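(* Let a PDE be of the form $$\partial_t^nu+\sum_{j=1}^m a_{n,j}\,\partial_t^n\partial_x^ju+\sum_{0\le i<n,\ 0\le j\le m}a_{i,j}\,\partial_t^i\partial_x^ju=0,\qquad n,m\in\mathbb{N},$$ with constant coefficients. Put $p_i(z)=-\sum_{j=0}^m a_{i-1,j}z^j$ for $i=1,\dots,n$ and $q(z)=1+\sum_{j=1}^m a_{n,j}z^j$, and let $\rho>0$ be such that $\{z\in\mathbb{C}:q(z)=0\}\subset\mathbb{C}\setminus\rho\overline{\mathbb{D}}$. Define $P:\mathbb{C}\times\overline{\rho\mathbb{D}}\to\mathbb{C}$ by $$P(\lambda,z):=p_1(z)+\dots+\lambda^{n-1}p_n(z)-\lambda^nq(z)=a_m(\lambda)z^m+\dots+a_1(\lambda)z+a_0(\lambda),$$ where $a_0,\dots,a_m$ are polynomials of degree at most $n$. Then the projection family of operators associated to the solution semigroup on $X_\rho^n$ is Devaney chaotic if and only if there are some $\lambda_0\in i\mathbb{R}$ and $z_0\in\rho\mathbb{D}$ such that $P(\lambda_0,z_0)=0$ and $\mathrm{disc}_z(P)(\lambda_0)\neq0$.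
   Context: $\mathbb{D}=\{z\in\mathbb{C}:|z|<1\}$. For $\rho>0$ the Herzog space is $X_\rho=\{f:\mathbb{R}\to\mathbb{C}: f(x)=\sum_{k\ge0}\frac{c_k\rho^k}{k!}x^k,\ (c_k)_{k\ge0}\in c_0(\mathbb{N}_0)\}$ with norm $\|f\|=\sup_k|c_k|$; $\partial_x$ is bounded on it with $\sigma(\partial_x)=\rho\overline{\mathbb{D}}$, and $(p_i/q)(\partial_x)$ is given by the Riesz–Dunford functional calculus. Setting $u_1=u$, $u_{i+1}=\partial_tu_i$, the PDE becomes the Cauchy problem $\partial_t(u_1,\dots,u_n)^T=A_d(u_1,\dots,u_n)^T$ with initial data in $X_\rho^n$ and $$A_d=\begin{pmatrix}0&I&0&\dots\\0&0&I&\dots\\ \vdots&\vdots&\vdots&\ddots\\ (p_1/q)(\partial_x)&(p_2/q)(\partial_x)&\dots&(p_n/q)(\partial_x)\end{pmatrix};$$ the solution semigroup is $(e^{tA_d})_{t\ge0}$ and the associated projection family is $(\pi\circ e^{tA_d}:X_\rho^n\to X_\rho)_{t\ge0}$, $\pi$ being the first coordinate projection. Discriminant: for a polynomial $r(z)=b_dz^d+\dots+b_0$ with $d\in\mathbb{N}$, $b_d\ne0$, $\mathrm{disc}(r)=\frac{(-1)^{d(d-1)/2}}{b_d}\mathrm{res}(r,r')$, where res is the resultant (the determinant of the Sylvester matrix). For a polynomial $P(\lambda,z)$ of two variables, $\mathrm{disc}_z(P)(\lambda)$ denotes the discriminant of the polynomial $P(\lambda,\cdot)$ for each fixed $\lambda\in\mathbb{C}$;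 it is in turn a polynomial in $\lambda$. A $C_0$-semigroup $(T_t)$ is Devaney chaotic if $\{T_tx:t\ge0\}$ is dense for some $x$ and the set of $x$ with $T_tx=x$ for some $t>0$ is dense. The projection family $(\pi\circ\mathcal{T}_t)$ of a $C_0$-semigroup $(\mathcal{T}_t)$ on $X^n$ is Devaney chaotic if there is a closed subspace $Y\ne\{0\}$ of $X^n$, invariant under $(\mathcal{T}_t)$, such that $(\mathcal{T}_t|_Y)$ is Devaney chaotic and $\overline{\pi(Y)}=X$.
   Formalization: The formal theorem also assumes that disc_z(P) has only finitely many zeros, i.e. is not identically zero; without this the equivalence fails, e.g. for u_tt − 2u_tx + u_xx = 0, where P = −(λ−z)² and disc_z(P) ≡ 0 but the projection family is chaotic. *)

theory Defs
  imports
    "HOL-Complex_Analysis.Complex_Analysis"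
    "Subresultants.Resultant_Prelim"
begin

section \<open>Herzog spaces\<close>

definition c0_seqs :: "(nat \<Rightarrow> complex) set" where
  "c0_seqs = {c. c \<longlonglongrightarrow> 0}"

definition herzog_series :: "real \<Rightarrow> (nat \<Rightarrow> complex) \<Rightarrow> real \<Rightarrow> complex" where
  "herzog_series \<rho> c x = (\<Sum>k. c k * of_real (\<rho> ^ k) / fact k * of_real (x ^ k))"

definition herzog_space :: "real \<Rightarrow> (real \<Rightarrow> complex) set" where
  "herzog_space \<rho> = herzog_series \<rho> ` c0_seqs"

definition herzog_coeff :: "real \<Rightarrow> (real \<Rightarrow> complex) \<Rightarrow> nat \<Rightarrow> complex" where
  "herzog_coeff \<rho> f = inv_into c0_seqs (herzog_series \<rho>) f"

definition herzog_norm :: "real \<Rightarrow> (real \<Rightarrow> complex) \<Rightarrow> real" where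
  "herzog_norm \<rho> f = (SUP k. cmod (herzog_coeff \<rho> f k))"

text \<open>The value \<open>0\<close> outside the space is irrelevant; the locale \<^locale>\<open>Metric_space\<close>
  demands non-negativity and symmetry on the whole type.\<close>

definition herzog_dist :: "real \<Rightarrow> (real \<Rightarrow> complex) \<Rightarrow> (real \<Rightarrow> complex) \<Rightarrow> real" where
  "herzog_dist \<rho> f g =
    (if f \<in> herzog_space \<rho> \<and> g \<in> herzog_space \<rho> then herzog_norm \<rho> (\<lambda>x. f x - g x) else 0)"

definition herzog_topology :: "real \<Rightarrow> (real \<Rightarrow> complex) topology" where
  "herzog_topology \<rho> = Metric_space.mtopology (herzog_space \<rho>) (herzog_dist \<rho>)"

text \<open>The elements of \<open>X\<^sub>\<rho>\<^sup>n\<close> are the families indexed by \<open>{1..n}\<close>,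
  extended by \<^const>\<open>undefined\<close> to all of \<^typ>\<open>nat\<close>.\<close>

definition herzog_power_topology :: "real \<Rightarrow> nat \<Rightarrow> (nat \<Rightarrow> real \<Rightarrow> complex) topology" where
  "herzog_power_topology \<rho> n = product_topology (\<lambda>_. herzog_topology \<rho>) {1..n}"

lemma herzog_series_summable:
  assumes "c \<in> c0_seqs"
  shows "summable (\<lambda>k. c k * of_real (\<rho> ^ k) / fact k * of_real (x ^ k))"
proof -
  have "Bseq c"
    using assms by (auto simp: c0_seqs_def intro: convergent_imp_Bseq convergentI)
  then obtain K where K: "\<And>k. norm (c k) \<le> K" unfolding Bseq_def by blast
  have "summable (\<lambda>k. K * (inverse (fact k) * \<bar>\<rho> * x\<bar> ^ k))"
    by (intro summable_mult summable_exp)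
  then show ?thesis
  proof (rule summable_comparison_test')
    fix k
    have "norm (c k * of_real (\<rho> ^ k) / fact k * of_real (x ^ k))
        = norm (c k) * (inverse (fact k) * \<bar>\<rho> * x\<bar> ^ k)"
      by (simp add: norm_mult norm_divide norm_power abs_mult power_mult_distrib field_simps)
    also have "\<dots> \<le> K * (inverse (fact k) * \<bar>\<rho> * x\<bar> ^ k)"
      by (intro mult_right_mono K) simp
    finally show "norm (c k * of_real (\<rho> ^ k) / fact k * of_real (x ^ k))
        \<le> K * (inverse (fact k) * \<bar>\<rho> * x\<bar> ^ k)" .
  qed
qed

lemma real_power_series_eq_0:
  fixes a :: "nat \<Rightarrow> real"
  assumes "\<And>x. (\<lambda>k. a k * x ^ k) sums 0"
  shows "a k = 0"
proof (induction k rule: less_induct)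
  case (less k)
  have s: "(\<lambda>j. a (j + k) * x ^ j) sums 0" if "x \<noteq> 0" for x
  proof -
    have "(\<lambda>j. a (j + k) * x ^ (j + k)) sums (0 - (\<Sum>i<k. a i * x ^ i))"
      using assms[of x] by (rule sums_split_initial_segment)
    then have "(\<lambda>j. a (j + k) * x ^ (j + k)) sums 0" using less by simp
    then have "(\<lambda>j. a (j + k) * x ^ (j + k) / x ^ k) sums (0 / x ^ k)" by (rule sums_divide)
    then show ?thesis using that by (simp add: power_add)
  qed
  have "((\<lambda>x::real. 0) \<longlongrightarrow> a (0 + k)) (at 0)"
    by (rule powser_limit_0_strong[of 1 "\<lambda>j. a (j + k)"]) (use s in auto)
  then show ?case by (simp add: tendsto_const_iff)
qed

lemma herzog_series_inj:
  assumes "\<rho> > 0"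
  shows "inj_on (herzog_series \<rho>) c0_seqs"
proof (rule inj_onI)
  fix c d assume c: "c \<in> c0_seqs" and d: "d \<in> c0_seqs"
    and eq: "herzog_series \<rho> c = herzog_series \<rho> d"
  define e where "e k = (c k - d k) * of_real (\<rho> ^ k) / fact k" for k
  have sums: "(\<lambda>k. e k * of_real (x ^ k)) sums 0" for x :: real
  proof -
    have "(\<lambda>k. c k * of_real (\<rho> ^ k) / fact k * of_real (x ^ k)
        - d k * of_real (\<rho> ^ k) / fact k * of_real (x ^ k))
        sums (herzog_series \<rho> c x - herzog_series \<rho> d x)"
      unfolding herzog_series_def by (intro sums_diff summable_sums herzog_series_summable c d)
    then show ?thesis using eq by (simp add: e_def algebra_simps diff_divide_distrib)
  qed
  have "Re (e k) = 0" for k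
    using sums_Re[OF sums] by (intro real_power_series_eq_0) simp
  moreover have "Im (e k) = 0" for k
    using sums_Im[OF sums] by (intro real_power_series_eq_0) simp
  ultimately have "e k = 0" for k by (simp add: complex_eq_iff)
  then show "c = d" using assms by (simp add: e_def fun_eq_iff)
qed

lemma herzog_coeff_series:
  assumes "\<rho> > 0" "c \<in> c0_seqs"
  shows "herzog_coeff \<rho> (herzog_series \<rho> c) = c"
  unfolding herzog_coeff_def using herzog_series_inj[OF assms(1)] assms(2) by (rule inv_into_f_f)

lemma Metric_space_herzog:
  assumes "\<rho> > 0"
  shows "Metric_space (herzog_space \<rho>) (herzog_dist \<rho>)"
proof -
  have dist: "herzog_dist \<rho> (herzog_series \<rho> c) (herzog_series \<rho> d) = (SUP k. cmod (c k - d k))"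
    and bdd: "bdd_above (range (\<lambda>k. cmod (c k - d k)))"
    if "c \<in> c0_seqs" "d \<in> c0_seqs" for c d
  proof -
    have cd: "(\<lambda>k. c k - d k) \<in> c0_seqs"
      using that tendsto_diff[of c 0 sequentially d 0] by (simp add: c0_seqs_def)
    have "(\<lambda>x. herzog_series \<rho> c x - herzog_series \<rho> d x) = herzog_series \<rho> (\<lambda>k. c k - d k)"
      unfolding herzog_series_def
      by (subst suminf_diff[OF herzog_series_summable herzog_series_summable])
        (simp_all only: that left_diff_distrib diff_divide_distrib)
    then show "herzog_dist \<rho> (herzog_series \<rho> c) (herzog_series \<rho> d) = (SUP k. cmod (c k - d k))"
      using that
      by (simp add: herzog_dist_def herzog_norm_def herzog_space_def herzog_coeff_series[OF assms cd])
    have "Bseq (\<lambda>k. c k - d k)"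
      using cd by (auto simp: c0_seqs_def intro: convergent_imp_Bseq convergentI)
    then show "bdd_above (range (\<lambda>k. cmod (c k - d k)))"
      unfolding Bseq_def by (auto intro: bdd_aboveI2)
  qed
  have nonneg: "(SUP k. cmod (c k - d k)) \<ge> 0" if "c \<in> c0_seqs" "d \<in> c0_seqs" for c d
    by (rule cSUP_upper2[OF bdd[OF that] UNIV_I]) simp
  have zero: "(SUP k. cmod (c k - d k)) = 0 \<longleftrightarrow> c = d" if "c \<in> c0_seqs" "d \<in> c0_seqs" for c d
  proof
    assume *: "(SUP k. cmod (c k - d k)) = 0"
    have "cmod (c k - d k) \<le> 0" for k
      using cSUP_upper[OF UNIV_I[of k] bdd[OF that]] * by simp
    then show "c = d" by (simp add: fun_eq_iff)
  qed simp
  have tri: "(SUP k. cmod (c k - e k)) \<le> (SUP k. cmod (c k - d k)) + (SUP k. cmod (d k - e k))"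
    if "c \<in> c0_seqs" "d \<in> c0_seqs" "e \<in> c0_seqs" for c d e
  proof (rule cSUP_least)
    fix k
    have "cmod (c k - e k) \<le> cmod (c k - d k) + cmod (d k - e k)"
      using norm_triangle_ineq[of "c k - d k" "d k - e k"] by simp
    also have "\<dots> \<le> (SUP k. cmod (c k - d k)) + (SUP k. cmod (d k - e k))"
      by (intro add_mono cSUP_upper bdd that UNIV_I)
    finally show "cmod (c k - e k) \<le> (SUP k. cmod (c k - d k)) + (SUP k. cmod (d k - e k))" .
  qed simp
  show ?thesis
  proof
    fix f g :: "real \<Rightarrow> complex"
    show "0 \<le> herzog_dist \<rho> f g"
    proof (cases "f \<in> herzog_space \<rho> \<and> g \<in> herzog_space \<rho>")
      case True
      then show ?thesis by (auto simp: herzog_space_def dist nonneg)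
    qed (auto simp: herzog_dist_def)
    show "herzog_dist \<rho> f g = herzog_dist \<rho> g f"
    proof (cases "f \<in> herzog_space \<rho> \<and> g \<in> herzog_space \<rho>")
      case True
      then show ?thesis by (auto simp: herzog_space_def dist norm_minus_commute)
    qed (auto simp: herzog_dist_def)
  next
    fix f g assume "f \<in> herzog_space \<rho>" "g \<in> herzog_space \<rho>"
    then obtain c d where c: "f = herzog_series \<rho> c" "c \<in> c0_seqs"
      and d: "g = herzog_series \<rho> d" "d \<in> c0_seqs"
      unfolding herzog_space_def by blast
    show "herzog_dist \<rho> f g = 0 \<longleftrightarrow> f = g"
      unfolding c(1) d(1) dist[OF c(2) d(2)] zero[OF c(2) d(2)]
      using inj_on_eq_iff[OF herzog_series_inj[OF assms] c(2) d(2)] by (rule sym)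
  next
    fix f g h assume "f \<in> herzog_space \<rho>" "g \<in> herzog_space \<rho>" "h \<in> herzog_space \<rho>"
    then obtain c d e where c: "f = herzog_series \<rho> c" "c \<in> c0_seqs"
      and d: "g = herzog_series \<rho> d" "d \<in> c0_seqs"
      and e: "h = herzog_series \<rho> e" "e \<in> c0_seqs"
      unfolding herzog_space_def by blast
    show "herzog_dist \<rho> f h \<le> herzog_dist \<rho> f g + herzog_dist \<rho> g h"
      unfolding c(1) d(1) e(1) dist[OF c(2) d(2)] dist[OF c(2) e(2)] dist[OF d(2) e(2)]
      by (rule tri[OF c(2) d(2) e(2)])
  qed
qed

section \<open>Riesz--Dunford calculus and the solution semigroup\<close>

definition dx :: "(real \<Rightarrow> complex) \<Rightarrow> real \<Rightarrow> complex" where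
  "dx f x = vector_derivative f (at x)"

definition herzog_spectrum ::
    "real \<Rightarrow> ((real \<Rightarrow> complex) \<Rightarrow> real \<Rightarrow> complex) \<Rightarrow> complex set" where
  "herzog_spectrum \<rho> T = {\<zeta>. \<not> (
     bij_betw (\<lambda>h x. \<zeta> * h x - T h x) (herzog_space \<rho>) (herzog_space \<rho>) \<and>
     (\<exists>C. \<forall>h\<in>herzog_space \<rho>. herzog_norm \<rho> h \<le> C * herzog_norm \<rho> (\<lambda>x. \<zeta> * h x - T h x)))}"

definition herzog_resolvent ::
    "real \<Rightarrow> ((real \<Rightarrow> complex) \<Rightarrow> real \<Rightarrow> complex) \<Rightarrow> complex \<Rightarrow>
      (real \<Rightarrow> complex) \<Rightarrow> real \<Rightarrow> complex" where
  "herzog_resolvent \<rho> T \<zeta> = inv_into (herzog_space \<rho>) (\<lambda>h x. \<zeta> * h x - T h x)"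

text \<open>The gauge integral over \<open>[0,1]\<close> of a function with values in \<open>X\<^sub>\<rho>\<close>, in the norm of
  \<open>X\<^sub>\<rho>\<close>; cf. the characterisation \<open>has_integral\<close> of the integral of vector-valued
  functions.\<close>

definition has_herzog_integral ::
    "real \<Rightarrow> (real \<Rightarrow> real \<Rightarrow> complex) \<Rightarrow> (real \<Rightarrow> complex) \<Rightarrow> bool" where
  "has_herzog_integral \<rho> F y \<longleftrightarrow> y \<in> herzog_space \<rho> \<and>
     (\<forall>e>0. \<exists>\<gamma>. gauge \<gamma> \<and> (\<forall>\<D>. \<D> tagged_division_of {0..1} \<and> \<gamma> fine \<D> \<longrightarrow>
        herzog_norm \<rho> (\<lambda>x. (\<Sum>(t, K)\<in>\<D>. of_real (measure lborel K) * F t x) - y x) < e))"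

text \<open>\<open>g(T) f = 1/(2\<pi>i) \<integral> g(\<zeta>) (\<zeta> - T)\<^sup>-\<^sup>1 f d\<zeta>\<close>, the contour being a circle about
  \<open>0\<close> that encloses the spectrum, with \<open>g\<close> holomorphic on a neighbourhood of the closed
  disc; the value does not depend on the radius. Such contours suffice for functions
  holomorphic near a disc about \<open>0\<close> containing the spectrum of \<open>T\<close>.\<close>

definition riesz_dunford ::
    "real \<Rightarrow> ((real \<Rightarrow> complex) \<Rightarrow> real \<Rightarrow> complex) \<Rightarrow> (complex \<Rightarrow> complex) \<Rightarrow>
      (real \<Rightarrow> complex) \<Rightarrow> real \<Rightarrow> complex" where
  "riesz_dunford \<rho> T g f = (THE y. \<exists>r>0.
     herzog_spectrum \<rho> T \<subseteq> ball 0 r \<and> g analytic_on cball 0 r \<and>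
     has_herzog_integral \<rho>
       (\<lambda>t x. 1 / (2 * of_real pi * \<i>) * vector_derivative (circlepath 0 r) (at t within {0..1}) *
          g (circlepath 0 r t) * herzog_resolvent \<rho> T (circlepath 0 r t) f x) y)"

text \<open>\<open>a i j\<close> is the coefficient of \<open>\<partial>\<^sub>t\<^sup>i \<partial>\<^sub>x\<^sup>j u\<close>; the value \<open>a n 0\<close> is not
  used, the coefficient of \<open>\<partial>\<^sub>t\<^sup>n u\<close> being \<open>1\<close>.\<close>

definition pde_p :: "nat \<Rightarrow> (nat \<Rightarrow> nat \<Rightarrow> complex) \<Rightarrow> nat \<Rightarrow> complex poly" where
  "pde_p m a i = - (\<Sum>j=0..m. monom (a (i - 1) j) j)"

definition pde_q :: "nat \<Rightarrow> nat \<Rightarrow> (nat \<Rightarrow> nat \<Rightarrow> complex) \<Rightarrow> complex poly" where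
  "pde_q n m a = 1 + (\<Sum>j=1..m. monom (a n j) j)"

definition pde_P :: "nat \<Rightarrow> nat \<Rightarrow> (nat \<Rightarrow> nat \<Rightarrow> complex) \<Rightarrow> complex \<Rightarrow> complex poly" where
  "pde_P n m a \<mu> =
     (\<Sum>i=1..n. Polynomial.smult (\<mu> ^ (i - 1)) (pde_p m a i)) - Polynomial.smult (\<mu> ^ n) (pde_q n m a)"

definition pde_operator ::
    "real \<Rightarrow> nat \<Rightarrow> nat \<Rightarrow> (nat \<Rightarrow> nat \<Rightarrow> complex) \<Rightarrow>
      (nat \<Rightarrow> real \<Rightarrow> complex) \<Rightarrow> nat \<Rightarrow> real \<Rightarrow> complex" where
  "pde_operator \<rho> n m a u = (\<lambda>i\<in>{1..n}.
     if i < n then u (i + 1)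
     else (\<lambda>x. \<Sum>j=1..n.
       riesz_dunford \<rho> dx (\<lambda>z. poly (pde_p m a j) z / poly (pde_q n m a) z) (u j) x))"

definition herzog_exp ::
    "real \<Rightarrow> nat \<Rightarrow> ((nat \<Rightarrow> real \<Rightarrow> complex) \<Rightarrow> nat \<Rightarrow> real \<Rightarrow> complex) \<Rightarrow> real \<Rightarrow>
      (nat \<Rightarrow> real \<Rightarrow> complex) \<Rightarrow> nat \<Rightarrow> real \<Rightarrow> complex" where
  "herzog_exp \<rho> n A t u = (THE v. limitin (herzog_power_topology \<rho> n)
     (\<lambda>N. \<lambda>i\<in>{1..n}. \<lambda>x. \<Sum>k<N. of_real (t ^ k / fact k) * (A ^^ k) u i x) v sequentially)"

definition solution_semigroup ::
    "real \<Rightarrow> nat \<Rightarrow> nat \<Rightarrow> (nat \<Rightarrow> nat \<Rightarrow> complex) \<Rightarrow> real \<Rightarrow>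
      (nat \<Rightarrow> real \<Rightarrow> complex) \<Rightarrow> nat \<Rightarrow> real \<Rightarrow> complex" where
  "solution_semigroup \<rho> n m a = herzog_exp \<rho> n (pde_operator \<rho> n m a)"

section \<open>Devaney chaos\<close>

definition devaney_chaotic :: "'a topology \<Rightarrow> (real \<Rightarrow> 'a \<Rightarrow> 'a) \<Rightarrow> bool" where
  "devaney_chaotic X T \<longleftrightarrow>
     (\<exists>x\<in>topspace X. X closure_of {T t x |t. t \<ge> 0} = topspace X) \<and>
     X closure_of {x \<in> topspace X. \<exists>t>0. T t x = x} = topspace X"

definition herzog_closed_subspace :: "real \<Rightarrow> nat \<Rightarrow> (nat \<Rightarrow> real \<Rightarrow> complex) set \<Rightarrow> bool" where
  "herzog_closed_subspace \<rho> n Y \<longleftrightarrow>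
     closedin (herzog_power_topology \<rho> n) Y \<and>
     (\<lambda>i\<in>{1..n}. \<lambda>x. 0) \<in> Y \<and>
     (\<forall>u\<in>Y. \<forall>v\<in>Y. (\<lambda>i\<in>{1..n}. \<lambda>x. u i x + v i x) \<in> Y) \<and>
     (\<forall>c. \<forall>u\<in>Y. (\<lambda>i\<in>{1..n}. \<lambda>x. c * u i x) \<in> Y)"

definition projection_family_chaotic ::
    "real \<Rightarrow> nat \<Rightarrow> (real \<Rightarrow> (nat \<Rightarrow> real \<Rightarrow> complex) \<Rightarrow> nat \<Rightarrow> real \<Rightarrow> complex) \<Rightarrow> bool" where
  "projection_family_chaotic \<rho> n T \<longleftrightarrow>
     (\<exists>Y. herzog_closed_subspace \<rho> n Y \<and> Y \<noteq> {(\<lambda>i\<in>{1..n}. \<lambda>x. 0)} \<and>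
        (\<forall>t\<ge>0. T t ` Y \<subseteq> Y) \<and>
        devaney_chaotic (subtopology (herzog_power_topology \<rho> n) Y) T \<and>
        herzog_topology \<rho> closure_of ((\<lambda>u. u 1) ` Y) = herzog_space \<rho>)"

section \<open>Discriminant\<close>

text \<open>The degree here is the actual degree of \<open>r\<close>. Outside the usual range of positive degree, the
  formula gives the value \<open>1 / c\<close> for a constant \<open>c \<noteq> 0\<close> and, by division by
  zero, \<open>0\<close> for \<open>r = 0\<close>.\<close>

definition disc :: "complex poly \<Rightarrow> complex" where
  "disc r = (- 1) ^ (degree r * (degree r - 1) div 2) / lead_coeff r * resultant r (pderiv r)"

text \<open>Let \<open>d\<close> be the degree of \<open>P(\<mu>, z)\<close> in \<open>z\<close>, with leading coefficient \<open>a\<^sub>d(\<mu>)\<close>.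
  Off the finitely many zeros of \<open>a\<^sub>d\<close> the following is a polynomial function of \<open>\<mu>\<close> if
  \<open>d > 0\<close>. In that case its zero set is finite
  iff this polynomial is not the zero polynomial, that is, iff \<open>P\<close> has no repeated factor of
  positive degree in \<open>z\<close>.\<close>

definition disc_z :: "nat \<Rightarrow> nat \<Rightarrow> (nat \<Rightarrow> nat \<Rightarrow> complex) \<Rightarrow> complex \<Rightarrow> complex" where
  "disc_z n m a \<mu> = disc (pde_P n m a \<mu>)"

end

theory Submission
  imports Defs
begin

text \<open>A Herzog series is determined by its coefficients \<open>c \<in> c\<^sub>0\<close>, the norm is the supremum norm of
  \<open>c\<close>, and \<open>\<partial>\<^sub>x\<close> becomes \<open>\<rho>\<close> times the backward shift. So \<open>X\<^sub>\<rho>\<^sup>n\<close> is isometric to the \<open>n\<close>-tuples of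
  null sequences, and the whole question can be treated for bounded operators on a Banach space of
  sequences. For such an operator \<open>A\<close> and a function \<open>f\<close> holomorphic on a disc about \<open>0\<close> of radius larger than
  \<open>\<parallel>A\<parallel>\<close>, the sum of \<open>f\<^sub>k A\<^sup>k\<close> over the Taylor coefficients \<open>f\<^sub>k\<close> is a multiplicative functional
  calculus. It agrees with the Riesz--Dunford integral (\<open>riesz_dunford_hser\<close>) and also yields
  \<open>exp (t A)\<close>.

  If \<open>P(\<mu>, z) = 0\<close> with \<open>\<bar>z\<bar> < \<rho>\<close>, then \<open>(e\<^sub>z, \<mu> e\<^sub>z, \<dots>, \<mu>\<^sup>n\<^sup>-\<^sup>1 e\<^sub>z)\<close> with
  \<open>e\<^sub>z(x) = exp (z x)\<close> is an eigenvector of the companion operator \<open>A\<^sub>d\<close> for the eigenvalue \<open>\<mu>\<close>.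

  A nonzero discriminant at \<open>\<mu>\<^sub>0\<close> makes \<open>z\<^sub>0\<close> a simple root of \<open>P(\<mu>\<^sub>0, \<cdot>)\<close>, so that there is an analytic
  branch \<open>\<zeta>\<close> of roots with \<open>\<zeta>(\<mu>\<^sub>0) = z\<^sub>0\<close>, and hence an analytic family of eigenvectors \<open>v(\<mu>)\<close> near \<open>\<mu>\<^sub>0\<close>.
  The eigenvalues in the left half plane, those in the right half plane and those in
  \<open>2\<pi>\<i>\<rat>\<close> all accumulate at \<open>\<mu>\<^sub>0 \<in> \<i>\<real>\<close>. By the identity theorem the
  three corresponding sets of eigenvectors have the same closed span \<open>Y\<close>. The first two give a transitive
  semigroup on \<open>Y\<close>, hence a dense orbit by Baire's theorem, and the third gives a dense set of periodic points
  (\<open>chaos_of_eigenvector_family\<close>). The branch \<open>\<zeta>\<close> is not constant, because \<open>P(\<cdot>, z\<^sub>0)\<close> has leading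
  coefficient \<open>- q(z\<^sub>0) \<noteq> 0\<close>, so the exponentials \<open>e\<^sub>\<zeta>\<^sub>(\<^sub>\<mu>\<^sub>)\<close> in the first coordinate span a dense
  subspace (\<open>expo_total\<close>).

  Conversely, let \<open>exp (t A) u = u\<close> with \<open>t > 0\<close>. As \<open>A\<close> is bounded, only the finitely many zeros of
  \<open>exp (t z) - 1\<close> in a disc matter, and \<open>u\<close> is a finite sum of eigenvectors for imaginary eigenvalues. If all
  imaginary eigenvalues lay in the finite zero set of the discriminant, then the dense set of periodic points, and with
  it all of \<open>Y\<close>, would be annihilated by one polynomial in \<open>A\<close> with simple imaginary roots. Then every orbit in
  \<open>Y\<close> would be bounded, and none dense (\<open>chaos_implies_imaginary_eigenvalue\<close>). So there is an imaginary
  eigenvalue \<open>\<mu>\<close> with nonzero discriminant. Its eigenvector gives a nonzero null sequence in the kernel of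
  \<open>P(\<mu>, \<partial>\<^sub>x)\<close>, and this kernel is trivial unless \<open>P(\<mu>, \<cdot>)\<close> has a root in the open disc
  (\<open>eigenvector_root\<close>).\<close>

section \<open>Complex Banach spaces\<close>

text \<open>A real Banach space with a compatible multiplication by complex scalars. Bounded functions with
  values in such a space form another one. This is used twice, for sequences of coefficients and for tuples of such
  sequences.\<close>

class cbanach = banach +
  fixes scaleC :: "complex \<Rightarrow> 'a \<Rightarrow> 'a" (infixr \<open>*\<^sub>C\<close> 75)
  assumes scaleC_add_right: "c *\<^sub>C (x + y) = c *\<^sub>C x + c *\<^sub>C y"
    and scaleC_add_left: "(c + d) *\<^sub>C x = c *\<^sub>C x + d *\<^sub>C x"
    and scaleC_scaleC: "c *\<^sub>C d *\<^sub>C x = (c * d) *\<^sub>C x"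
    and scaleC_of_real: "of_real r *\<^sub>C x = r *\<^sub>R x"
    and norm_scaleC: "norm (c *\<^sub>C x) = cmod c * norm x"

instantiation complex :: cbanach
begin
definition scaleC_complex :: "complex \<Rightarrow> complex \<Rightarrow> complex" where
  "scaleC_complex c z = c * z"
instance
  by standard (auto simp: scaleC_complex_def algebra_simps norm_mult scaleR_conv_of_real)
end

lemma bounded_bilinear_scaleC: "bounded_bilinear (scaleC :: complex \<Rightarrow> 'a \<Rightarrow> 'a::cbanach)"
proof
  fix r :: real and c :: complex and x :: 'a
  show "(r *\<^sub>R c) *\<^sub>C x = r *\<^sub>R (c *\<^sub>C x)"
    by (metis scaleC_of_real scaleC_scaleC scaleR_conv_of_real)
  show "c *\<^sub>C (r *\<^sub>R x) = r *\<^sub>R (c *\<^sub>C x)"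
    by (simp add: scaleC_of_real[symmetric] scaleC_scaleC mult.commute)
  show "\<exists>K. \<forall>a b. norm (a *\<^sub>C (b::'a)) \<le> norm a * norm b * K"
    by (rule exI[of _ 1]) (simp add: norm_scaleC)
qed (simp_all add: scaleC_add_right scaleC_add_left)

interpretation scaleC: bounded_bilinear "scaleC :: complex \<Rightarrow> 'a \<Rightarrow> 'a::cbanach"
  by (rule bounded_bilinear_scaleC)

lemmas tendsto_scaleC [tendsto_intros] = scaleC.tendsto
lemmas continuous_on_scaleC [continuous_intros] = scaleC.continuous_on

lemma scaleC_one [simp]: "1 *\<^sub>C x = (x :: 'a::cbanach)"
  using scaleC_of_real[of 1 x] by simp

lemma scaleC_zero [simp]: "0 *\<^sub>C x = (0 :: 'a::cbanach)" "c *\<^sub>C (0 :: 'a) = 0"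
  by (simp_all add: scaleC.zero_left scaleC.zero_right)

lemma scaleC_eq_0_iff [simp]: "c *\<^sub>C x = (0 :: 'a::cbanach) \<longleftrightarrow> c = 0 \<or> x = 0"
  by (metis mult_eq_0_iff norm_eq_zero norm_scaleC)

lemma sums_scaleC_right: "f sums s \<Longrightarrow> (\<lambda>k. c *\<^sub>C f k) sums (c *\<^sub>C s)" for s :: "'a::cbanach"
  by (rule bounded_linear.sums[OF scaleC.bounded_linear_right])

lemma sums_scaleC_left: "f sums s \<Longrightarrow> (\<lambda>k. f k *\<^sub>C x) sums (s *\<^sub>C x)" for x :: "'a::cbanach"
  by (rule bounded_linear.sums[OF scaleC.bounded_linear_left])

lemma scaleC_minus_one: "(-1) *\<^sub>C x = - (x :: 'a::cbanach)"
  by (simp add: scaleC.minus_left)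

text \<open>Completeness of the space of bounded continuous functions refers to a metric on their domain;
  the metric induces the discrete topology that \<open>nat\<close> already carries.\<close>

instantiation nat :: metric_space
begin

definition dist_nat :: "nat \<Rightarrow> nat \<Rightarrow> real" where
  "dist_nat m n = \<bar>real m - real n\<bar>"

definition uniformity_nat :: "(nat \<times> nat) filter" where
  "uniformity_nat = (INF e\<in>{0<..}. principal {(x, y). dist x y < e})"

instance
proof
  fix U :: "nat set"
  have eq: "m = n" if "\<bar>real m - real n\<bar> < 1" for m n
    using that by linarith
  have "(uniformity :: (nat \<times> nat) filter) \<le> principal {(x, y). dist x y < 1}"
    unfolding uniformity_nat_def by (rule INF_lower) simp
  then have "\<forall>\<^sub>F (x', y) in uniformity. x' = x \<longrightarrow> y \<in> U" if "x \<in> U" for x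
    by (rule filter_leD) (use that in \<open>auto simp: eventually_principal dist_nat_def dest: eq\<close>)
  then show "open U = (\<forall>x\<in>U. \<forall>\<^sub>F (x', y) in uniformity. x' = x \<longrightarrow> y \<in> U)"
    by (simp add: open_discrete)
qed (auto simp: dist_nat_def uniformity_nat_def)

end

instance bcontfun :: (metric_space, banach) banach ..

lemma scaleC_bcontfun:
  fixes f :: "'a::metric_space \<Rightarrow>\<^sub>C 'b::cbanach"
  shows "(\<lambda>x. c *\<^sub>C apply_bcontfun f x) \<in> bcontfun"
proof (rule bcontfun_normI)
  show "continuous_on UNIV (\<lambda>x. c *\<^sub>C apply_bcontfun f x)"
    by (intro continuous_intros continuous_on_apply_bcontfun)
  show "norm (c *\<^sub>C apply_bcontfun f x) \<le> cmod c * norm f" for x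
    by (simp add: norm_scaleC mult_left_mono norm_bounded)
qed

instantiation bcontfun :: (metric_space, cbanach) cbanach
begin

definition scaleC_bcontfun :: "complex \<Rightarrow> ('a, 'b) bcontfun \<Rightarrow> ('a, 'b) bcontfun" where
  "scaleC_bcontfun c f = Bcontfun (\<lambda>x. c *\<^sub>C apply_bcontfun f x)"

lemma scaleC_bcontfun_apply [simp]:
  "apply_bcontfun (c *\<^sub>C f) x = c *\<^sub>C apply_bcontfun f x" for f :: "('a, 'b) bcontfun"
  by (simp add: scaleC_bcontfun_def Bcontfun_inverse scaleC_bcontfun)

instance
proof
  fix c d :: complex and r :: real and f g :: "('a, 'b) bcontfun"
  show "c *\<^sub>C (f + g) = c *\<^sub>C f + c *\<^sub>C g"
    by (rule bcontfun_eqI) (simp add: scaleC_add_right)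
  show "(c + d) *\<^sub>C f = c *\<^sub>C f + d *\<^sub>C f"
    by (rule bcontfun_eqI) (simp add: scaleC_add_left)
  show "c *\<^sub>C d *\<^sub>C f = (c * d) *\<^sub>C f"
    by (rule bcontfun_eqI) (simp add: scaleC_scaleC)
  show "of_real r *\<^sub>C f = r *\<^sub>R f"
    by (rule bcontfun_eqI) (simp add: scaleC_of_real)
  have le: "norm (c *\<^sub>C h) \<le> cmod c * norm h" for c and h :: "('a, 'b) bcontfun"
    by (rule norm_bound) (simp add: norm_scaleC mult_left_mono norm_bounded)
  show "norm (c *\<^sub>C f) = cmod c * norm f"
  proof (cases "c = 0")
    case True
    then show ?thesis using le[of 0 f] by simp
  next
    case False
    have "norm f = norm (inverse c *\<^sub>C c *\<^sub>C f)"
      by (rule arg_cong[where f = norm], rule bcontfun_eqI) (simp add: scaleC_scaleC False)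
    also have "\<dots> \<le> cmod (inverse c) * norm (c *\<^sub>C f)" by (rule le)
    finally have "cmod c * norm f \<le> norm (c *\<^sub>C f)"
      using False by (simp add: norm_inverse norm_divide divide_simps mult.commute)
    with le[of c f] show ?thesis by simp
  qed
qed

end

definition csubspace :: "'a::cbanach set \<Rightarrow> bool" where
  "csubspace W \<longleftrightarrow> subspace W \<and> (\<forall>c. \<forall>x\<in>W. c *\<^sub>C x \<in> W)"

lemma csubspaceD:
  assumes "csubspace W"
  shows "0 \<in> W" "x \<in> W \<Longrightarrow> y \<in> W \<Longrightarrow> x + y \<in> W" "x \<in> W \<Longrightarrow> y \<in> W \<Longrightarrow> x - y \<in> W"
    "x \<in> W \<Longrightarrow> c *\<^sub>C x \<in> W" "(\<And>i. i \<in> I \<Longrightarrow> f i \<in> W) \<Longrightarrow> sum f I \<in> W"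
  using assms by (auto simp: csubspace_def subspace_0 subspace_add subspace_diff subspace_sum)

section \<open>Functional calculus for bounded operators\<close>

definition taylor :: "(complex \<Rightarrow> complex) \<Rightarrow> nat \<Rightarrow> complex" where
  "taylor f k = (deriv ^^ k) f 0 / fact k"

text \<open>The Riesz--Dunford calculus for functions holomorphic on a disc about \<open>0\<close> of radius larger than the
  norm of \<open>A\<close>, expressed by the Taylor expansion at \<open>0\<close>.\<close>

definition fcalc :: "('a::cbanach \<Rightarrow> 'a) \<Rightarrow> (complex \<Rightarrow> complex) \<Rightarrow> 'a \<Rightarrow> 'a" where
  "fcalc A f u = (\<Sum>k. taylor f k *\<^sub>C (A ^^ k) u)"

lemma taylor_sums:
  assumes "f holomorphic_on ball 0 R" "cmod z < R"
  shows "(\<lambda>k. taylor f k * z ^ k) sums f z"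
  using holomorphic_power_series[OF assms(1), of z] assms(2) by (simp add: taylor_def)

lemma taylor_abs_summable:
  assumes "f holomorphic_on ball 0 R" "0 \<le> r" "r < R"
  shows "summable (\<lambda>k. cmod (taylor f k) * r ^ k)"
proof -
  obtain s where s: "r < s" "s < R" using assms dense by blast
  have "summable (\<lambda>k. taylor f k * of_real s ^ k)"
    using taylor_sums[OF assms(1), of "of_real s"] s assms by (auto simp: sums_iff)
  then have "summable (\<lambda>k. norm (taylor f k * of_real r ^ k))"
    by (rule powser_insidea) (use s assms in auto)
  then show ?thesis using assms by (simp add: norm_mult norm_power)
qed

lemma taylor_mult:
  assumes "f holomorphic_on ball 0 R" "g holomorphic_on ball 0 R" "R > 0"
  shows "taylor (\<lambda>z. f z * g z) k = (\<Sum>i\<le>k. taylor f i * taylor g (k - i))"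
proof -
  have "(deriv ^^ k) (\<lambda>w. f w * g w) 0 =
      (\<Sum>i = 0..k. of_nat (k choose i) * (deriv ^^ i) f 0 * (deriv ^^ (k - i)) g 0)"
    by (rule higher_deriv_mult) (use assms in auto)
  also have "\<dots> = (\<Sum>i\<le>k. fact k * (taylor f i * taylor g (k - i)))"
    unfolding atMost_atLeast0
    by (rule sum.cong) (auto simp: taylor_def binomial_fact field_simps)
  finally show ?thesis by (simp add: taylor_def[of "\<lambda>z. f z * g z"] sum_distrib_left[symmetric])
qed

lemma taylor_add:
  assumes "f holomorphic_on ball 0 R" "g holomorphic_on ball 0 R" "R > 0"
  shows "taylor (\<lambda>z. f z + g z) k = taylor f k + taylor g k"
  using higher_deriv_add[OF assms(1,2) open_ball, of 0 k] assms(3)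
  by (simp add: taylor_def add_divide_distrib)

lemma taylor_cong:
  assumes "\<And>z. z \<in> ball 0 R \<Longrightarrow> f z = g z" "R > 0"
  shows "taylor f k = taylor g k"
proof -
  have "\<forall>\<^sub>F z in nhds 0. f z = g z"
    using assms by (intro eventually_nhds_in_open[of "ball 0 R", THEN eventually_mono]) auto
  then show ?thesis
    unfolding taylor_def by (subst higher_deriv_cong_ev) auto
qed

lemma taylor_const: "taylor (\<lambda>z. c) k = (if k = 0 then c else 0)"
  by (simp add: taylor_def)

lemma taylor_ident: "taylor (\<lambda>z. z) k = (if k = 1 then 1 else 0)"
  by (simp add: taylor_def)

lemma fcalc_cong:
  assumes "\<And>z. z \<in> ball 0 R \<Longrightarrow> f z = g z" "R > 0"
  shows "fcalc A f = fcalc A g"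
  using taylor_cong[OF assms] by (simp add: fcalc_def fun_eq_iff)

text \<open>The bound \<open>r\<close> is kept explicit, since the functional calculus is available for functions
  holomorphic on some disc of radius \<open>R > r\<close>.\<close>

locale cbounded_op =
  fixes A :: "'a::cbanach \<Rightarrow> 'a" and r :: real
  assumes add: "A (x + y) = A x + A y"
    and scale: "A (c *\<^sub>C x) = c *\<^sub>C A x"
    and bound: "norm (A x) \<le> r * norm x"
    and nonneg: "r \<ge> 0"
begin

lemma pow_add: "(A ^^ k) (x + y) = (A ^^ k) x + (A ^^ k) y"
  by (induction k) (auto simp: add)

lemma pow_scale: "(A ^^ k) (c *\<^sub>C x) = c *\<^sub>C (A ^^ k) x"
  by (induction k) (auto simp: scale)

lemma pow_bound: "norm ((A ^^ k) x) \<le> r ^ k * norm x"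
proof (induction k)
  case (Suc k)
  have "norm ((A ^^ Suc k) x) \<le> r * norm ((A ^^ k) x)" by (simp add: bound)
  also have "\<dots> \<le> r * (r ^ k * norm x)" by (intro mult_left_mono Suc nonneg)
  finally show ?case by (simp add: mult.assoc)
qed simp

lemma pow_bounded_linear: "bounded_linear (A ^^ k)"
proof (rule bounded_linear_intro[where K = "r ^ k"])
  show "(A ^^ k) (s *\<^sub>R x) = s *\<^sub>R (A ^^ k) x" for s x
    using pow_scale[of k "of_real s" x] by (simp add: scaleC_of_real)
qed (use pow_add pow_bound in \<open>auto simp: mult.commute\<close>)

lemma bounded_linear: "bounded_linear A"
  using pow_bounded_linear[of 1] by simp

lemma fcalc_summable_norm:
  assumes "f holomorphic_on ball 0 R" "r < R"
  shows "summable (\<lambda>k. norm (taylor f k *\<^sub>C (A ^^ k) u))"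
proof (rule summable_comparison_test'[where N = 0])
  show "summable (\<lambda>k. cmod (taylor f k) * r ^ k * norm u)"
    by (intro summable_mult2 taylor_abs_summable[OF assms(1)] assms nonneg)
  show "norm (norm (taylor f k *\<^sub>C (A ^^ k) u)) \<le> cmod (taylor f k) * r ^ k * norm u" for k
    using mult_left_mono[OF pow_bound[of k u], of "cmod (taylor f k)"]
    by (simp add: norm_scaleC mult.assoc)
qed

lemma fcalc_sums:
  assumes "f holomorphic_on ball 0 R" "r < R"
  shows "(\<lambda>k. taylor f k *\<^sub>C (A ^^ k) u) sums fcalc A f u"
  unfolding fcalc_def
  by (intro summable_sums summable_norm_cancel[OF fcalc_summable_norm[OF assms]])

lemma fcalc_add_right:
  assumes "f holomorphic_on ball 0 R" "r < R"
  shows "fcalc A f (u + v) = fcalc A f u + fcalc A f v"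
  using sums_unique[OF sums_add[OF fcalc_sums[OF assms, of u] fcalc_sums[OF assms, of v]]]
  by (simp add: fcalc_def pow_add scaleC_add_right)

lemma fcalc_scale_right:
  assumes "f holomorphic_on ball 0 R" "r < R"
  shows "fcalc A f (c *\<^sub>C u) = c *\<^sub>C fcalc A f u"
  using sums_unique[OF sums_scaleC_right[OF fcalc_sums[OF assms, of u], of c]]
    by (simp add: fcalc_def pow_scale scaleC_scaleC mult.commute)

lemma fcalc_bound:
  assumes "f holomorphic_on ball 0 R" "r < R"
  shows "norm (fcalc A f u) \<le> (\<Sum>k. cmod (taylor f k) * r ^ k) * norm u"
proof -
  have s: "summable (\<lambda>k. cmod (taylor f k) * r ^ k)"
    by (intro taylor_abs_summable[OF assms(1)] assms nonneg)
  have "norm (fcalc A f u) \<le> (\<Sum>k. norm (taylor f k *\<^sub>C (A ^^ k) u))"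
    unfolding fcalc_def by (intro summable_norm fcalc_summable_norm[OF assms])
  also have "\<dots> \<le> (\<Sum>k. cmod (taylor f k) * r ^ k * norm u)"
  proof (rule suminf_le)
    show "norm (taylor f k *\<^sub>C (A ^^ k) u) \<le> cmod (taylor f k) * r ^ k * norm u" for k
      using mult_left_mono[OF pow_bound[of k u], of "cmod (taylor f k)"]
      by (simp add: norm_scaleC mult.assoc)
  qed (intro fcalc_summable_norm[OF assms] summable_mult2 s)+
  also have "\<dots> = (\<Sum>k. cmod (taylor f k) * r ^ k) * norm u"
    by (rule suminf_mult2[OF s, symmetric])
  finally show ?thesis .
qed

lemma fcalc_bounded_op:
  assumes "f holomorphic_on ball 0 R" "r < R"
  shows "cbounded_op (fcalc A f) (\<Sum>k. cmod (taylor f k) * r ^ k)"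
  by unfold_locales
    (use assms nonneg in \<open>auto intro!: fcalc_add_right[OF assms] fcalc_scale_right[OF assms] fcalc_bound[OF assms] suminf_nonneg
       taylor_abs_summable[OF assms(1)]\<close>)

lemma fcalc_add_left:
  assumes "f holomorphic_on ball 0 R" "g holomorphic_on ball 0 R" "r < R"
  shows "fcalc A (\<lambda>z. f z + g z) u = fcalc A f u + fcalc A g u"
  using sums_unique[OF sums_add[OF fcalc_sums[OF assms(1,3), of u] fcalc_sums[OF assms(2,3), of u]]]
    nonneg assms
  by (simp add: fcalc_def taylor_add[where R = R] scaleC_add_left)

lemma fcalc_const: "fcalc A (\<lambda>z. c) u = c *\<^sub>C u"
  using sums_unique[OF sums_If_finite_set[of "{0}" "\<lambda>k. c *\<^sub>C (A ^^ k) u"]]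
  by (simp add: fcalc_def taylor_const if_distrib[of "\<lambda>c. c *\<^sub>C _"] cong: if_cong)

lemma fcalc_ident: "fcalc A (\<lambda>z. z) u = A u"
  using sums_unique[OF sums_If_finite_set[of "{1}" "\<lambda>k. (A ^^ k) u"]]
  by (simp add: fcalc_def taylor_ident if_distrib[of "\<lambda>c. c *\<^sub>C _"] cong: if_cong)

text \<open>Both sides are sums of the absolutely summable family
  \<open>(i, j) \<mapsto> f\<^sub>i g\<^sub>j A\<^sup>i\<^sup>+\<^sup>j u\<close>, taken by rows on the right and by the diagonals \<open>i + j = k\<close> on the left.\<close>

lemma fcalc_mult:
  assumes f: "f holomorphic_on ball 0 R" and g: "g holomorphic_on ball 0 R" and r: "r < R"
  shows "fcalc A (\<lambda>z. f z * g z) u = fcalc A f (fcalc A g u)"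
proof -
  define F where "F = (\<lambda>(i, j). (taylor f i * taylor g j) *\<^sub>C (A ^^ (i + j)) u)"
  define Sf where "Sf = (\<Sum>k. cmod (taylor f k) * r ^ k)"
  define Sg where "Sg = (\<Sum>k. cmod (taylor g k) * r ^ k)"
  have sf: "summable (\<lambda>k. cmod (taylor f k) * r ^ k)" and sg: "summable (\<lambda>k. cmod (taylor g k) * r ^ k)"
    using f g r nonneg by (auto intro: taylor_abs_summable)
  define G where "G = (\<lambda>(i, j). (cmod (taylor f i) * r ^ i) * (cmod (taylor g j) * r ^ j) * norm u)"
  have hg: "((\<lambda>j. cmod (taylor g j) * r ^ j) has_sum Sg) UNIV"
    unfolding Sg_def by (rule sums_nonneg_imp_has_sum) (use sg nonneg in auto)
  have hf: "((\<lambda>j. cmod (taylor f j) * r ^ j) has_sum Sf) UNIV"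
    unfolding Sf_def by (rule sums_nonneg_imp_has_sum) (use sf nonneg in auto)
  have "G summable_on (UNIV \<times> UNIV)"
  proof (rule summable_on_SigmaI)
    show "((\<lambda>j. G (i, j)) has_sum (cmod (taylor f i) * r ^ i) * Sg * norm u) UNIV" for i
      unfolding G_def by (simp, intro has_sum_cmult_left has_sum_cmult_right hg)
    show "(\<lambda>i. (cmod (taylor f i) * r ^ i) * Sg * norm u) summable_on UNIV"
      by (intro summable_on_cmult_left) (use hf in \<open>auto simp: summable_on_def\<close>)
  qed (use nonneg in \<open>auto simp: G_def\<close>)
  then have "(\<lambda>p. norm (F p)) summable_on (UNIV \<times> UNIV)"
  proof (rule summable_on_comparison_test)
    fix p :: "nat \<times> nat"
    obtain i j where p: "p = (i, j)" by force
    have "cmod (taylor f i) * cmod (taylor g j) * norm ((A ^^ (i + j)) u)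
        \<le> cmod (taylor f i) * cmod (taylor g j) * (r ^ (i + j) * norm u)"
      by (intro mult_left_mono pow_bound) simp
    then show "norm (F p) \<le> G p"
      by (simp add: F_def G_def p norm_scaleC norm_mult power_add mult_ac)
  qed simp
  then have "F summable_on (UNIV \<times> UNIV)" by (rule abs_summable_summable)
  then obtain S where S: "(F has_sum S) (UNIV \<times> UNIV)" by (auto simp: summable_on_def)
  have "((\<lambda>i. taylor f i *\<^sub>C (A ^^ i) (fcalc A g u)) has_sum S) UNIV"
  proof (rule has_sum_SigmaD[OF S])
    fix i
    interpret P: bounded_linear "A ^^ i" by (rule pow_bounded_linear)
    have "(\<lambda>j. F (i, j)) = (\<lambda>j. taylor f i *\<^sub>C (A ^^ i) (taylor g j *\<^sub>C (A ^^ j) u))"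
      by (simp add: F_def pow_scale scaleC_scaleC funpow_add)
    moreover have "((\<lambda>j. taylor g j *\<^sub>C (A ^^ j) u) has_sum fcalc A g u) UNIV"
      by (intro norm_summable_imp_has_sum fcalc_summable_norm[OF g r] fcalc_sums[OF g r])
    then have "((\<lambda>j. taylor f i *\<^sub>C (A ^^ i) (taylor g j *\<^sub>C (A ^^ j) u)) has_sum
        taylor f i *\<^sub>C (A ^^ i) (fcalc A g u)) UNIV"
      using has_sum_bounded_linear[OF bounded_linear_compose[OF scaleC.bounded_linear_right
          pow_bounded_linear[of i]]]
      by fastforce
    ultimately show "((\<lambda>j. F (i, j)) has_sum taylor f i *\<^sub>C (A ^^ i) (fcalc A g u)) UNIV"
      by simp
  qed
  then have 1: "S = fcalc A f (fcalc A g u)"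
    using sums_unique2[OF has_sum_imp_sums fcalc_sums[OF f r]] by blast
  have S': "((\<lambda>(k, i). F (i, k - i)) has_sum S) (Sigma UNIV (\<lambda>k. {..k}))"
    using S by (subst has_sum_reindex_bij_witness[of _ "\<lambda>(i, j). (i + j, i)" "\<lambda>(k, i). (i, k - i)"
          "UNIV \<times> UNIV" F _ S S]) auto
  have "((\<lambda>k. \<Sum>i\<le>k. F (i, k - i)) has_sum S) UNIV"
    by (rule has_sum_SigmaD[OF S']) (auto intro!: has_sum_finiteI)
  moreover have "(\<Sum>i\<le>k. F (i, k - i)) = taylor (\<lambda>z. f z * g z) k *\<^sub>C (A ^^ k) u" for k
    using r nonneg by (simp add: F_def taylor_mult[OF f g] scaleC.sum_left)
  ultimately have 2: "S = fcalc A (\<lambda>z. f z * g z) u"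
    using sums_unique2[OF has_sum_imp_sums fcalc_sums[of "\<lambda>z. f z * g z" R]] f g r
    by (simp add: holomorphic_on_mult)
  show ?thesis using 1 2 by simp
qed

lemma pow_eigenvector:
  assumes "A v = c *\<^sub>C v"
  shows "(A ^^ k) v = c ^ k *\<^sub>C v"
  by (induction k) (auto simp: scale assms scaleC_scaleC mult.commute)

lemma fcalc_eigenvector:
  assumes f: "f holomorphic_on ball 0 R" and "cmod c < R" and "A v = c *\<^sub>C v"
  shows "fcalc A f v = f c *\<^sub>C v"
  using sums_unique[OF sums_scaleC_left[OF taylor_sums[OF assms(1,2)], of v]]
  by (simp add: fcalc_def pow_eigenvector[OF assms(3)] scaleC_scaleC)

lemma fcalc_closed_subspace:
  assumes "f holomorphic_on ball 0 R" "r < R" "closed W" "csubspace W" "\<And>x. x \<in> W \<Longrightarrow> A x \<in> W" "u \<in> W"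
  shows "fcalc A f u \<in> W"
proof (rule closed_sequentially[OF assms(3)])
  have p: "(A ^^ k) u \<in> W" for k by (induction k) (use assms in auto)
  show "(\<Sum>k<N. taylor f k *\<^sub>C (A ^^ k) u) \<in> W" for N
    by (intro csubspaceD[OF assms(4)] p)
  show "(\<lambda>N. \<Sum>k<N. taylor f k *\<^sub>C (A ^^ k) u) \<longlonglongrightarrow> fcalc A f u"
    using fcalc_sums[OF assms(1,2)] by (simp add: sums_def)
qed

end

section \<open>Closed subspaces and analytic families\<close>

text \<open>The real span of a set that is closed under multiplication by \<open>\<i>\<close> up to sign is a complex
  subspace.\<close>

definition cspan :: "'a::cbanach set \<Rightarrow> 'a set" where
  "cspan S = span (S \<union> scaleC \<i> ` S)"

lemma cspan_superset: "S \<subseteq> cspan S"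
  using span_superset[of "S \<union> scaleC \<i> ` S"] by (auto simp: cspan_def)

lemma cspan_minimal:
  assumes "S \<subseteq> W" "csubspace W"
  shows "cspan S \<subseteq> W"
  unfolding cspan_def by (rule span_minimal) (use assms in \<open>auto simp: csubspace_def\<close>)

lemma scaleC_Re_Im: "c *\<^sub>C x = Re c *\<^sub>R x + Im c *\<^sub>R (\<i> *\<^sub>C x)" for x :: "'a::cbanach"
proof -
  have "c *\<^sub>C x = (of_real (Re c) + of_real (Im c) * \<i>) *\<^sub>C x"
    by (rule arg_cong[where f = "\<lambda>c. c *\<^sub>C x"]) (simp add: complex_eq_iff)
  then show ?thesis by (simp only: scaleC_add_left scaleC_scaleC[symmetric] scaleC_of_real)
qed

lemma csubspace_cspan: "csubspace (cspan S)"
proof -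
  let ?B = "S \<union> scaleC \<i> ` S"
  have lin: "linear (scaleC \<i> :: 'a \<Rightarrow> 'a)"
    by (rule bounded_linear.linear[OF scaleC.bounded_linear_right])
  have "scaleC \<i> ` ?B \<subseteq> span ?B"
  proof clarify
    fix x assume "x \<in> ?B"
    then consider "x \<in> S" | y where "y \<in> S" "x = \<i> *\<^sub>C y" by auto
    then show "\<i> *\<^sub>C x \<in> span ?B"
    proof cases
      case 1
      then show ?thesis by (auto intro: span_base)
    next
      case 2
      then have "- y \<in> span ?B" by (intro span_neg span_base) auto
      then show ?thesis using 2 by (simp add: scaleC_scaleC scaleC_minus_one)
    qed
  qed
  then have "scaleC \<i> ` span ?B \<subseteq> span ?B"
    unfolding linear_span_image[OF lin, symmetric] by (rule span_minimal[OF _ subspace_span])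
  then have "c *\<^sub>C x \<in> span ?B" if "x \<in> span ?B" for c x
    unfolding scaleC_Re_Im[of c] using that by (blast intro: span_add span_scale)
  then show ?thesis by (auto simp: csubspace_def cspan_def)
qed

lemma cspan_mono: "S \<subseteq> T \<Longrightarrow> cspan S \<subseteq> cspan T"
  using cspan_minimal[OF order.trans[OF _ cspan_superset] csubspace_cspan] .

lemma csubspace_closure:
  fixes W :: "'a::cbanach set"
  assumes "csubspace W"
  shows "csubspace (closure W)"
proof -
  have add: "x + y \<in> closure W" if xy: "x \<in> closure W" "y \<in> closure W" for x y
  proof -
    obtain f g where "\<And>n. f n \<in> W" "f \<longlonglongrightarrow> x" "\<And>n. g n \<in> W" "g \<longlonglongrightarrow> y"
      using xy unfolding closure_sequential by blast
    then show ?thesis unfolding closure_sequential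
      by (intro exI[of _ "\<lambda>n. f n + g n"]) (auto intro: tendsto_add csubspaceD[OF assms])
  qed
  have scale: "c *\<^sub>C x \<in> closure W" if x: "x \<in> closure W" for c x
  proof -
    obtain f where "\<And>n. f n \<in> W" "f \<longlonglongrightarrow> x"
      using x unfolding closure_sequential by blast
    then show ?thesis unfolding closure_sequential
      by (intro exI[of _ "\<lambda>n. c *\<^sub>C f n"]) (auto intro!: tendsto_intros csubspaceD[OF assms])
  qed
  have "0 \<in> closure W" using csubspaceD(1)[OF assms] closure_subset by blast
  then show ?thesis using add scale
    by (auto simp: csubspace_def subspace_def scaleC_of_real[symmetric])
qed

text \<open>\<open>Q\<close> consists of the combinations with rational coefficients, indexed by finite lists.\<close>

lemma countable_dense_in_span:
  fixes B :: "'a::real_normed_vector set"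
  assumes "countable B"
  obtains Q where "countable Q" "Q \<subseteq> span B" "span B \<subseteq> closure Q"
proof -
  define L where "L = lists ((\<rat> :: real set) \<times> B)"
  define val where "val xs = (\<Sum>(q, b)\<leftarrow>xs. q *\<^sub>R b)" for xs :: "(real \<times> 'a) list"
  define Q where "Q = val ` L"
  have "countable Q"
    unfolding Q_def L_def by (intro countable_image countable_lists countable_SIGMA countable_rat assms)
  moreover have "val xs \<in> span B" if "xs \<in> L" for xs
    using that unfolding L_def by (induction xs) (auto simp: val_def intro: span_add span_scale span_base span_zero)
  then have "Q \<subseteq> span B" by (auto simp: Q_def)
  moreover have "x \<in> closure Q" if "x \<in> span B" for x
    using that
  proof (induction rule: span_induct_alt)
    case base
    have "val [] \<in> Q" unfolding Q_def by (rule imageI) (simp add: L_def)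
    then show ?case using closure_subset by (auto simp: val_def)
  next
    case (step c b y)
    obtain f where f: "\<And>n. f n \<in> Q" "f \<longlonglongrightarrow> y"
      using step unfolding closure_sequential by blast
    have "c \<in> closure \<rat>" by (simp add: Rats_closure_real)
    then obtain q where q: "\<And>n. q n \<in> \<rat>" "q \<longlonglongrightarrow> c"
      unfolding closure_sequential by blast
    have "q n *\<^sub>R b + f n \<in> Q" for n
    proof -
      obtain xs where xs: "f n = val xs" "xs \<in> L" using f(1)[of n] by (auto simp: Q_def)
      then have "q n *\<^sub>R b + f n = val ((q n, b) # xs)" "(q n, b) # xs \<in> L"
        using q(1)[of n] step(1) by (auto simp: val_def L_def)
      then show ?thesis unfolding Q_def by blast
    qed
    then show ?case unfolding closure_sequential
      by (intro exI[of _ "\<lambda>n. q n *\<^sub>R b + f n"] conjI allI tendsto_intros q f)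
  qed
  ultimately show ?thesis using that by blast
qed

text \<open>An expansion whose coefficients obey Cauchy's estimate for a function bounded by \<open>M\<close>. The
  constant is explicit in order that expansions of all coordinates with a common \<open>M\<close> can be combined.\<close>

definition pseries :: "(complex \<Rightarrow> 'a::cbanach) \<Rightarrow> complex \<Rightarrow> real \<Rightarrow> real \<Rightarrow> bool" where
  "pseries v c r M \<longleftrightarrow> (\<exists>w. (\<forall>k. norm (w k) \<le> M / r ^ k) \<and>
     (\<forall>\<mu>\<in>ball c r. (\<lambda>k. (\<mu> - c) ^ k *\<^sub>C w k) sums v \<mu>))"

lemma pseries_cong: "pseries v c r M \<Longrightarrow> (\<And>\<mu>. \<mu> \<in> ball c r \<Longrightarrow> v \<mu> = v' \<mu>) \<Longrightarrow> pseries v' c r M"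
  by (simp add: pseries_def)

lemma pseries_complex:
  assumes hol: "f holomorphic_on ball c r" and M: "\<And>z. z \<in> ball c r \<Longrightarrow> cmod (f z) \<le> M" and "r > 0"
  shows "pseries f c r M"
proof -
  define w where "w k = (deriv ^^ k) f c / fact k" for k
  have "norm (w k) \<le> M / r ^ k" for k
  proof -
    have bnd: "cmod (w k) * s ^ k \<le> M" if s: "0 < s" "s < r" for s
    proof -
      have "norm ((deriv ^^ k) f c) \<le> fact k * M / s ^ k"
      proof (rule Cauchy_inequality)
        have sub: "cball c s \<subseteq> ball c r" "ball c s \<subseteq> ball c r" using s by auto
        show "f holomorphic_on ball c s" using hol sub(2) by (rule holomorphic_on_subset)
        show "continuous_on (cball c s) f"
          using holomorphic_on_imp_continuous_on[OF hol] sub(1) continuous_on_subset by blast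
        show "cmod (f x) \<le> M" if "cmod (c - x) = s" for x
          using that s by (intro M) (auto simp: dist_norm)
      qed (use s in auto)
      then show ?thesis using s by (simp add: w_def norm_divide field_simps)
    qed
    have "((\<lambda>s. cmod (w k) * s ^ k) \<longlongrightarrow> cmod (w k) * r ^ k) (at_left r)"
      by (intro tendsto_intros)
    moreover have "\<forall>\<^sub>F s in at_left r. cmod (w k) * s ^ k \<le> M"
      unfolding eventually_at_left_field using bnd \<open>r > 0\<close> by (intro exI[of _ 0]) auto
    ultimately have "cmod (w k) * r ^ k \<le> M"
      by (rule tendsto_upperbound) simp
    then show ?thesis using \<open>r > 0\<close> by (simp add: field_simps)
  qed
  moreover have "(\<lambda>k. (\<mu> - c) ^ k *\<^sub>C w k) sums f \<mu>" if "\<mu> \<in> ball c r" for \<mu>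
    using holomorphic_power_series[OF hol that] by (simp add: w_def scaleC_complex_def mult.commute)
  ultimately show ?thesis unfolding pseries_def by (intro exI[of _ w] conjI allI ballI)
qed

lemma pseries_coeff_sums:
  fixes w :: "nat \<Rightarrow> 'a::cbanach"
  assumes w: "\<And>k. norm (w k) \<le> M / r ^ k" and x: "cmod x < r"
  shows "summable (\<lambda>k. norm (x ^ k *\<^sub>C w k))"
proof (rule summable_comparison_test'[where N = 0])
  have r: "r > 0" using x by (meson norm_ge_zero le_less_trans)
  show "summable (\<lambda>k. M * (cmod x / r) ^ k)"
    by (intro summable_mult summable_geometric) (use x r in auto)
  show "norm (norm (x ^ k *\<^sub>C w k)) \<le> M * (cmod x / r) ^ k" for k
    using mult_left_mono[OF w[of k], of "cmod x ^ k"]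
    by (simp add: norm_scaleC norm_power power_divide mult_ac)
qed

lemma bounded_linear_apply_bcontfun:
  "bounded_linear (\<lambda>f. apply_bcontfun (f :: 'a::topological_space \<Rightarrow>\<^sub>C 'b::real_normed_vector) i)"
  by (rule bounded_linear_intro[where K = 1]) (auto simp: norm_bounded)

lemma discrete_bcontfunI:
  fixes f :: "'i::discrete_topology \<Rightarrow> 'a::real_normed_vector"
  assumes "\<And>i. norm (f i) \<le> M"
  shows "f \<in> bcontfun"
  by (rule bcontfun_normI[OF _ assms]) simp

text \<open>With a common bound \<open>M\<close>, the coefficients of the coordinates form bounded functions again, so
  coordinatewise holomorphic and uniformly bounded families are holomorphic in the supremum norm.\<close>

lemma pseries_bcontfun:
  fixes v :: "complex \<Rightarrow> nat \<Rightarrow>\<^sub>C 'a::cbanach"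
  assumes "\<And>i. pseries (\<lambda>\<mu>. apply_bcontfun (v \<mu>) i) c r M"
  shows "pseries v c r M"
proof -
  have "\<forall>i. \<exists>w. (\<forall>k. norm (w k) \<le> M / r ^ k) \<and>
      (\<forall>\<mu>\<in>ball c r. (\<lambda>k. (\<mu> - c) ^ k *\<^sub>C w k) sums apply_bcontfun (v \<mu>) i)"
    using assms unfolding pseries_def by (rule allI)
  from choice[OF this] obtain w where *: "\<forall>i. (\<forall>k. norm (w i k) \<le> M / r ^ k) \<and>
      (\<forall>\<mu>\<in>ball c r. (\<lambda>k. (\<mu> - c) ^ k *\<^sub>C w i k) sums apply_bcontfun (v \<mu>) i)" ..
  have w: "\<And>i k. norm (w i k) \<le> M / r ^ k"
    and s: "\<And>i \<mu>. \<mu> \<in> ball c r \<Longrightarrow> (\<lambda>k. (\<mu> - c) ^ k *\<^sub>C w i k) sums apply_bcontfun (v \<mu>) i"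
    using * by simp_all
  define W where "W k = Bcontfun (\<lambda>i. w i k)" for k
  have W: "apply_bcontfun (W k) i = w i k" for k i
    unfolding W_def by (simp add: Bcontfun_inverse discrete_bcontfunI[OF w])
  have nW: "norm (W k) \<le> M / r ^ k" for k
    by (rule norm_bound) (simp add: W w)
  have sW: "(\<lambda>k. (\<mu> - c) ^ k *\<^sub>C W k) sums v \<mu>" if \<mu>: "\<mu> \<in> ball c r" for \<mu>
  proof -
    have "summable (\<lambda>k. (\<mu> - c) ^ k *\<^sub>C W k)"
      by (rule summable_norm_cancel, rule pseries_coeff_sums[OF nW])
        (use \<mu> in \<open>simp add: dist_norm norm_minus_commute\<close>)
    then obtain S where S: "(\<lambda>k. (\<mu> - c) ^ k *\<^sub>C W k) sums S" by (auto simp: summable_def)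
    have "S = v \<mu>"
    proof (rule bcontfun_eqI)
      fix i
      have "(\<lambda>k. (\<mu> - c) ^ k *\<^sub>C w i k) sums apply_bcontfun S i"
        using bounded_linear.sums[OF bounded_linear_apply_bcontfun[of i] S] by (simp add: W)
      then show "apply_bcontfun S i = apply_bcontfun (v \<mu>) i"
        by (rule sums_unique2[OF _ s[OF \<mu>]])
    qed
    then show ?thesis using S by (simp only:)
  qed
  show ?thesis unfolding pseries_def
  proof (rule exI[of _ W], intro conjI allI ballI)
    show "norm (W k) \<le> M / r ^ k" for k by (rule nW)
    show "(\<lambda>k. (\<mu> - c) ^ k *\<^sub>C W k) sums v \<mu>" if "\<mu> \<in> ball c r" for \<mu>
      by (rule sW[OF that])
  qed
qed

text \<open>The identity theorem for a vector-valued analytic function and a closed subspace, without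
  functionals: given that \<open>w\<^sub>0, \<dots>, w\<^sub>k\<^sub>-\<^sub>1\<close> lie in \<open>W\<close>, the vector \<open>w\<^sub>k\<close> is the limit along
  \<open>\<Lambda>\<close> of the quotients \<open>g\<close>, which belong to \<open>W\<close>.\<close>

lemma pseries_coefficients_in_subspace:
  fixes v :: "complex \<Rightarrow> 'a::cbanach"
  assumes w: "\<And>k. norm (w k) \<le> M / r ^ k"
    and s: "\<And>\<mu>. \<mu> \<in> ball c r \<Longrightarrow> (\<lambda>k. (\<mu> - c) ^ k *\<^sub>C w k) sums v \<mu>"
    and r: "r > 0" and lim: "c islimpt \<Lambda>"
    and W: "closed W" "csubspace W" and inW: "\<And>\<mu>. \<mu> \<in> \<Lambda> \<Longrightarrow> v \<mu> \<in> W"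
  shows "w k \<in> W"
proof -
  have M: "M \<ge> 0" using order.trans[OF norm_ge_zero w[of 0]] by simp
  show ?thesis
  proof (induction k rule: less_induct)
    case (less k)
    \<comment> \<open>the difference to the limit is the tail of the expansion, dominated by a geometric series with ratio at most 1/2\<close>
    define g where "g \<mu> = inverse ((\<mu> - c) ^ k) *\<^sub>C (v \<mu> - (\<Sum>i<k. (\<mu> - c) ^ i *\<^sub>C w i))" for \<mu>
    have bnd: "norm (g \<mu> - w k) \<le> cmod (\<mu> - c) * (2 * M / r ^ Suc k)"
      if \<mu>: "\<mu> \<noteq> c" "dist \<mu> c < r / 2" for \<mu>
    proof -
      define x where "x = \<mu> - c"
      have x: "x \<noteq> 0" "cmod x < r / 2" using \<mu> by (auto simp: x_def dist_norm)
      have xr: "cmod x < r" using x r by simp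
      have sx: "(\<lambda>j. x ^ j *\<^sub>C w j) sums v \<mu>"
        using s[of \<mu>] xr by (simp add: x_def dist_norm norm_minus_commute)
      define G where "G = (\<lambda>j. inverse (x ^ k) *\<^sub>C (x ^ (j + Suc k) *\<^sub>C w (j + Suc k)))"
      have "G sums (inverse (x ^ k) *\<^sub>C (v \<mu> - (\<Sum>i<Suc k. x ^ i *\<^sub>C w i)))"
        unfolding G_def by (intro sums_scaleC_right sums_split_initial_segment sx)
      also have "inverse (x ^ k) *\<^sub>C (v \<mu> - (\<Sum>i<Suc k. x ^ i *\<^sub>C w i)) = g \<mu> - w k"
        using x by (simp add: g_def x_def[symmetric] scaleC.diff_right scaleC_add_right scaleC_scaleC)
      finally have G: "G sums (g \<mu> - w k)" .
      have Gb: "norm (G j) \<le> cmod x * (M / r ^ Suc k) * (1 / 2) ^ j" for j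
      proof -
        have "inverse (x ^ k) * x ^ (j + Suc k) = x ^ Suc j"
          using x(1) by (simp add: power_add)
        then have "norm (G j) = cmod x ^ Suc j * norm (w (j + Suc k))"
          by (simp only: G_def scaleC_scaleC norm_scaleC norm_power)
        also have "\<dots> \<le> cmod x ^ Suc j * (M / r ^ (j + Suc k))"
          by (intro mult_left_mono w) simp
        also have "\<dots> = cmod x * (M / r ^ Suc k) * (cmod x / r) ^ j"
          by (simp add: power_add power_divide mult_ac)
        also have "\<dots> \<le> cmod x * (M / r ^ Suc k) * (1 / 2) ^ j"
          using x r M by (intro mult_left_mono power_mono) (auto simp: field_simps)
        finally show ?thesis .
      qed
      have geo: "(\<lambda>j. cmod x * (M / r ^ Suc k) * (1 / 2) ^ j) sums (cmod x * (M / r ^ Suc k) * 2)"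
        using sums_mult[OF geometric_sums[of "1 / 2 :: real"], of "cmod x * (M / r ^ Suc k)"] by simp
      have sn: "summable (\<lambda>j. norm (G j))"
        by (rule summable_comparison_test'[OF sums_summable[OF geo], where N = 0]) (use Gb in simp)
      have "norm (g \<mu> - w k) \<le> (\<Sum>j. norm (G j))"
        using summable_norm[OF sn] G by (simp add: sums_iff)
      also have "\<dots> \<le> cmod x * (M / r ^ Suc k) * 2"
        using suminf_le[OF Gb sn sums_summable[OF geo]] geo by (simp add: sums_iff)
      finally show ?thesis by (simp add: x_def mult_ac)
    qed
    have "((\<lambda>\<mu>. cmod (\<mu> - c) * (2 * M / r ^ Suc k)) \<longlongrightarrow> cmod (c - c) * (2 * M / r ^ Suc k)) (at c within \<Lambda>)"
      by (intro tendsto_intros)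
    then have "((\<lambda>\<mu>. cmod (\<mu> - c) * (2 * M / r ^ Suc k)) \<longlongrightarrow> 0) (at c within \<Lambda>)"
      by simp
    then have "((\<lambda>\<mu>. g \<mu> - w k) \<longlongrightarrow> 0) (at c within \<Lambda>)"
      by (rule Lim_null_comparison[rotated])
        (use r bnd in \<open>auto simp: eventually_at intro!: exI[of _ "r / 2"]\<close>)
    then have lim_g: "(g \<longlongrightarrow> w k) (at c within \<Lambda>)" by (simp add: Lim_null[symmetric])
    have "g \<mu> \<in> W" if "\<mu> \<in> \<Lambda>" for \<mu>
      unfolding g_def by (intro csubspaceD[OF W(2)] inW that less) simp
    then have "\<forall>\<^sub>F \<mu> in at c within \<Lambda>. g \<mu> \<in> W" by (auto simp: eventually_at_filter)
    then show ?case
      using Lim_in_closed_set[OF W(1) _ _ lim_g] lim by (simp add: trivial_limit_within)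
  qed
qed

lemma pseries_identity:
  fixes v :: "complex \<Rightarrow> 'a::cbanach"
  assumes v: "pseries v c r M" and r: "r > 0" and lim: "c islimpt \<Lambda>"
    and W: "closed W" "csubspace W" and inW: "\<And>\<mu>. \<mu> \<in> \<Lambda> \<Longrightarrow> v \<mu> \<in> W" and \<mu>: "\<mu> \<in> ball c r"
  shows "v \<mu> \<in> W"
proof -
  obtain w where w: "\<And>k. norm (w k) \<le> M / r ^ k"
    and s: "\<And>\<mu>. \<mu> \<in> ball c r \<Longrightarrow> (\<lambda>k. (\<mu> - c) ^ k *\<^sub>C w k) sums v \<mu>"
    using v unfolding pseries_def by blast
  have wW: "w k \<in> W" for k
    by (rule pseries_coefficients_in_subspace[OF w s r lim W inW])
  show ?thesis
  proof (rule closed_sequentially[OF W(1)])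
    show "(\<Sum>k<N. (\<mu> - c) ^ k *\<^sub>C w k) \<in> W" for N
      by (intro csubspaceD[OF W(2)] wW)
    show "(\<lambda>N. \<Sum>k<N. (\<mu> - c) ^ k *\<^sub>C w k) \<longlonglongrightarrow> v \<mu>"
      using s[OF \<mu>] by (simp add: sums_def)
  qed
qed

section \<open>The semigroup of a bounded operator\<close>

definition expop :: "('a::cbanach \<Rightarrow> 'a) \<Rightarrow> real \<Rightarrow> 'a \<Rightarrow> 'a" where
  "expop A t = fcalc A (\<lambda>z. exp (of_real t * z))"

lemma higher_deriv_exp_mult: "(deriv ^^ k) (\<lambda>z. exp (c * z)) = (\<lambda>z. c ^ k * exp (c * z))"
proof (induction k)
  case (Suc k)
  have "deriv (\<lambda>z. c ^ k * exp (c * z)) z = c ^ Suc k * exp (c * z)" for z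
    by (rule DERIV_imp_deriv) (auto intro!: derivative_eq_intros)
  then show ?case by (simp add: Suc fun_eq_iff)
qed simp

lemma taylor_exp_mult: "taylor (\<lambda>z. exp (c * z)) k = c ^ k / fact k"
  by (simp add: taylor_def higher_deriv_exp_mult)

lemma exp_decay:
  fixes x :: "'a::cbanach"
  assumes "Re \<mu> < 0"
  shows "((\<lambda>t. exp (of_real t * \<mu>) *\<^sub>C x) \<longlongrightarrow> 0) at_top"
proof (rule tendsto_norm_zero_cancel)
  have "filterlim (\<lambda>t. Re \<mu> * t) at_bot at_top"
    by (rule filterlim_tendsto_neg_mult_at_bot[OF tendsto_const assms filterlim_ident])
  then have "((\<lambda>t. exp (Re \<mu> * t)) \<longlongrightarrow> 0) at_top"
    by (rule filterlim_compose[OF exp_at_bot])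
  then have "((\<lambda>t. exp (Re \<mu> * t) * norm x) \<longlongrightarrow> 0 * norm x) at_top"
    by (intro tendsto_intros)
  then show "((\<lambda>t. norm (exp (of_real t * \<mu>) *\<^sub>C x)) \<longlongrightarrow> 0) at_top"
    by (simp add: norm_scaleC norm_exp_eq_Re mult.commute)
qed

context cbounded_op
begin

lemma exp_hol: "(\<lambda>z. exp (of_real t * z)) holomorphic_on ball 0 (r + 1)"
  by (intro holomorphic_intros)

lemma expop_sums: "(\<lambda>k. of_real (t ^ k / fact k) *\<^sub>C (A ^^ k) u) sums expop A t u"
  using fcalc_sums[OF exp_hol[of t], of u] by (simp add: expop_def taylor_exp_mult)

lemma expop_cbounded_op: "\<exists>K. cbounded_op (expop A t) K"
  unfolding expop_def using fcalc_bounded_op[OF exp_hol] by auto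

lemma expop_bounded_linear: "bounded_linear (expop A t)"
  using expop_cbounded_op cbounded_op.bounded_linear by blast

lemmas expop_add = linear_add[OF bounded_linear.linear[OF expop_bounded_linear]]
lemmas expop_zero = linear_0[OF bounded_linear.linear[OF expop_bounded_linear]]

lemma expop_scale: "expop A t (c *\<^sub>C u) = c *\<^sub>C expop A t u"
  using expop_cbounded_op[of t] cbounded_op.scale by blast

lemma expop_plus: "expop A (s + t) u = expop A s (expop A t u)"
  using fcalc_mult[OF exp_hol[of s] exp_hol[of t], of u]
  by (simp add: expop_def distrib_right exp_add)

lemma expop_0: "expop A 0 u = u"
  by (simp add: expop_def fcalc_const)

lemma expop_eigenvector:
  assumes "A v = c *\<^sub>C v"
  shows "expop A t v = exp (of_real t * c) *\<^sub>C v"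
proof -
  have "(\<lambda>z. exp (of_real t * z)) holomorphic_on ball 0 (cmod c + 1)"
    by (intro holomorphic_intros)
  from fcalc_eigenvector[OF this _ assms] show ?thesis by (simp add: expop_def)
qed

lemma expop_invariant:
  assumes "closed W" "csubspace W" "\<And>x. x \<in> W \<Longrightarrow> A x \<in> W" "u \<in> W"
  shows "expop A t u \<in> W"
  unfolding expop_def by (rule fcalc_closed_subspace[OF exp_hol _ assms]) simp

lemma expop_period_mult:
  assumes "expop A t u = u"
  shows "expop A (real k * t) u = u"
  by (induction k) (auto simp: expop_0 distrib_right expop_plus assms)

lemma decay_of_stable_span:
  assumes "\<And>v. v \<in> S \<Longrightarrow> \<exists>\<mu>. Re \<mu> < 0 \<and> A v = \<mu> *\<^sub>C v" and "x \<in> cspan S"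
  shows "((\<lambda>t. expop A t x) \<longlongrightarrow> 0) at_top"
proof -
  have "csubspace {x. ((\<lambda>t. expop A t x) \<longlongrightarrow> 0) at_top}"
    unfolding csubspace_def subspace_def
    using tendsto_add[of _ "0 :: 'a" _ _ "0 :: 'a"] tendsto_scaleC[OF tendsto_const, of _ "0 :: 'a"]
    by (auto simp: expop_zero expop_add expop_scale scaleC_of_real[symmetric])
  moreover have "S \<subseteq> {x. ((\<lambda>t. expop A t x) \<longlongrightarrow> 0) at_top}"
    using assms(1) exp_decay by (fastforce simp: expop_eigenvector)
  ultimately show ?thesis using cspan_minimal assms(2) by blast
qed

text \<open>On an eigenvector \<open>v\<close> for \<open>\<mu>\<close> the preimage is \<open>exp (- t \<mu>) v\<close>, which tends to
  \<open>0\<close> because \<open>Re \<mu> > 0\<close>.\<close>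

lemma small_preimages_in_unstable_span:
  assumes "\<And>v. v \<in> S \<Longrightarrow> \<exists>\<mu>. Re \<mu> > 0 \<and> A v = \<mu> *\<^sub>C v" and "y \<in> cspan S"
  shows "\<exists>s. (\<forall>t. s t \<in> cspan S \<and> expop A t (s t) = y) \<and> (s \<longlongrightarrow> 0) at_top"
proof -
  define G where "G = {y. \<exists>s. (\<forall>t. s t \<in> cspan S \<and> expop A t (s t) = y) \<and> (s \<longlongrightarrow> 0) at_top}"
  have GI: "y \<in> G" if "\<And>t. s t \<in> cspan S" "\<And>t. expop A t (s t) = y" "(s \<longlongrightarrow> 0) at_top" for y s
    using that unfolding G_def by blast
  note cs = csubspaceD[OF csubspace_cspan[of S]]
  have "csubspace G"
    unfolding csubspace_def subspace_def
  proof (intro conjI ballI allI)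
    show "0 \<in> G" by (rule GI[of "\<lambda>t. 0"]) (auto simp: expop_zero cs)
    fix x y assume "x \<in> G" "y \<in> G"
    then obtain s s' where s: "\<And>t. s t \<in> cspan S" "\<And>t. expop A t (s t) = x" "(s \<longlongrightarrow> 0) at_top"
      and s': "\<And>t. s' t \<in> cspan S" "\<And>t. expop A t (s' t) = y" "(s' \<longlongrightarrow> 0) at_top"
      unfolding G_def by blast
    show "x + y \<in> G"
      by (rule GI[of "\<lambda>t. s t + s' t"])
        (use s s' tendsto_add[OF s(3) s'(3)] in \<open>auto simp: expop_add intro: cs\<close>)
  next
    fix c x assume "x \<in> G"
    then obtain s where s: "\<And>t. s t \<in> cspan S" "\<And>t. expop A t (s t) = x" "(s \<longlongrightarrow> 0) at_top"
      unfolding G_def by blast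
    show *: "c *\<^sub>C x \<in> G" for c
      by (rule GI[of "\<lambda>t. c *\<^sub>C s t"])
        (use s tendsto_scaleC[OF tendsto_const s(3), of c] in \<open>auto simp: expop_scale intro: cs\<close>)
    show "a *\<^sub>R x \<in> G" for a :: real
      using *[of "of_real a"] by (simp add: scaleC_of_real)
  qed
  moreover have "S \<subseteq> G"
  proof
    fix v assume v: "v \<in> S"
    then obtain \<mu> where \<mu>: "Re \<mu> > 0" "A v = \<mu> *\<^sub>C v" using assms(1) by blast
    show "v \<in> G"
    proof (rule GI[of "\<lambda>t. exp (of_real t * - \<mu>) *\<^sub>C v"])
      show "((\<lambda>t. exp (of_real t * - \<mu>) *\<^sub>C v) \<longlongrightarrow> 0) at_top"
        by (rule exp_decay) (use \<mu> in simp)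
      show "exp (of_real t * - \<mu>) *\<^sub>C v \<in> cspan S" for t
        using cspan_superset v by (auto intro: cs)
      show "expop A t (exp (of_real t * - \<mu>) *\<^sub>C v) = v" for t
        by (simp add: expop_scale expop_eigenvector[OF \<mu>(2)] scaleC_scaleC exp_add[symmetric])
    qed
  qed
  ultimately have "y \<in> G" using cspan_minimal assms(2) by blast
  then show ?thesis by (simp add: G_def)
qed

text \<open>An eigenvector for \<open>2\<pi>\<i>a/b\<close> has period \<open>b\<close>; a sum of vectors with integer periods
  has the product as a period.\<close>

lemma periodic_in_rational_span:
  assumes "\<And>v. v \<in> S \<Longrightarrow> \<exists>q\<in>\<rat>. A v = (of_real (2 * pi * q) * \<i>) *\<^sub>C v" and "x \<in> cspan S"
  shows "\<exists>t>0. expop A t x = x"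
proof -
  define G where "G = {x. \<exists>N::nat. N > 0 \<and> expop A (real N) x = x}"
  have "csubspace G"
    unfolding csubspace_def subspace_def
  proof (intro conjI ballI allI)
    show "0 \<in> G" by (auto simp: G_def expop_zero intro: exI[of _ 1])
    fix x y assume "x \<in> G" "y \<in> G"
    then obtain N K where N: "N > 0" "expop A (real N) x = x" and K: "K > 0" "expop A (real K) y = y"
      unfolding G_def by blast
    have "expop A (real (K * N)) x = x" "expop A (real (K * N)) y = y"
      using expop_period_mult[OF N(2), of K] expop_period_mult[OF K(2), of N] by (simp_all add: mult.commute)
    then show "x + y \<in> G" unfolding G_def using N K by (auto simp: expop_add intro!: exI[of _ "K * N"])
  next
    fix c :: complex and a :: real and x assume "x \<in> G"
    then show "c *\<^sub>C x \<in> G" by (auto simp: G_def expop_scale)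
    show "a *\<^sub>R x \<in> G" using \<open>x \<in> G\<close> by (auto simp: G_def expop_scale scaleC_of_real[symmetric])
  qed
  moreover have "S \<subseteq> G"
  proof
    fix v assume "v \<in> S"
    then obtain q where q: "q \<in> \<rat>" "A v = (of_real (2 * pi * q) * \<i>) *\<^sub>C v" using assms(1) by blast
    obtain a b where ab: "b > 0" "q = of_int a / of_int b" using q(1) by (rule Rats_cases')
    define N where "N = nat b"
    have N: "N > 0" "q * real N = of_int a" using ab by (auto simp: N_def)
    have "of_real (real N) * (of_real (2 * pi * q) * \<i>) = of_real (2 * pi * (q * real N)) * \<i>"
      by simp
    also have "exp \<dots> = 1"
      unfolding N(2) using exp_integer_2pi[of "of_int a"] by (simp add: mult_ac)
    finally have "expop A (real N) v = v"
      by (simp only: expop_eigenvector[OF q(2)] scaleC_one)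
    then show "v \<in> G" unfolding G_def using N by auto
  qed
  ultimately have "x \<in> G" using cspan_minimal assms(2) by blast
  then obtain N :: nat where "N > 0" "expop A (real N) x = x" by (auto simp: G_def)
  then show ?thesis by (intro exI[of _ "real N"]) simp
qed

text \<open>Baire's theorem in \<open>Y\<close>. For a point \<open>q\<close> of the countable dense set and a radius \<open>1/(m+1)\<close>, the
  vectors whose orbit meets the corresponding ball form an open set, dense by transitivity; a vector in the intersection
  has a dense orbit.\<close>

lemma dense_orbit:
  assumes Y: "closed Y" and inv: "\<And>t x. t \<ge> 0 \<Longrightarrow> x \<in> Y \<Longrightarrow> expop A t x \<in> Y"
    and sep: "countable Q" "Q \<subseteq> Y" "Y \<subseteq> closure Q" and ne: "Y \<noteq> {}"
    and trans: "\<And>U V. open U \<Longrightarrow> open V \<Longrightarrow> U \<inter> Y \<noteq> {} \<Longrightarrow> V \<inter> Y \<noteq> {} \<Longrightarrow>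
      \<exists>t\<ge>0. \<exists>x\<in>U \<inter> Y. expop A t x \<in> V"
  shows "\<exists>x\<in>Y. Y \<subseteq> closure {expop A t x |t. t \<ge> 0}"
proof -
  define G where "G q m = {x \<in> Y. \<exists>t\<ge>0. expop A t x \<in> ball q (inverse (real (Suc m)))}" for q m
  define \<G> where "\<G> = (\<lambda>(q, m). G q m) ` (Q \<times> UNIV)"
  have G_open: "openin (top_of_set Y) (G q m)" for q m
  proof -
    have "open (expop A t -` ball q (inverse (real (Suc m))))" for t
      by (intro open_vimage open_ball linear_continuous_on expop_bounded_linear)
    then have "open (\<Union>t\<in>{0..}. expop A t -` ball q (inverse (real (Suc m))))" by blast
    moreover have "G q m = Y \<inter> (\<Union>t\<in>{0..}. expop A t -` ball q (inverse (real (Suc m))))"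
      by (auto simp: G_def)
    ultimately show ?thesis by (simp add: openin_open_Int)
  qed
  have G_dense: "top_of_set Y closure_of (G q m) = Y" if "q \<in> Q" for q m
  proof -
    have "y \<in> closure (G q m)" if y: "y \<in> Y" for y
      unfolding closure_approachable
    proof (intro allI impI)
      fix e :: real assume "e > 0"
      then have "y \<in> ball y e \<inter> Y" using y by simp
      moreover have "q \<in> ball q (inverse (real (Suc m))) \<inter> Y" using \<open>q \<in> Q\<close> sep(2) by auto
      ultimately obtain t x where "t \<ge> 0" "x \<in> ball y e \<inter> Y" "expop A t x \<in> ball q (inverse (real (Suc m)))"
        using trans[OF open_ball open_ball] by blast
      then show "\<exists>x\<in>G q m. dist x y < e" unfolding G_def by (auto simp: dist_commute)
    qed
    moreover have "G q m \<subseteq> Y" by (auto simp: G_def)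
    ultimately show ?thesis by (auto simp: closure_of_subtopology Int_absorb1)
  qed
  have "top_of_set Y closure_of \<Inter>\<G> = topspace (top_of_set Y)"
  proof (rule Baire_category)
    show "completely_metrizable_space (top_of_set Y) \<or>
        locally_compact_space (top_of_set Y) \<and> regular_space (top_of_set Y)"
      using completely_metrizable_space_closedin[OF completely_metrizable_space_euclidean
          Y[unfolded closed_closedin]] by simp
    show "countable \<G>" unfolding \<G>_def by (intro countable_image countable_SIGMA sep) auto
    show "openin (top_of_set Y) T \<and> top_of_set Y closure_of T = topspace (top_of_set Y)" if "T \<in> \<G>" for T
      using that G_open G_dense by (auto simp: \<G>_def)
  qed
  then have "top_of_set Y closure_of \<Inter>\<G> \<noteq> {}" using ne by simp
  then obtain x where x: "x \<in> Y" "x \<in> \<Inter>\<G>"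
    by (auto simp: closure_of_def)
  have "Q \<subseteq> closure {expop A t x |t. t \<ge> 0}"
  proof
    fix q assume q: "q \<in> Q"
    show "q \<in> closure {expop A t x |t. t \<ge> 0}"
      unfolding closure_approachable
    proof (intro allI impI)
      fix e :: real assume "e > 0"
      then obtain m where m: "inverse (real (Suc m)) < e" using reals_Archimedean by blast
      have "x \<in> G q m" using x(2) q by (auto simp: \<G>_def)
      then obtain t where "t \<ge> 0" "expop A t x \<in> ball q (inverse (real (Suc m)))"
        by (auto simp: G_def)
      then show "\<exists>y\<in>{expop A t x |t. t \<ge> 0}. dist y q < e"
        using m by (auto simp: dist_commute intro!: bexI[of _ "expop A t x"])
    qed
  qed
  from order.trans[OF sep(3) closure_minimal[OF this closed_closure]] x(1) show ?thesis ..
qed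

text \<open>The point \<open>c\<close> on the imaginary axis is an accumulation point of the eigenvalues in either half plane
  and of those in \<open>2\<pi>\<i>\<rat>\<close>, so by the identity theorem each of these three sets of eigenvectors
  has closed span \<open>Y\<close>. For \<open>x\<close> in the stable span and \<open>y\<close> in the unstable one, let \<open>s t\<close> be the small
  preimage of \<open>y\<close>: the vector \<open>x + s t\<close> is close to \<open>x\<close> and is mapped close to \<open>y\<close>, which is transitivity.\<close>

theorem chaos_of_eigenvector_family:
  assumes ps: "pseries v c d M" and d: "d > 0" and c: "Re c = 0"
    and eig: "\<And>\<mu>. \<mu> \<in> ball c d \<Longrightarrow> A (v \<mu>) = \<mu> *\<^sub>C v \<mu>"
  defines "Y \<equiv> closure (cspan (v ` ball c d))"
  shows "x \<in> Y \<Longrightarrow> expop A t x \<in> Y"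
    and "\<exists>x\<in>Y. Y \<subseteq> closure {expop A t x |t. t \<ge> 0}"
    and "Y \<subseteq> closure {x \<in> Y. \<exists>t>0. expop A t x = x}"
proof -
  have cs: "csubspace Y" unfolding Y_def by (intro csubspace_closure csubspace_cspan)
  have dense: "closure (cspan (v ` \<Lambda>)) = Y" if "\<Lambda> \<subseteq> ball c d" "c islimpt \<Lambda>" for \<Lambda>
  proof
    show "closure (cspan (v ` \<Lambda>)) \<subseteq> Y"
      unfolding Y_def using that by (intro closure_mono cspan_mono image_mono)
    have "v \<mu> \<in> closure (cspan (v ` \<Lambda>))" if "\<mu> \<in> ball c d" for \<mu>
    proof (rule pseries_identity[OF ps d \<open>c islimpt \<Lambda>\<close> closed_closure])
      show "csubspace (closure (cspan (v ` \<Lambda>)))" by (intro csubspace_closure csubspace_cspan)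
      show "v \<mu> \<in> closure (cspan (v ` \<Lambda>))" if "\<mu> \<in> \<Lambda>" for \<mu>
        using cspan_superset[of "v ` \<Lambda>"] closure_subset that by blast
    qed fact
    then show "Y \<subseteq> closure (cspan (v ` \<Lambda>))"
      unfolding Y_def
      by (intro closure_minimal cspan_minimal csubspace_closure csubspace_cspan closed_closure) auto
  qed
  define L R I where "L = {\<mu> \<in> ball c d. Re \<mu> < 0}" and "R = {\<mu> \<in> ball c d. Re \<mu> > 0}"
    and "I = {\<mu> \<in> ball c d. \<exists>q\<in>\<rat>. \<mu> = of_real (2 * pi * q) * \<i>}"
  have L: "c islimpt L"
    unfolding islimpt_approachable
  proof (intro allI impI)
    fix e :: real assume "e > 0"
    then show "\<exists>x\<in>L. x \<noteq> c \<and> dist x c < e"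
      using d c by (intro bexI[of _ "c - of_real (min e d / 2)"]) (auto simp: L_def dist_norm)
  qed
  have R: "c islimpt R"
    unfolding islimpt_approachable
  proof (intro allI impI)
    fix e :: real assume "e > 0"
    then show "\<exists>x\<in>R. x \<noteq> c \<and> dist x c < e"
      using d c by (intro bexI[of _ "c + of_real (min e d / 2)"]) (auto simp: R_def dist_norm)
  qed
  have I: "c islimpt I"
    unfolding islimpt_approachable
  proof (intro allI impI)
    fix e :: real assume "e > 0"
    then have "Im c / (2 * pi) < (Im c + min e d) / (2 * pi)"
      using d by (intro divide_strict_right_mono) auto
    then obtain q where q: "q \<in> \<rat>" "Im c / (2 * pi) < q" "q < (Im c + min e d) / (2 * pi)"
      using Rats_dense_in_real by blast
    have q': "Im c < 2 * pi * q" "2 * pi * q < Im c + min e d"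
      using q by (auto simp: field_simps)
    define x where "x = of_real (2 * pi * q) * \<i>"
    have "x - c = of_real (2 * pi * q - Im c) * \<i>"
      using c by (simp add: x_def complex_eq_iff)
    then have "dist x c = 2 * pi * q - Im c"
      using q' by (simp only: dist_norm norm_mult norm_of_real norm_ii) simp
    then show "\<exists>x\<in>I. x \<noteq> c \<and> dist x c < e"
      using q q' x_def unfolding I_def
      by (intro bexI[of _ x] CollectI conjI bexI[of _ q]) (auto simp: dist_commute)
  qed
  have AY: "A x \<in> Y" if "x \<in> Y" for x
  proof -
    have "csubspace {x. A x \<in> Y}"
      using csubspaceD[OF cs] linear_0[OF bounded_linear.linear[OF bounded_linear]]
      by (auto simp: csubspace_def subspace_def add scale scaleC_of_real[symmetric])
    moreover have "v \<mu> \<in> Y" if "\<mu> \<in> ball c d" for \<mu>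
      unfolding Y_def by (rule subsetD[OF closure_subset], rule subsetD[OF cspan_superset]) (use that in simp)
    then have "v ` ball c d \<subseteq> {x. A x \<in> Y}"
      using csubspaceD(4)[OF cs] by (auto simp: eig)
    ultimately have sub: "cspan (v ` ball c d) \<subseteq> {x. A x \<in> Y}" by (intro cspan_minimal)
    have "closed {x. A x \<in> Y}"
      using closed_vimage[of Y A] linear_continuous_on[OF bounded_linear, of UNIV]
      by (simp add: vimage_def Y_def)
    from closure_minimal[OF sub this] show ?thesis using that unfolding Y_def by blast
  qed
  show inv: "expop A t x \<in> Y" if "x \<in> Y" for t x
    by (rule expop_invariant[OF _ cs AY that]) (simp add: Y_def)
  have YI: "Y = closure (cspan (v ` I))" by (rule dense[OF _ I, symmetric]) (auto simp: I_def)
  have "cspan (v ` I) \<subseteq> {x \<in> Y. \<exists>t>0. expop A t x = x}"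
  proof
    fix x assume x: "x \<in> cspan (v ` I)"
    have "x \<in> Y" unfolding YI by (rule subsetD[OF closure_subset x])
    moreover have "\<exists>t>0. expop A t x = x"
    proof (rule periodic_in_rational_span[OF _ x])
      fix w assume "w \<in> v ` I"
      then obtain \<mu> q where "w = v \<mu>" "\<mu> \<in> ball c d" "q \<in> \<rat>" "\<mu> = of_real (2 * pi * q) * \<i>"
        unfolding I_def by blast
      then show "\<exists>q\<in>\<rat>. A w = (of_real (2 * pi * q) * \<i>) *\<^sub>C w" using eig by blast
    qed
    ultimately show "x \<in> {x \<in> Y. \<exists>t>0. expop A t x = x}" by simp
  qed
  from closure_mono[OF this] show "Y \<subseteq> closure {x \<in> Y. \<exists>t>0. expop A t x = x}"
    unfolding YI[symmetric] .
  have "countable I"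
  proof (rule countable_subset)
    show "I \<subseteq> (\<lambda>q. of_real (2 * pi * q) * \<i>) ` \<rat>" by (auto simp: I_def)
  qed (intro countable_image countable_rat)
  then have "countable (v ` I \<union> scaleC \<i> ` v ` I)" by simp
  then obtain Q where Q: "countable Q" "Q \<subseteq> cspan (v ` I)" "cspan (v ` I) \<subseteq> closure Q"
    unfolding cspan_def by (rule countable_dense_in_span)
  have Q': "Q \<subseteq> Y" "Y \<subseteq> closure Q"
    unfolding YI by (rule order.trans[OF Q(2) closure_subset], rule closure_minimal[OF Q(3) closed_closure])
  show "\<exists>x\<in>Y. Y \<subseteq> closure {expop A t x |t. t \<ge> 0}"
  proof (rule dense_orbit[OF _ inv Q(1) Q'])
    show "closed Y" by (simp add: Y_def)
    show "Y \<noteq> {}" using csubspaceD(1)[OF cs] by blast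
    fix U V :: "'a set" assume UV: "open U" "open V" "U \<inter> Y \<noteq> {}" "V \<inter> Y \<noteq> {}"
    have YL: "Y = closure (cspan (v ` L))" by (rule dense[OF _ L, symmetric]) (auto simp: L_def)
    have YR: "Y = closure (cspan (v ` R))" by (rule dense[OF _ R, symmetric]) (auto simp: R_def)
    obtain x where x: "x \<in> U" "x \<in> cspan (v ` L)"
      using UV(3) unfolding YL open_Int_closure_eq_empty[OF UV(1)] by auto
    obtain y where y: "y \<in> V" "y \<in> cspan (v ` R)"
      using UV(4) unfolding YR open_Int_closure_eq_empty[OF UV(2)] by auto
    have dx: "((\<lambda>t. expop A t x) \<longlongrightarrow> 0) at_top"
      by (rule decay_of_stable_span[OF _ x(2)]) (use eig in \<open>auto simp: L_def\<close>)
    have "\<exists>s. (\<forall>t. s t \<in> cspan (v ` R) \<and> expop A t (s t) = y) \<and> (s \<longlongrightarrow> 0) at_top"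
      by (rule small_preimages_in_unstable_span[OF _ y(2)]) (use eig in \<open>auto simp: R_def\<close>)
    then obtain s where s: "\<And>t. s t \<in> cspan (v ` R)" "\<And>t. expop A t (s t) = y" "(s \<longlongrightarrow> 0) at_top"
      by blast
    have "((\<lambda>t. x + s t) \<longlongrightarrow> x + 0) at_top" by (rule tendsto_add[OF tendsto_const s(3)])
    from topological_tendstoD[OF this UV(1)] x have 1: "\<forall>\<^sub>F t in at_top. x + s t \<in> U" by simp
    have "((\<lambda>t. expop A t x + y) \<longlongrightarrow> 0 + y) at_top" by (rule tendsto_add[OF dx tendsto_const])
    from topological_tendstoD[OF this UV(2)] y have 2: "\<forall>\<^sub>F t in at_top. expop A t x + y \<in> V" by simp
    have "\<forall>\<^sub>F t in at_top. t \<ge> 0 \<and> x + s t \<in> U \<and> expop A t x + y \<in> V"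
      using 1 2 eventually_ge_at_top[of 0] by eventually_elim auto
    then obtain t where t: "t \<ge> 0" "x + s t \<in> U" "expop A t x + y \<in> V"
      using eventually_happens'[OF trivial_limit_at_top_linorder, of "\<lambda>t. t \<ge> 0 \<and> x + s t \<in> U \<and> expop A t x + y \<in> V"]
      by auto
    have "x \<in> Y" unfolding YL by (rule subsetD[OF closure_subset x(2)])
    moreover have "s t \<in> Y" unfolding YR by (rule subsetD[OF closure_subset s(1)])
    ultimately have "x + s t \<in> Y" by (rule csubspaceD[OF cs])
    with t show "\<exists>t\<ge>0. \<exists>x\<in>U \<inter> Y. expop A t x \<in> V"
      by (intro exI[of _ t] conjI bexI[of _ "x + s t"]) (auto simp: expop_add s)
  qed
qed

end

section \<open>Periodic points and imaginary eigenvalues\<close>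

definition root_poly :: "complex set \<Rightarrow> complex \<Rightarrow> complex" where
  "root_poly K z = (\<Prod>\<kappa>\<in>K. z - \<kappa>)"

lemma root_poly_holomorphic: "root_poly K holomorphic_on S"
  unfolding root_poly_def by (intro holomorphic_intros)

context cbounded_op
begin

lemma fcalc_diff_const: "fcalc A (\<lambda>z. z - c) u = A u - c *\<^sub>C u"
proof -
  have "fcalc A (\<lambda>z. z + - c) u = fcalc A (\<lambda>z. z) u + fcalc A (\<lambda>z. - c) u"
    by (rule fcalc_add_left[of _ "r + 1"]) (auto intro: holomorphic_intros)
  then show ?thesis by (simp add: fcalc_ident fcalc_const scaleC.minus_left)
qed

lemma fcalc_root_poly_insert:
  assumes "finite K" "c \<notin> K"
  shows "fcalc A (root_poly (insert c K)) u = fcalc A (root_poly K) (A u - c *\<^sub>C u)"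
proof -
  have "root_poly (insert c K) = (\<lambda>z. root_poly K z * (z - c))"
    using assms by (simp add: root_poly_def fun_eq_iff mult.commute)
  moreover have "fcalc A (\<lambda>z. root_poly K z * (z - c)) u = fcalc A (root_poly K) (fcalc A (\<lambda>z. z - c) u)"
    by (rule fcalc_mult[of _ "r + 1"]) (auto intro: holomorphic_intros root_poly_holomorphic)
  ultimately show ?thesis by (simp add: fcalc_diff_const)
qed

text \<open>The function \<open>f z = exp (t z) - 1\<close> has simple imaginary zeros, finitely many of them in
  the disc of radius \<open>R = r + 1\<close>. If these form \<open>K\<close>, then \<open>h = root_poly K / f\<close> is
  holomorphic on the disc, whence \<open>root_poly K (A) u = h (A) (exp (t A) u - u) = 0\<close>.\<close>

lemma fcalc_root_poly_periodic:
  assumes per: "expop A t u = u" and t: "t > 0"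
  obtains K where "finite K" "\<And>\<kappa>. \<kappa> \<in> K \<Longrightarrow> Re \<kappa> = 0" "fcalc A (root_poly K) u = 0"
proof -
  define R where "R = r + 1"
  have R: "R > 0" "r < R" using nonneg by (auto simp: R_def)
  define f where "f z = exp (of_real t * z) - 1" for z :: complex
  define K where "K = {z \<in> ball 0 R. f z = 0}"
  have f_zero: "Re z = 0 \<and> (\<exists>n::int. z = of_real (2 * pi * n / t) * \<i>)" if "f z = 0" for z
  proof -
    have "exp (of_real t * z) = 1" using that by (simp add: f_def)
    then obtain n :: int where n: "t * Re z = 0" "t * Im z = of_int (2 * n) * pi"
      by (auto simp: exp_eq_1)
    then have "Re z = 0" "Im z = 2 * pi * n / t" using t by (auto simp: field_simps)
    then show ?thesis by (auto simp: complex_eq_iff)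
  qed
  have "finite K"
  proof (rule finite_subset)
    show "K \<subseteq> (\<lambda>n::int. of_real (2 * pi * n / t) * \<i>) ` {n. \<bar>n\<bar> \<le> \<lceil>R * t\<rceil>}"
    proof
      fix z assume z: "z \<in> K"
      then obtain n :: int where n: "z = of_real (2 * pi * n / t) * \<i>" using f_zero by (auto simp: K_def)
      have "cmod z < R" using z by (simp add: K_def)
      moreover have "cmod z = 2 * pi * \<bar>real_of_int n\<bar> / t"
        unfolding n norm_mult norm_of_real using t by (simp add: abs_mult)
      ultimately have "2 * pi * \<bar>real_of_int n\<bar> < R * t" using t by (simp add: field_simps)
      moreover have "1 * \<bar>real_of_int n\<bar> \<le> 2 * pi * \<bar>real_of_int n\<bar>"
        by (rule mult_right_mono) (use pi_gt3 in auto)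
      ultimately have "\<bar>real_of_int n\<bar> \<le> R * t" by simp
      then have "\<bar>n\<bar> \<le> \<lceil>R * t\<rceil>" by (metis ceiling_mono ceiling_of_int of_int_abs)
      then show "z \<in> (\<lambda>n::int. of_real (2 * pi * n / t) * \<i>) ` {n. \<bar>n\<bar> \<le> \<lceil>R * t\<rceil>}"
        using n by blast
    qed
    have "{n::int. \<bar>n\<bar> \<le> \<lceil>R * t\<rceil>} = {- \<lceil>R * t\<rceil>..\<lceil>R * t\<rceil>}" by auto
    then show "finite ((\<lambda>n::int. of_real (2 * pi * n / t) * \<i>) ` {n. \<bar>n\<bar> \<le> \<lceil>R * t\<rceil>})" by simp
  qed
  define p where "p = root_poly K"
  \<comment> \<open>the values on K are those of l'Hopital's rule, as f' = t at the zeros of f\<close>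
  define h where "h z = (if z \<in> K then deriv p z / of_real t else p z / f z)" for z
  have p_hol: "p holomorphic_on S" and f_hol: "f holomorphic_on S" for S
    unfolding p_def f_def by (intro root_poly_holomorphic holomorphic_intros)+
  have h_hol: "h holomorphic_on ball 0 R"
  proof (rule no_isolated_singularity'[OF _ _ open_ball \<open>finite K\<close>])
    fix z assume z: "z \<in> K"
    have p': "(p has_field_derivative deriv p z) (at z)"
      using p_hol[of UNIV] holomorphic_derivI by blast
    have f': "(f has_field_derivative of_real t * exp (of_real t * z)) (at z)"
      unfolding f_def by (auto intro!: derivative_eq_intros)
    have ez: "exp (of_real t * z) = 1" using z by (simp add: K_def f_def)
    have pz: "p z = 0" using z \<open>finite K\<close> by (simp add: p_def root_poly_def prod_zero_iff)
    have "((\<lambda>w. p w / f w) \<longlongrightarrow> deriv p z / of_real t) (at z)"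
      by (rule lhopital_complex_simple[OF p' f']) (use z t ez pz in \<open>auto simp: K_def\<close>)
    moreover have "\<forall>\<^sub>F w in at z. p w / f w = h w"
    proof -
      have "open (- (K - {z}))" by (intro open_Compl finite_imp_closed) (use \<open>finite K\<close> in auto)
      then have "\<forall>\<^sub>F w in nhds z. w \<in> - (K - {z})" by (rule eventually_nhds_in_open) auto
      then show ?thesis unfolding eventually_at_filter by eventually_elim (auto simp: h_def)
    qed
    ultimately have "(h \<longlongrightarrow> deriv p z / of_real t) (at z)" by (rule Lim_transform_eventually)
    then have "(h \<longlongrightarrow> h z) (at z)" using z by (simp add: h_def)
    then show "(h \<longlongrightarrow> h z) (at z within ball 0 R)" by (rule tendsto_within_subset) auto
  next
    have "(\<lambda>z. p z / f z) holomorphic_on ball 0 R - K"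
      by (intro holomorphic_intros p_hol f_hol) (auto simp: K_def)
    then show "h holomorphic_on ball 0 R - K"
      by (rule holomorphic_transform) (auto simp: h_def)
  qed
  have "h z * f z = p z" if "z \<in> ball 0 R" for z
  proof (cases "z \<in> K")
    case True
    then show ?thesis using \<open>finite K\<close> by (auto simp: K_def p_def root_poly_def prod_zero_iff)
  next
    case False
    then show ?thesis using that by (auto simp: h_def K_def)
  qed
  then have "fcalc A p = fcalc A (\<lambda>z. h z * f z)"
    by (intro fcalc_cong[of R]) (use R in auto)
  then have "fcalc A p u = fcalc A (\<lambda>z. h z * f z) u" by (simp only:)
  also have "\<dots> = fcalc A h (fcalc A f u)"
    by (rule fcalc_mult[OF h_hol f_hol R(2)])
  also have "fcalc A f u = fcalc A (\<lambda>z. exp (of_real t * z)) u + fcalc A (\<lambda>z. -1) u"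
    unfolding f_def diff_conv_add_uminus by (rule fcalc_add_left[OF _ _ R(2)]) (intro holomorphic_intros)+
  also have "\<dots> = 0"
    using per by (simp add: expop_def fcalc_const scaleC_minus_one)
  also have "fcalc A h 0 = 0"
    using fcalc_scale_right[OF h_hol R(2), of 0 0] by simp
  finally have "fcalc A (root_poly K) u = 0" by (simp add: p_def)
  moreover have "Re z = 0" if "z \<in> K" for z using that f_zero by (auto simp: K_def)
  ultimately show ?thesis using that \<open>finite K\<close> by blast
qed

definition eigenvectors :: "'a set \<Rightarrow> complex set \<Rightarrow> 'a set" where
  "eigenvectors Z K = {v \<in> Z. \<exists>\<kappa>\<in>K. A v = \<kappa> *\<^sub>C v}"

text \<open>The kernel of a product of distinct linear factors is the sum of the eigenspaces. In the
  induction, \<open>A - \<mu>\<close> maps the sum of the eigenspaces for \<open>K\<close> onto itself since \<open>\<mu> \<notin> K\<close>;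
  subtracting from \<open>u\<close> a preimage of \<open>A u - \<mu> u\<close> in this sum leaves an element of the kernel of \<open>A - \<mu>\<close>.\<close>

lemma root_poly_kernel:
  assumes Z: "csubspace Z" "\<And>x. x \<in> Z \<Longrightarrow> A x \<in> Z"
    and "finite K" "u \<in> Z" "fcalc A (root_poly K) u = 0"
  shows "u \<in> cspan (eigenvectors Z K)"
  using assms(3-5)
proof (induction K arbitrary: u rule: finite_induct)
  case empty
  have "root_poly {} = (\<lambda>z. 1)" by (simp add: root_poly_def fun_eq_iff)
  then have "u = 0" using empty by (simp add: fcalc_const)
  then show ?case using csubspaceD(1)[OF csubspace_cspan] by simp
next
  case (insert \<mu> K)
  let ?E = "cspan (eigenvectors Z K)"
  note cs = csubspaceD[OF csubspace_cspan]
  have sub: "?E \<subseteq> Z" by (rule cspan_minimal[OF _ Z(1)]) (auto simp: eigenvectors_def)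
  define G where "G = {y. \<exists>w\<in>?E. A w - \<mu> *\<^sub>C w = y}"
  have GI: "y \<in> G" if "w \<in> ?E" "A w - \<mu> *\<^sub>C w = y" for w y using that by (auto simp: G_def)
  interpret lin: bounded_linear A by (rule bounded_linear)
  have Gs: "c *\<^sub>C y \<in> G" if y: "y \<in> G" for c y
  proof -
    obtain w where "w \<in> ?E" "A w - \<mu> *\<^sub>C w = y" using y by (auto simp: G_def)
    then show ?thesis
      by (intro GI[of "c *\<^sub>C w"] cs) (auto simp: scale scaleC.diff_right scaleC_scaleC mult.commute)
  qed
  have "x + y \<in> G" if xy: "x \<in> G" "y \<in> G" for x y
  proof -
    obtain w w' where "w \<in> ?E" "A w - \<mu> *\<^sub>C w = x" "w' \<in> ?E" "A w' - \<mu> *\<^sub>C w' = y"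
      using xy by (auto simp: G_def)
    then show ?thesis
      by (intro GI[of "w + w'"] cs) (auto simp: add scaleC_add_right algebra_simps)
  qed
  moreover have "0 \<in> G" using cs(1) by (intro GI[of 0]) (auto simp: lin.zero)
  ultimately have "csubspace G" using Gs by (auto simp: csubspace_def subspace_def scaleC_of_real[symmetric])
  moreover have "eigenvectors Z K \<subseteq> G"
  proof
    fix v assume v: "v \<in> eigenvectors Z K"
    then obtain \<kappa> where l: "\<kappa> \<in> K" "A v = \<kappa> *\<^sub>C v" by (auto simp: eigenvectors_def)
    then have "\<kappa> - \<mu> \<noteq> 0" using insert by auto
    have "v \<in> ?E" using v cspan_superset by blast
    show "v \<in> G"
    proof (rule GI)
      show "inverse (\<kappa> - \<mu>) *\<^sub>C v \<in> ?E" using \<open>v \<in> ?E\<close> by (rule cs)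
      have "A (inverse (\<kappa> - \<mu>) *\<^sub>C v) - \<mu> *\<^sub>C inverse (\<kappa> - \<mu>) *\<^sub>C v =
          ((\<kappa> - \<mu>) * inverse (\<kappa> - \<mu>)) *\<^sub>C v"
        by (simp only: scale l scaleC_scaleC scaleC.diff_left[symmetric] left_diff_distrib mult.commute)
      then show "A (inverse (\<kappa> - \<mu>) *\<^sub>C v) - \<mu> *\<^sub>C inverse (\<kappa> - \<mu>) *\<^sub>C v = v"
        using \<open>\<kappa> - \<mu> \<noteq> 0\<close> by simp
    qed
  qed
  ultimately have "?E \<subseteq> G" by (intro cspan_minimal)
  moreover have "A u - \<mu> *\<^sub>C u \<in> ?E"
    using insert fcalc_root_poly_insert[OF insert(1,2), of u]
    by (intro insert.IH) (auto intro: csubspaceD[OF Z(1)] Z(2))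
  ultimately obtain w where w: "w \<in> ?E" "A w - \<mu> *\<^sub>C w = A u - \<mu> *\<^sub>C u" by (auto simp: G_def)
  have "w \<in> Z" using sub w(1) by blast
  then have "u - w \<in> Z" using insert by (intro csubspaceD[OF Z(1)])
  moreover have "A (u - w) = \<mu> *\<^sub>C (u - w)"
    using w(2) by (simp add: lin.diff scaleC.diff_right algebra_simps)
  ultimately have "u - w \<in> eigenvectors Z (insert \<mu> K)" by (auto simp: eigenvectors_def)
  then have 1: "u - w \<in> cspan (eigenvectors Z (insert \<mu> K))" using cspan_superset by blast
  have "eigenvectors Z K \<subseteq> eigenvectors Z (insert \<mu> K)" by (auto simp: eigenvectors_def)
  then have 2: "w \<in> cspan (eigenvectors Z (insert \<mu> K))" using w(1) cspan_mono by blast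
  show ?case using cs(2)[OF 1 2] by simp
qed

lemma bounded_orbit_imaginary_span:
  assumes "\<And>\<kappa>. \<kappa> \<in> K \<Longrightarrow> Re \<kappa> = 0" and "x \<in> cspan (eigenvectors Z K)"
  shows "\<exists>M. \<forall>t. norm (expop A t x) \<le> M"
proof -
  define G where "G = {x. \<exists>M. \<forall>t. norm (expop A t x) \<le> M}"
  have GI: "x \<in> G" if "\<And>t. norm (expop A t x) \<le> M" for x M using that by (auto simp: G_def)
  have Gs: "c *\<^sub>C y \<in> G" if y: "y \<in> G" for c y
  proof -
    obtain M where "\<And>t. norm (expop A t y) \<le> M" using y by (auto simp: G_def)
    then show ?thesis
      by (intro GI[of _ "cmod c * M"]) (auto simp: expop_scale norm_scaleC mult_left_mono)
  qed
  have "x + y \<in> G" if xy: "x \<in> G" "y \<in> G" for x y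
  proof -
    obtain M N where "\<And>t. norm (expop A t x) \<le> M" "\<And>t. norm (expop A t y) \<le> N"
      using xy by (auto simp: G_def)
    then show ?thesis
      by (intro GI[of _ "M + N"]) (auto simp: expop_add intro: norm_triangle_le add_mono)
  qed
  moreover have "0 \<in> G" by (rule GI[of _ 0]) (simp add: expop_zero)
  ultimately have "csubspace G" using Gs by (auto simp: csubspace_def subspace_def scaleC_of_real[symmetric])
  moreover have "eigenvectors Z K \<subseteq> G"
  proof
    fix v assume "v \<in> eigenvectors Z K"
    then obtain \<kappa> where l: "\<kappa> \<in> K" "A v = \<kappa> *\<^sub>C v" by (auto simp: eigenvectors_def)
    show "v \<in> G"
      by (rule GI[of _ "norm v"]) (simp add: expop_eigenvector[OF l(2)] norm_scaleC norm_exp_eq_Re assms(1)[OF l(1)])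
  qed
  ultimately have "x \<in> G" using cspan_minimal assms(2) by blast
  then show ?thesis by (simp add: G_def)
qed

text \<open>Suppose that all imaginary eigenvalues on \<open>Z\<close> are in \<open>F\<close>. Then each periodic vector in \<open>Y\<close> is
  a combination of eigenvectors for eigenvalues in the finite set \<open>K0 = F \<inter> \<i>\<real>\<close>, so it is annihilated by
  \<open>root_poly K0 (A)\<close>. By continuity so is every vector in \<open>Y\<close>, which therefore has a bounded orbit, and a
  bounded set is not dense in a nonzero subspace.\<close>

theorem chaos_implies_imaginary_eigenvalue:
  assumes Z: "csubspace Z" "\<And>x. x \<in> Z \<Longrightarrow> A x \<in> Z"
    and Y: "csubspace Y" "Y \<subseteq> Z" "Y \<noteq> {0}" and F: "finite F"
    and orbit: "x \<in> Y" "Y \<subseteq> closure {expop A t x |t. t \<ge> 0}"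
    and per: "Y \<subseteq> closure {x \<in> Y. \<exists>t>0. expop A t x = x}"
  obtains \<kappa> v where "v \<in> Z" "v \<noteq> 0" "A v = \<kappa> *\<^sub>C v" "Re \<kappa> = 0" "\<kappa> \<notin> F"
proof (rule ccontr)
  assume not: "\<not> thesis"
  define K0 where "K0 = {\<kappa> \<in> F. Re \<kappa> = 0}"
  have K0: "finite K0" using F by (simp add: K0_def)
  have "{x \<in> Y. \<exists>t>0. expop A t x = x} \<subseteq> cspan (eigenvectors Z K0)"
  proof clarify
    fix u t assume u: "u \<in> Y" "t > 0" "expop A t u = u"
    obtain K where K: "finite K" "\<And>\<kappa>. \<kappa> \<in> K \<Longrightarrow> Re \<kappa> = 0" "fcalc A (root_poly K) u = 0"
      using fcalc_root_poly_periodic[OF u(3,2)] by blast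
    have "u \<in> cspan (eigenvectors Z K)"
      by (rule root_poly_kernel[OF Z K(1) _ K(3)]) (use u Y in auto)
    moreover have "eigenvectors Z K \<subseteq> cspan (eigenvectors Z K0)"
    proof
      fix v assume "v \<in> eigenvectors Z K"
      then obtain \<kappa> where l: "v \<in> Z" "\<kappa> \<in> K" "A v = \<kappa> *\<^sub>C v" by (auto simp: eigenvectors_def)
      show "v \<in> cspan (eigenvectors Z K0)"
      proof (cases "v = 0")
        case True
        then show ?thesis using csubspaceD(1)[OF csubspace_cspan] by simp
      next
        case False
        then have "\<kappa> \<in> K0" using not that[OF l(1) False l(3)] K(2)[OF l(2)] by (auto simp: K0_def)
        then have "v \<in> eigenvectors Z K0" using l by (auto simp: eigenvectors_def)
        then show ?thesis using cspan_superset by blast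
      qed
    qed
    ultimately show "u \<in> cspan (eigenvectors Z K0)" using cspan_minimal[OF _ csubspace_cspan] by blast
  qed
  moreover
  let ?p = "fcalc A (root_poly K0)"
  define N where "N = {u. ?p u = 0}"
  interpret P: cbounded_op ?p "\<Sum>k. cmod (taylor (root_poly K0) k) * r ^ k"
    by (rule fcalc_bounded_op[of _ "r + 1"]) (auto intro: root_poly_holomorphic)
  interpret Pl: bounded_linear ?p by (rule P.bounded_linear)
  have "csubspace N"
    by (auto simp: N_def csubspace_def subspace_def P.add P.scale Pl.zero scaleC_of_real[symmetric])
  moreover have "eigenvectors Z K0 \<subseteq> N"
  proof
    fix v assume "v \<in> eigenvectors Z K0"
    then obtain \<kappa> where l: "\<kappa> \<in> K0" "A v = \<kappa> *\<^sub>C v" by (auto simp: eigenvectors_def)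
    have "?p v = root_poly K0 \<kappa> *\<^sub>C v"
      by (rule fcalc_eigenvector[OF root_poly_holomorphic[of _ "ball 0 (cmod \<kappa> + 1)"] _ l(2)]) simp
    also have "root_poly K0 \<kappa> = 0" using l(1) K0 by (simp add: root_poly_def prod_zero_iff)
    finally show "v \<in> N" by (simp add: N_def)
  qed
  ultimately have "{x \<in> Y. \<exists>t>0. expop A t x = x} \<subseteq> N" using cspan_minimal by blast
  moreover have "closed N"
    unfolding N_def by (intro closed_Collect_eq Pl.continuous_on continuous_on_id continuous_on_const)
  ultimately have "Y \<subseteq> N" using per closure_minimal by blast
  have "x \<in> cspan (eigenvectors Z K0)"
    by (rule root_poly_kernel[OF Z K0]) (use \<open>Y \<subseteq> N\<close> orbit Y in \<open>auto simp: N_def\<close>)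
  then obtain M where M: "\<And>t. norm (expop A t x) \<le> M"
    using bounded_orbit_imaginary_span[of K0 x Z] by (auto simp: K0_def)
  have "closure {expop A t x |t. t \<ge> 0} \<subseteq> cball 0 M"
    by (rule closure_minimal) (use M in auto)
  then have bnd: "norm y \<le> M" if "y \<in> Y" for y using orbit(2) that by auto
  obtain y where y: "y \<in> Y" "y \<noteq> 0" using Y(3) csubspaceD(1)[OF Y(1)] by blast
  have "of_real ((\<bar>M\<bar> + 1) / norm y) *\<^sub>C y \<in> Y" using y by (intro csubspaceD[OF Y(1)])
  from bnd[OF this] have "\<bar>M\<bar> + 1 \<le> M"
    using y by (simp only: scaleC_of_real norm_scaleR) simp
  then show False by simp
qed

end

section \<open>Simple roots and analytic branches\<close>

lemma poly_eq_sum_lessThan: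
  fixes p :: "complex poly"
  assumes "degree p < N"
  shows "poly p z = (\<Sum>k<N. coeff p k * z ^ k)"
proof -
  have "poly p z = (\<Sum>k\<le>degree p. coeff p k * z ^ k)" by (rule poly_altdef)
  also have "\<dots> = (\<Sum>k<N. coeff p k * z ^ k)"
    by (rule sum.mono_neutral_left) (use assms in \<open>auto simp: coeff_eq_0\<close>)
  finally show ?thesis .
qed

text \<open>The rows of the Sylvester matrix list the coefficients of the polynomials \<open>x\<^sup>k p\<close> and
  \<open>x\<^sup>k q\<close>, so the matrix annihilates the vector of powers of a common root.\<close>

lemma resultant_eq_0_of_common_root:
  fixes p q :: "complex poly"
  assumes p: "poly p z = 0" "p \<noteq> 0" and q: "poly q z = 0"
  shows "resultant p q = 0"
proof -
  define m where "m = degree p"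
  define n where "n = degree q"
  define N where "N = m + n"
  define v where "v = Matrix.vec N (\<lambda>j. z ^ (N - Suc j))"
  have "m > 0" using p by (auto simp: m_def intro: Nat.gr0I elim!: degree_eq_zeroE)
  have v: "v \<in> carrier_vec N" by (simp add: v_def)
  have "v \<noteq> 0\<^sub>v N"
  proof
    assume "v = 0\<^sub>v N"
    then have "vec_index v (N - 1) = vec_index (0\<^sub>v N) (N - 1)" by simp
    then show False using \<open>m > 0\<close> by (simp add: v_def N_def)
  qed
  have entry_sum: "(\<Sum>j\<in>{0..<N}. coeff (monom 1 (Suc k) * r) (N - j) * z ^ (N - Suc j)) = 0"
    if r: "poly r z = 0" and k: "k + degree r < N" for r :: "complex poly" and k
  proof -
    have "degree (monom 1 k * r) < N"
      using degree_mult_le[of "monom 1 k" r] degree_monom_le[of "1 :: complex" k] k by linarith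
    then have "poly (monom 1 k * r) z = (\<Sum>j<N. coeff (monom 1 k * r) j * z ^ j)"
      by (rule poly_eq_sum_lessThan)
    also have "\<dots> = (\<Sum>j<N. coeff (monom 1 k * r) (N - Suc j) * z ^ (N - Suc j))"
      by (rule sum.nat_diff_reindex[symmetric])
    also have "\<dots> = (\<Sum>j\<in>{0..<N}. coeff (monom 1 (Suc k) * r) (N - j) * z ^ (N - Suc j))"
      unfolding lessThan_atLeast0
      by (rule sum.cong) (auto simp: coeff_monom_mult Suc_diff_Suc)
    finally show ?thesis using r by simp
  qed
  have "mult_mat_vec (sylvester_mat p q) v = 0\<^sub>v N"
  proof (rule eq_vecI)
    fix i assume "i < dim_vec (0\<^sub>v N :: complex vec)"
    then have i: "i < N" by simp
    have "vec_index (mult_mat_vec (sylvester_mat p q) v) i =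
        (\<Sum>j\<in>{0..<N}. index_mat (sylvester_mat p q) (i, j) * z ^ (N - Suc j))"
      using i by (simp add: v_def scalar_prod_def N_def m_def n_def)
    also have "\<dots> = 0"
    proof (cases "i < n")
      case True
      have "(\<Sum>j\<in>{0..<N}. index_mat (sylvester_mat p q) (i, j) * z ^ (N - Suc j)) =
          (\<Sum>j\<in>{0..<N}. coeff (monom 1 (Suc (n - Suc i)) * p) (N - j) * z ^ (N - Suc j))"
        using i True by (intro sum.cong) (auto simp: sylvester_index_mat2 N_def m_def n_def Suc_diff_Suc)
      also have "\<dots> = 0" by (rule entry_sum[OF p(1)]) (use True in \<open>simp add: N_def m_def\<close>)
      finally show ?thesis .
    next
      case False
      have "(\<Sum>j\<in>{0..<N}. index_mat (sylvester_mat p q) (i, j) * z ^ (N - Suc j)) =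
          (\<Sum>j\<in>{0..<N}. coeff (monom 1 (Suc (N - Suc i)) * q) (N - j) * z ^ (N - Suc j))"
        using i False by (intro sum.cong) (auto simp: sylvester_index_mat2 N_def m_def n_def Suc_diff_Suc)
      also have "\<dots> = 0" by (rule entry_sum[OF q]) (use i False in \<open>simp add: N_def n_def\<close>)
      finally show ?thesis .
    qed
    finally show "vec_index (mult_mat_vec (sylvester_mat p q) v) i = vec_index (0\<^sub>v N) i"
      using i by simp
  qed (simp add: N_def m_def n_def)
  with v \<open>v \<noteq> 0\<^sub>v N\<close> show ?thesis
    unfolding resultant_def
    using det_0_iff_vec_prod_zero_field[OF sylvester_carrier_mat[of p q]]
    by (auto simp: N_def m_def n_def)
qed

lemma disc_nonzero_simple_root:
  assumes "disc p \<noteq> 0" "poly p z = 0"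
  shows "poly (pderiv p) z \<noteq> 0"
  using resultant_eq_0_of_common_root[OF assms(2)] assms(1) by (auto simp: disc_def)

lemma tendsto_nhds_of_continuous_on:
  fixes f :: "'a::t2_space \<Rightarrow> 'b::topological_space"
  shows "continuous_on UNIV f \<Longrightarrow> (f \<longlongrightarrow> f x) (nhds x)"
  by (simp add: continuous_on_eq_continuous_at isCont_def tendsto_at_iff_tendsto_nhds)

text \<open>Newton's iteration with the fixed slope \<open>c = F' \<mu>0 z0\<close>, started at \<open>z0\<close>, contracts by the factor
  \<open>1/2\<close> near \<open>z0\<close> uniformly for \<open>\<mu>\<close> near \<open>\<mu>0\<close>. The iterates depend holomorphically on
  \<open>\<mu>\<close>, and so does their uniform limit \<open>\<zeta>\<close>. The first assumption expresses joint
  holomorphy of \<open>F\<close> by substitution of holomorphic functions of \<open>\<mu>\<close> for \<open>z\<close>.\<close>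

lemma holomorphic_implicit_function:
  fixes F :: "complex \<Rightarrow> complex \<Rightarrow> complex"
  assumes comp: "\<And>g S. g holomorphic_on S \<Longrightarrow> (\<lambda>\<mu>. F \<mu> (g \<mu>)) holomorphic_on S"
    and deriv: "\<And>\<mu> z. (F \<mu> has_field_derivative F' \<mu> z) (at z)"
    and cont: "continuous_on UNIV (\<lambda>(\<mu>, z). F' \<mu> z)"
    and zero: "F \<mu>0 z0 = 0" and simple: "F' \<mu>0 z0 \<noteq> 0" and e: "e > 0"
  obtains d \<zeta> where "d > 0" "\<zeta> holomorphic_on ball \<mu>0 d" "\<zeta> \<mu>0 = z0"
    "\<And>\<mu>. \<mu> \<in> ball \<mu>0 d \<Longrightarrow> \<zeta> \<mu> \<in> ball z0 e \<and> F \<mu> (\<zeta> \<mu>) = 0"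
proof -
  define c where "c = F' \<mu>0 z0"
  have c: "c \<noteq> 0" using simple by (simp add: c_def)
  define G where "G p = 1 - F' (fst p) (snd p) / c" for p
  have "continuous_on UNIV G"
    unfolding G_def using cont c by (intro continuous_intros) (auto simp: case_prod_beta)
  then have "(G \<longlongrightarrow> G (\<mu>0, z0)) (nhds (\<mu>0, z0))"
    by (rule tendsto_nhds_of_continuous_on)
  moreover have "G (\<mu>0, z0) = 0" using c by (simp add: c_def G_def)
  ultimately have "\<forall>\<^sub>F p in nhds (\<mu>0, z0). dist (G p) 0 < 1 / 2"
    by (intro tendstoD) auto
  then obtain s where "s > 0" "\<And>p. dist p (\<mu>0, z0) < s \<Longrightarrow> dist (G p) 0 < 1 / 2"
    unfolding eventually_nhds_metric by blast
  then have s: "s > 0" "\<And>\<mu> z. dist (\<mu>, z) (\<mu>0, z0) < s \<Longrightarrow> cmod (1 - F' \<mu> z / c) < 1 / 2"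
    by (force simp: G_def)+
  \<comment> \<open>on this ball and for these parameters T has the Lipschitz constant 1/2, and it moves the centre by at most b / 2, so that it maps the ball into itself\<close>
  define b where "b = min (e / 2) (s / 4)"
  have b: "b > 0" "b < e" "b \<le> s / 4" using e s by (auto simp: b_def)
  have "(\<lambda>\<mu>. F \<mu> z0) holomorphic_on UNIV" by (intro comp holomorphic_intros)
  then have "continuous_on UNIV (\<lambda>\<mu>. F \<mu> z0)" by (rule holomorphic_on_imp_continuous_on)
  from tendsto_nhds_of_continuous_on[OF this, of \<mu>0]
  have "((\<lambda>\<mu>. F \<mu> z0) \<longlongrightarrow> F \<mu>0 z0) (nhds \<mu>0)" .
  then have "\<forall>\<^sub>F \<mu> in nhds \<mu>0. dist (F \<mu> z0) 0 < cmod c * (b / 2)"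
    unfolding zero by (rule tendstoD) (use c b in simp)
  then obtain s' where s': "s' > 0" "\<And>\<mu>. dist \<mu> \<mu>0 < s' \<Longrightarrow> cmod (F \<mu> z0) < cmod c * (b / 2)"
    unfolding eventually_nhds_metric by auto
  define d where "d = min s' (s / 4)"
  have d: "d > 0" "d \<le> s'" "d \<le> s / 4" using s s' by (auto simp: d_def)
  define T where "T \<mu> z = z - F \<mu> z / c" for \<mu> z
  have lip: "cmod (T \<mu> z - T \<mu> w) \<le> 1 / 2 * cmod (z - w)"
    if "\<mu> \<in> ball \<mu>0 d" "z \<in> cball z0 b" "w \<in> cball z0 b" for \<mu> z w
  proof (rule field_differentiable_bound[where S = "cball z0 b" and f' = "\<lambda>z. 1 - F' \<mu> z / c"])
    fix x assume x: "x \<in> cball z0 b"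
    show "(T \<mu> has_field_derivative 1 - F' \<mu> x / c) (at x within cball z0 b)"
      unfolding T_def
      by (rule has_field_derivative_at_within, intro DERIV_diff DERIV_ident DERIV_cdivide deriv)
    have "dist (\<mu>, x) (\<mu>0, z0) \<le> dist \<mu> \<mu>0 + dist x z0"
      unfolding dist_prod_def by (simp add: sqrt_sum_squares_le_sum)
    also have "\<dots> < s" using that(1) x d b s(1) by (auto simp: dist_commute)
    finally show "cmod (1 - F' \<mu> x / c) \<le> 1 / 2" by (rule less_imp_le[OF s(2)])
  qed (use that in auto)
  have start: "cmod (T \<mu> z0 - z0) \<le> b / 2" if "\<mu> \<in> ball \<mu>0 d" for \<mu>
    using s'(2)[of \<mu>] that d c by (auto simp: T_def norm_divide dist_commute field_simps)
  define g where "g k \<mu> = (T \<mu> ^^ k) z0" for k \<mu>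
  have g_Suc: "g (Suc k) \<mu> = T \<mu> (g k \<mu>)" and g_0: "g 0 \<mu> = z0" for k \<mu> by (auto simp: g_def)
  have g_in: "g k \<mu> \<in> cball z0 b" if \<mu>: "\<mu> \<in> ball \<mu>0 d" for k \<mu>
  proof (induction k)
    case (Suc k)
    have "cmod (g (Suc k) \<mu> - z0) \<le> cmod (T \<mu> (g k \<mu>) - T \<mu> z0) + cmod (T \<mu> z0 - z0)"
      using norm_triangle_ineq[of "T \<mu> (g k \<mu>) - T \<mu> z0" "T \<mu> z0 - z0"] by (simp add: g_Suc)
    also have "\<dots> \<le> 1 / 2 * cmod (g k \<mu> - z0) + b / 2"
      using b Suc by (intro add_mono lip start \<mu>) auto
    also have "\<dots> \<le> b" using Suc by (simp add: dist_norm norm_minus_commute)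
    finally show ?case by (simp add: dist_norm norm_minus_commute)
  qed (use b in \<open>simp add: g_0\<close>)
  have step: "cmod (g (Suc k) \<mu> - g k \<mu>) \<le> (1 / 2) ^ k * (b / 2)" if \<mu>: "\<mu> \<in> ball \<mu>0 d" for k \<mu>
  proof (induction k)
    case (Suc k)
    have "cmod (g (Suc (Suc k)) \<mu> - g (Suc k) \<mu>) \<le> 1 / 2 * cmod (g (Suc k) \<mu> - g k \<mu>)"
      unfolding g_Suc by (intro lip \<mu> g_in[OF \<mu>] g_in[OF \<mu>, of "Suc k", unfolded g_Suc])
    also have "\<dots> \<le> 1 / 2 * ((1 / 2) ^ k * (b / 2))" by (intro mult_left_mono Suc) auto
    finally show ?case by simp
  qed (use start[OF \<mu>] in \<open>simp add: g_Suc g_0\<close>)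
  define \<zeta> where "\<zeta> \<mu> = z0 + (\<Sum>k. g (Suc k) \<mu> - g k \<mu>)" for \<mu>
  have "uniform_limit (ball \<mu>0 d) (\<lambda>N \<mu>. \<Sum>k<N. g (Suc k) \<mu> - g k \<mu>)
      (\<lambda>\<mu>. \<Sum>k. g (Suc k) \<mu> - g k \<mu>) sequentially"
    by (rule Weierstrass_m_test[OF step]) (auto intro!: summable_mult2 summable_geometric)
  from uniform_limit_add[OF uniform_limit_const[where c = "\<lambda>_. z0"] this]
  have "uniform_limit (ball \<mu>0 d) (\<lambda>N \<mu>. z0 + (\<Sum>k<N. g (Suc k) \<mu> - g k \<mu>)) \<zeta> sequentially"
    unfolding \<zeta>_def .
  moreover have "(\<lambda>N \<mu>. z0 + (\<Sum>k<N. g (Suc k) \<mu> - g k \<mu>)) = g"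
  proof (intro ext)
    fix N \<mu>
    show "z0 + (\<Sum>k<N. g (Suc k) \<mu> - g k \<mu>) = g N \<mu>"
      using sum_lessThan_telescope[of "\<lambda>k. g k \<mu>" N] by (simp add: g_0)
  qed
  ultimately have ul: "uniform_limit (ball \<mu>0 d) g \<zeta> sequentially" by (simp only:)
  have lim: "(\<lambda>k. g k \<mu>) \<longlonglongrightarrow> \<zeta> \<mu>" if "\<mu> \<in> ball \<mu>0 d" for \<mu>
    using tendsto_uniform_limitI[OF ul that] .
  have g_hol: "g k holomorphic_on ball \<mu>0 d" for k
  proof (induction k)
    case 0
    then show ?case by (simp add: g_def)
  next
    case (Suc k)
    have "g (Suc k) = (\<lambda>\<mu>. g k \<mu> - F \<mu> (g k \<mu>) / c)" by (simp add: g_Suc T_def fun_eq_iff)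
    then show ?case
      using c by (simp only:) (intro holomorphic_on_diff holomorphic_on_divide holomorphic_on_const Suc comp)
  qed
  have \<zeta>_hol: "\<zeta> holomorphic_on ball \<mu>0 d"
  proof (rule holomorphic_uniform_sequence[OF open_ball g_hol])
    fix x assume "x \<in> ball \<mu>0 d"
    then obtain d' where "d' > 0" "cball x d' \<subseteq> ball \<mu>0 d" using open_contains_cball open_ball by blast
    then show "\<exists>d'>0. cball x d' \<subseteq> ball \<mu>0 d \<and> uniform_limit (cball x d') g \<zeta> sequentially"
      using uniform_limit_on_subset[OF ul] by blast
  qed
  have \<zeta>_start: "\<zeta> \<mu>0 = z0"
  proof -
    have "g k \<mu>0 = z0" for k by (induction k) (auto simp: g_0 g_Suc T_def zero)
    then show ?thesis using lim[of \<mu>0] d LIMSEQ_unique[OF _ tendsto_const] by simp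
  qed
  have \<zeta>_root: "\<zeta> \<mu> \<in> ball z0 e \<and> F \<mu> (\<zeta> \<mu>) = 0" if \<mu>: "\<mu> \<in> ball \<mu>0 d" for \<mu>
  proof
    have "\<zeta> \<mu> \<in> cball z0 b"
      by (rule closed_sequentially[OF closed_cball g_in[OF \<mu>] lim[OF \<mu>]])
    then show "\<zeta> \<mu> \<in> ball z0 e" using b by auto
    have "isCont (T \<mu>) (\<zeta> \<mu>)"
      unfolding T_def
      by (intro isCont_diff isCont_divide continuous_ident continuous_const DERIV_isCont[OF deriv] c)
    then have "(\<lambda>k. T \<mu> (g k \<mu>)) \<longlonglongrightarrow> T \<mu> (\<zeta> \<mu>)"
      by (rule isCont_tendsto_compose[OF _ lim[OF \<mu>]])
    moreover have "(\<lambda>k. T \<mu> (g k \<mu>)) \<longlonglongrightarrow> \<zeta> \<mu>"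
      using LIMSEQ_Suc[OF lim[OF \<mu>]] by (simp add: g_Suc)
    ultimately have "T \<mu> (\<zeta> \<mu>) = \<zeta> \<mu>" by (rule LIMSEQ_unique)
    then show "F \<mu> (\<zeta> \<mu>) = 0" using c by (simp add: T_def)
  qed
  show ?thesis by (rule that[OF d(1) \<zeta>_hol \<zeta>_start \<zeta>_root])
qed

lemma poly_pde_P:
  "poly (pde_P n m a \<mu>) z = (\<Sum>i=1..n. \<mu> ^ (i - 1) * poly (pde_p m a i) z) - \<mu> ^ n * poly (pde_q n m a) z"
  by (simp add: pde_P_def poly_sum)

lemma poly_pderiv_pde_P:
  "poly (pderiv (pde_P n m a \<mu>)) z =
    (\<Sum>i=1..n. \<mu> ^ (i - 1) * poly (pderiv (pde_p m a i)) z) - \<mu> ^ n * poly (pderiv (pde_q n m a)) z"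
  by (simp add: pde_P_def poly_sum pderiv_sum pderiv_diff pderiv_smult)

lemma analytic_root_branch:
  assumes "disc_z n m a \<mu>0 \<noteq> 0" "poly (pde_P n m a \<mu>0) z0 = 0" "e > 0"
  obtains d \<zeta> where "d > 0" "\<zeta> holomorphic_on ball \<mu>0 d" "\<zeta> \<mu>0 = z0"
    "\<And>\<mu>. \<mu> \<in> ball \<mu>0 d \<Longrightarrow> \<zeta> \<mu> \<in> ball z0 e \<and> poly (pde_P n m a \<mu>) (\<zeta> \<mu>) = 0"
proof -
  have comp: "(\<lambda>\<mu>. poly (pde_P n m a \<mu>) (g \<mu>)) holomorphic_on S" if "g holomorphic_on S" for g S
    unfolding poly_pde_P by (intro holomorphic_on_diff holomorphic_on_sum holomorphic_on_mult
      holomorphic_on_power holomorphic_on_ident poly_holomorphic_on that)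
  have cont: "continuous_on UNIV (\<lambda>(\<mu>, z). poly (pderiv (pde_P n m a \<mu>)) z)"
    unfolding poly_pderiv_pde_P case_prod_beta
    by (intro continuous_on_diff continuous_on_sum continuous_on_mult continuous_on_power
      continuous_on_poly continuous_on_fst continuous_on_snd continuous_on_id)
  have simple: "poly (pderiv (pde_P n m a \<mu>0)) z0 \<noteq> 0"
    using assms(1,2) unfolding disc_z_def by (rule disc_nonzero_simple_root)
  show ?thesis
    by (rule holomorphic_implicit_function[where F = "\<lambda>\<mu>. poly (pde_P n m a \<mu>)",
          OF comp poly_DERIV cont assms(2) simple assms(3)]) (assumption, rule that)
qed

section \<open>The weighted backward shift\<close>

type_synonym bseq = "nat \<Rightarrow>\<^sub>C complex"

lemma bcontfun_bounded_fun:
  fixes f :: "nat \<Rightarrow> 'a::real_normed_vector"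
  assumes "\<And>i. norm (f i) \<le> M"
  shows "apply_bcontfun (Bcontfun f) = f"
  by (rule Bcontfun_inverse, rule discrete_bcontfunI, rule assms)

text \<open>The effect of differentiation on the coefficients of a Herzog series, see \<open>dx_hser\<close>.\<close>

definition shift :: "real \<Rightarrow> bseq \<Rightarrow> bseq" where
  "shift \<rho> c = Bcontfun (\<lambda>k. of_real \<rho> * apply_bcontfun c (Suc k))"

lemma shift_apply: "apply_bcontfun (shift \<rho> c) k = of_real \<rho> * apply_bcontfun c (Suc k)"
proof -
  have "norm (of_real \<rho> * apply_bcontfun c (Suc k)) \<le> \<bar>\<rho>\<bar> * norm c" for k
    by (simp add: norm_mult mult_left_mono norm_bounded)
  from bcontfun_bounded_fun[of "\<lambda>k. of_real \<rho> * apply_bcontfun c (Suc k)", OF this]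
  show ?thesis by (simp add: shift_def)
qed

lemma cbounded_op_shift:
  assumes "\<rho> \<ge> 0"
  shows "cbounded_op (shift \<rho>) \<rho>"
proof
  show "shift \<rho> (x + y) = shift \<rho> x + shift \<rho> y" for x y
    by (rule bcontfun_eqI) (simp add: shift_apply distrib_left)
  show "shift \<rho> (c *\<^sub>C x) = c *\<^sub>C shift \<rho> x" for c x
    by (rule bcontfun_eqI) (simp add: shift_apply scaleC_complex_def)
  show "norm (shift \<rho> x) \<le> \<rho> * norm x" for x
    by (rule norm_bound) (use assms in \<open>simp add: shift_apply norm_mult mult_left_mono norm_bounded\<close>)
qed (rule assms)

definition null_seqs :: "bseq set" where
  "null_seqs = {c. apply_bcontfun c \<longlonglongrightarrow> 0}"

lemma scaleC_bseq: "apply_bcontfun (c *\<^sub>C x) = (\<lambda>k. c * apply_bcontfun x k)" for x :: bseq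
  by (simp add: fun_eq_iff scaleC_complex_def)

lemma csubspace_null_seqs: "csubspace null_seqs"
  unfolding csubspace_def subspace_def null_seqs_def
  using tendsto_add[of _ "0 :: complex" _ _ 0] tendsto_mult[OF tendsto_const, of _ "0 :: complex"]
  by (auto simp: scaleC_of_real[symmetric] scaleC_bseq simp del: scaleC_bcontfun_apply)

lemma closed_null_seqs: "closed null_seqs"
  unfolding closed_sequential_limits
proof (intro allI impI, elim conjE)
  fix f l assume f: "\<forall>n. f n \<in> null_seqs" and l: "f \<longlonglongrightarrow> l"
  show "l \<in> null_seqs"
    unfolding null_seqs_def mem_Collect_eq
  proof (rule LIMSEQ_I)
    fix e :: real assume "e > 0"
    then obtain n where n: "dist (f n) l < e / 2"
      using metric_LIMSEQ_D[OF l, of "e / 2"] by auto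
    have "apply_bcontfun (f n) \<longlonglongrightarrow> 0" using f by (simp add: null_seqs_def)
    then obtain N where N: "\<And>k. k \<ge> N \<Longrightarrow> norm (apply_bcontfun (f n) k - 0) < e / 2"
      using LIMSEQ_D[of _ 0 "e / 2"] \<open>e > 0\<close> by (metis half_gt_zero)
    have "norm (apply_bcontfun l k - 0) < e" if "k \<ge> N" for k
    proof -
      have "dist (apply_bcontfun (f n) k) (apply_bcontfun l k) < e / 2"
        using dist_bounded[of "f n" k l] n by simp
      then show ?thesis using N[OF that] by (simp add: dist_norm) norm
    qed
    then show "\<exists>N. \<forall>k\<ge>N. norm (apply_bcontfun l k - 0) < e" by blast
  qed
qed

lemma shift_null_seqs: "c \<in> null_seqs \<Longrightarrow> shift \<rho> c \<in> null_seqs"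
  using tendsto_mult[OF tendsto_const LIMSEQ_Suc, of "apply_bcontfun c" 0 "of_real \<rho>"]
  by (simp add: null_seqs_def shift_apply[abs_def])

text \<open>The coefficients of the function \<open>x \<mapsto> exp (z x)\<close>.\<close>

definition expo :: "real \<Rightarrow> complex \<Rightarrow> bseq" where
  "expo \<rho> z = Bcontfun (\<lambda>k. (z / of_real \<rho>) ^ k)"

lemma expo_apply:
  assumes "\<rho> > 0" "cmod z < \<rho>"
  shows "apply_bcontfun (expo \<rho> z) k = (z / of_real \<rho>) ^ k"
proof -
  have "norm ((z / of_real \<rho>) ^ k) \<le> 1" for k
    using assms by (simp add: norm_power norm_divide power_le_one)
  from bcontfun_bounded_fun[of "\<lambda>k. (z / of_real \<rho>) ^ k", OF this] show ?thesis
    by (simp add: expo_def)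
qed

lemma expo_null_seqs:
  assumes "\<rho> > 0" "cmod z < \<rho>"
  shows "expo \<rho> z \<in> null_seqs"
  using assms LIMSEQ_power_zero[of "z / of_real \<rho>"]
  by (simp add: null_seqs_def expo_apply[OF assms, abs_def] norm_divide)

lemma shift_expo:
  assumes "\<rho> > 0" "cmod z < \<rho>"
  shows "shift \<rho> (expo \<rho> z) = z *\<^sub>C expo \<rho> z"
  by (rule bcontfun_eqI) (use assms in \<open>simp add: shift_apply expo_apply scaleC_complex_def\<close>)

text \<open>An eigenvector for \<open>z\<close> is a multiple of \<open>((z/\<rho>)\<^sup>k)\<^sub>k\<close>, which does not tend to \<open>0\<close> if
  \<open>\<bar>z\<bar> \<ge> \<rho>\<close>.\<close>

lemma shift_eigenvector_null_seqs:
  assumes "\<rho> > 0" "cmod z \<ge> \<rho>" "u \<in> null_seqs" "shift \<rho> u = z *\<^sub>C u"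
  shows "u = 0"
proof -
  have rec: "apply_bcontfun u (Suc k) = z / of_real \<rho> * apply_bcontfun u k" for k
    using arg_cong[OF assms(4), of "\<lambda>f. apply_bcontfun f k"] assms(1)
    by (simp add: shift_apply scaleC_complex_def field_simps)
  have pw: "apply_bcontfun u k = (z / of_real \<rho>) ^ k * apply_bcontfun u 0" for k
    by (induction k) (simp_all add: rec mult.assoc)
  have "norm (apply_bcontfun u 0) \<le> norm (apply_bcontfun u k)" for k
  proof -
    have "1 \<le> cmod (z / of_real \<rho>) ^ k" using assms by (intro one_le_power) (simp add: norm_divide)
    then have "1 * norm (apply_bcontfun u 0) \<le> cmod (z / of_real \<rho>) ^ k * norm (apply_bcontfun u 0)"
      by (rule mult_right_mono) simp
    then show ?thesis by (subst pw[of k]) (simp add: norm_mult norm_power)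
  qed
  moreover have "(\<lambda>k. norm (apply_bcontfun u k)) \<longlonglongrightarrow> norm (0 :: complex)"
    using assms(3) by (intro tendsto_norm) (simp add: null_seqs_def)
  ultimately have "norm (apply_bcontfun u 0) \<le> norm (0 :: complex)"
    by (intro LIMSEQ_le_const) auto
  then have "apply_bcontfun u k = 0" for k by (subst pw) simp
  then show ?thesis by (intro bcontfun_eqI) simp
qed

text \<open>Each root \<open>z\<close> of \<open>p\<close> contributes a factor \<open>\<partial>\<^sub>x - z\<close>, injective by the
  preceding lemma.\<close>

lemma poly_shift_injective:
  assumes \<rho>: "\<rho> > 0"
    and "p \<noteq> 0" "\<And>z. poly p z = 0 \<Longrightarrow> cmod z \<ge> \<rho>" "u \<in> null_seqs" "fcalc (shift \<rho>) (poly p) u = 0"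
  shows "u = 0"
  using assms(2-)
proof (induction "degree p" arbitrary: p u)
  case 0
  interpret cbounded_op "shift \<rho>" \<rho> by (rule cbounded_op_shift) (use \<rho> in simp)
  obtain c where c: "p = [:c:]" using 0(1) by (metis degree_eq_zeroE)
  then have "poly p = (\<lambda>z. c)" by (simp add: fun_eq_iff)
  then show ?case using 0 c by (simp add: fcalc_const)
next
  case (Suc d)
  interpret cbounded_op "shift \<rho>" \<rho> by (rule cbounded_op_shift) (use \<rho> in simp)
  have "coeff p 0 = 0 \<or> (\<exists>i\<in>{1..degree p}. coeff p i \<noteq> 0)"
    using Suc(2) by (intro disjI2 bexI[of _ "degree p"]) auto
  then obtain z where z: "poly p z = 0"
    using fundamental_theorem_of_algebra[of "coeff p" "degree p"] unfolding poly_altdef by blast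
  then obtain p' where p': "p = p' * [:- z, 1:]" by (metis poly_eq_0_iff_dvd dvdE mult.commute)
  have "p' \<noteq> 0" using p' Suc(3) by auto
  then have d: "d = degree p'" using Suc(2) unfolding p' by (subst (asm) degree_mult_eq) auto
  have "poly p = (\<lambda>w. poly p' w * (w - z))" by (simp add: p' fun_eq_iff algebra_simps)
  then have "fcalc (shift \<rho>) (poly p) u = fcalc (shift \<rho>) (poly p') (fcalc (shift \<rho>) (\<lambda>w. w - z) u)"
    using fcalc_mult[of "poly p'" "\<rho> + 1" "\<lambda>w. w - z" u]
    by (simp add: poly_holomorphic_on holomorphic_on_diff)
  then have 0: "fcalc (shift \<rho>) (poly p') (shift \<rho> u - z *\<^sub>C u) = 0"
    using Suc by (simp add: fcalc_diff_const)
  have "shift \<rho> u - z *\<^sub>C u = 0"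
  proof (rule Suc.hyps(1)[OF d \<open>p' \<noteq> 0\<close> _ _ 0])
    show "cmod w \<ge> \<rho>" if "poly p' w = 0" for w using Suc(4)[of w] that by (simp add: p')
    show "shift \<rho> u - z *\<^sub>C u \<in> null_seqs"
      using Suc(5) by (intro csubspaceD[OF csubspace_null_seqs] shift_null_seqs)
  qed
  then show ?case
    using shift_eigenvector_null_seqs[OF \<rho> Suc(4)[OF z] Suc(5)] by simp
qed

definition unit_seq :: "nat \<Rightarrow> bseq" where
  "unit_seq k = Bcontfun (\<lambda>j. if j = k then 1 else 0)"

lemma unit_seq_apply: "apply_bcontfun (unit_seq k) j = (if j = k then 1 else 0)"
  using bcontfun_bounded_fun[of "\<lambda>j. if j = k then 1 else 0 :: complex" 1] by (simp add: unit_seq_def)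

lemma null_seqs_subset:
  assumes W: "closed W" "csubspace W" "\<And>k. unit_seq k \<in> W"
  shows "null_seqs \<subseteq> W"
proof
  fix u assume u: "u \<in> null_seqs"
  define S where "S N = (\<Sum>k<N. apply_bcontfun u k *\<^sub>C unit_seq k)" for N
  have S: "apply_bcontfun (S N) j = (if j < N then apply_bcontfun u j else 0)" for N j
  proof -
    have "apply_bcontfun (S N) j = (\<Sum>k<N. apply_bcontfun (apply_bcontfun u k *\<^sub>C unit_seq k) j)"
      unfolding S_def by (rule linear_sum[OF bounded_linear.linear[OF bounded_linear_apply_bcontfun]])
    also have "\<dots> = (\<Sum>k<N. if k = j then apply_bcontfun u j else 0)"
      by (rule sum.cong) (auto simp: unit_seq_apply scaleC_complex_def)
    finally show ?thesis by (simp add: sum.delta)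
  qed
  show "u \<in> W"
  proof (rule closed_sequentially[OF W(1)])
    show "S N \<in> W" for N unfolding S_def by (intro csubspaceD[OF W(2)] W(3))
    show "S \<longlonglongrightarrow> u"
    proof (rule metric_LIMSEQ_I)
      fix e :: real assume e: "e > 0"
      have "apply_bcontfun u \<longlonglongrightarrow> 0" using u by (simp add: null_seqs_def)
      from LIMSEQ_D[OF this, of "e / 2"] e
      obtain N where N: "\<And>k. k \<ge> N \<Longrightarrow> norm (apply_bcontfun u k) < e / 2" by auto
      have "dist (S k) u < e" if "k \<ge> N" for k
      proof -
        have "dist (S k) u \<le> e / 2"
        proof (rule dist_bound)
          show "dist (apply_bcontfun (S k) j) (apply_bcontfun u j) \<le> e / 2" for j
            using N[of j] that e by (auto simp: S dist_norm not_less intro: less_imp_le)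
        qed
        then show ?thesis using e by simp
      qed
      then show "\<exists>N. \<forall>k\<ge>N. dist (S k) u < e" by blast
    qed
  qed
qed

lemma pseries_expo:
  assumes \<rho>: "\<rho> > 0" and c: "cmod c < \<rho>"
  shows "pseries (expo \<rho>) c (\<rho> - cmod c) 1"
proof (rule pseries_bcontfun)
  fix k
  have in_disc: "cmod z < \<rho>" if "z \<in> ball c (\<rho> - cmod c)" for z
    using that norm_triangle_ineq[of "z - c" c] by (simp add: dist_norm norm_minus_commute)
  have "pseries (\<lambda>z. (z / of_real \<rho>) ^ k) c (\<rho> - cmod c) 1"
  proof (rule pseries_complex)
    show "cmod ((z / of_real \<rho>) ^ k) \<le> 1" if "z \<in> ball c (\<rho> - cmod c)" for z
      using in_disc[OF that] \<rho> by (simp add: norm_power norm_divide power_le_one)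
  qed (use \<rho> c in \<open>auto intro!: holomorphic_intros\<close>)
  then show "pseries (\<lambda>z. apply_bcontfun (expo \<rho> z) k) c (\<rho> - cmod c) 1"
    by (rule pseries_cong) (simp add: expo_apply \<rho> in_disc)
qed

lemma expo_unit_seq_sums:
  assumes \<rho>: "\<rho> > 0" and z: "cmod z < \<rho>"
  shows "(\<lambda>k. z ^ k *\<^sub>C (inverse (of_real \<rho>) ^ k *\<^sub>C unit_seq k)) sums expo \<rho> z"
proof -
  have "norm (unit_seq k) \<le> 1" for k by (rule norm_bound) (simp add: unit_seq_apply)
  then have b: "norm (inverse (of_real \<rho>) ^ k *\<^sub>C unit_seq k) \<le> 1 / \<rho> ^ k" for k
    using \<rho> by (simp add: norm_scaleC norm_power norm_inverse norm_divide divide_simps)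
  have "summable (\<lambda>k. z ^ k *\<^sub>C (inverse (of_real \<rho>) ^ k *\<^sub>C unit_seq k))"
    by (rule summable_norm_cancel, rule pseries_coeff_sums[OF b z])
  then obtain S where S: "(\<lambda>k. z ^ k *\<^sub>C (inverse (of_real \<rho>) ^ k *\<^sub>C unit_seq k)) sums S"
    by (auto simp: summable_def)
  have "S = expo \<rho> z"
  proof (rule bcontfun_eqI)
    fix j
    have "(\<lambda>k. if k = j then (z / of_real \<rho>) ^ k else 0) sums apply_bcontfun S j"
      using bounded_linear.sums[OF bounded_linear_apply_bcontfun[of j] S]
      by (simp add: unit_seq_apply scaleC_complex_def if_distrib eq_commute power_mult_distrib
          divide_inverse cong: if_cong)
    then show "apply_bcontfun S j = apply_bcontfun (expo \<rho> z) j"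
      using sums_unique2[OF _ sums_single[of j "\<lambda>k. (z / of_real \<rho>) ^ k"]]
      by (simp add: expo_apply \<rho> z)
  qed
  then show ?thesis using S by simp
qed

text \<open>The expansion of the exponentials at a point \<open>c\<close> converges for \<open>\<bar>z - c\<bar> < \<rho> - \<bar>c\<bar>\<close>. Since
  this radius is at least \<open>\<delta> = \<rho> - \<bar>z0\<bar>\<close> on the segment from \<open>z0\<close> to \<open>0\<close>, the identity theorem can be
  applied at finitely many points \<open>c j\<close> of the segment, from \<open>z0\<close> to \<open>0\<close>. At \<open>0\<close> the Taylor coefficients are multiples of
  the unit sequences, which span all null sequences.\<close>

lemma expo_total:
  assumes \<rho>: "\<rho> > 0" and z0: "cmod z0 < \<rho>" "z0 islimpt \<Lambda>"
    and W: "closed W" "csubspace W" and inW: "\<And>z. z \<in> \<Lambda> \<Longrightarrow> expo \<rho> z \<in> W"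
  shows "null_seqs \<subseteq> W"
proof -
  define \<delta> where "\<delta> = \<rho> - cmod z0"
  have \<delta>: "\<delta> > 0" using z0 by (simp add: \<delta>_def)
  obtain N :: nat where N: "cmod z0 / \<delta> < real N" using reals_Archimedean2 by blast
  have "0 < real N" using N \<delta> by (intro le_less_trans[OF _ N]) simp
  then have N': "N > 0" "cmod z0 / real N < \<delta>"
    using N \<delta> by (auto simp: field_simps)
  define c where "c j = of_real (1 - real j / real N) * z0" for j
  have c: "cmod (c j) \<le> cmod z0" if "j \<le> N" for j
    unfolding c_def norm_mult norm_of_real
    by (rule mult_left_le_one_le) (use that N' in \<open>auto simp: field_simps\<close>)
  have step: "\<forall>z\<in>ball (c j) \<delta>. expo \<rho> z \<in> W" if lim: "c j islimpt L" and L: "\<And>z. z \<in> L \<Longrightarrow> expo \<rho> z \<in> W"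
    and j: "j \<le> N" for j L
  proof
    fix z assume z: "z \<in> ball (c j) \<delta>"
    have cj: "cmod (c j) < \<rho>" using c[OF j] z0 by simp
    show "expo \<rho> z \<in> W"
    proof (rule pseries_identity[OF pseries_expo[OF \<rho> cj] _ lim W L])
      show "z \<in> ball (c j) (\<rho> - cmod (c j))" using z c[OF j] by (auto simp: \<delta>_def)
    qed (use cj in auto)
  qed
  have all: "\<forall>z\<in>ball (c j) \<delta>. expo \<rho> z \<in> W" if "j \<le> N" for j
    using that
  proof (induction j)
    case 0
    have "c 0 = z0" by (simp add: c_def)
    then show ?case using step[of 0 \<Lambda>] z0 inW by simp
  next
    case (Suc j)
    have "c j - c (Suc j) = of_real (1 / real N) * z0"
      by (simp add: c_def algebra_simps diff_divide_distrib add_divide_distrib)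
    then have "dist (c j) (c (Suc j)) = cmod z0 / real N"
      by (simp only: dist_norm norm_mult norm_of_real) simp
    then have "c (Suc j) \<in> ball (c j) \<delta>" using N' by simp
    then have "c (Suc j) islimpt ball (c j) \<delta>" by (intro interior_limit_point) simp
    then show ?case using Suc by (intro step) auto
  qed
  have "c N = 0" using N' by (simp add: c_def)
  then have ball0: "expo \<rho> z \<in> W" if "z \<in> ball 0 \<delta>" for z using all[of N] that by simp
  have "inverse (of_real \<rho>) ^ k *\<^sub>C unit_seq k \<in> W" for k
  proof (rule pseries_coefficients_in_subspace[where v = "expo \<rho>" and c = 0 and r = \<rho> and M = 1
        and \<Lambda> = "ball 0 \<delta>"])
    have "norm (unit_seq k) \<le> 1" for k by (rule norm_bound) (simp add: unit_seq_apply)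
    then show "norm (inverse (of_real \<rho>) ^ k *\<^sub>C unit_seq k) \<le> 1 / \<rho> ^ k" for k
      using \<rho> by (simp add: norm_scaleC norm_power norm_inverse norm_divide divide_simps)
    show "(\<lambda>k. (\<mu> - 0) ^ k *\<^sub>C inverse (of_real \<rho>) ^ k *\<^sub>C unit_seq k) sums expo \<rho> \<mu>"
      if "\<mu> \<in> ball 0 \<rho>" for \<mu>
      using expo_unit_seq_sums[OF \<rho>, of \<mu>] that by simp
    show "0 islimpt ball (0 :: complex) \<delta>" by (intro interior_limit_point) (simp add: \<delta>)
  qed (use \<rho> W ball0 in auto)
  from csubspaceD(4)[OF W(2) this, of "of_real \<rho> ^ k" k for k]
  have "unit_seq k \<in> W" for k
    using \<rho> by (simp add: scaleC_scaleC power_mult_distrib[symmetric])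
  then show ?thesis by (rule null_seqs_subset[OF W])
qed

section \<open>The companion operator\<close>

type_synonym bseqs = "nat \<Rightarrow>\<^sub>C bseq"

text \<open>The operator matrix \<open>A\<^sub>d\<close> on tuples of coefficient sequences; the tuples have rows \<open>1, \<dots>, n\<close>
  and all other rows vanish.\<close>

definition companion :: "real \<Rightarrow> nat \<Rightarrow> nat \<Rightarrow> (nat \<Rightarrow> nat \<Rightarrow> complex) \<Rightarrow> bseqs \<Rightarrow> bseqs" where
  "companion \<rho> n m a w = Bcontfun (\<lambda>i.
     if i \<in> {1..<n} then apply_bcontfun w (Suc i)
     else if i = n then
       (\<Sum>j=1..n. fcalc (shift \<rho>) (\<lambda>z. poly (pde_p m a j) z / poly (pde_q n m a) z) (apply_bcontfun w j))
     else 0)"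

text \<open>The tuples of coefficient sequences that correspond to the elements of \<open>X\<^sub>\<rho>\<^sup>n\<close>.\<close>

definition null_rows :: "nat \<Rightarrow> bseqs set" where
  "null_rows n = {w. (\<forall>i\<in>{1..n}. apply_bcontfun w i \<in> null_seqs) \<and>
     (\<forall>i. i \<notin> {1..n} \<longrightarrow> apply_bcontfun w i = 0)}"

lemma csubspace_null_rows: "csubspace (null_rows n)"
  using csubspaceD[OF csubspace_null_seqs]
  by (auto simp: null_rows_def csubspace_def subspace_def scaleC_of_real[symmetric])

lemma closed_null_rows: "closed (null_rows n)"
proof -
  have c: "closed ((\<lambda>w :: bseqs. apply_bcontfun w i) -` S)" if "closed S" for i S
    by (intro closed_vimage that linear_continuous_on bounded_linear_apply_bcontfun)
  have "null_rows n = (\<Inter>i\<in>{1..n}. (\<lambda>w. apply_bcontfun w i) -` null_seqs) \<inter>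
      (\<Inter>i\<in>- {1..n}. (\<lambda>w. apply_bcontfun w i) -` {0})"
    by (auto simp: null_rows_def)
  then show ?thesis by (simp only:) (intro closed_Int closed_INT ballI c closed_null_seqs closed_singleton)
qed

lemma pde_q_0: "poly (pde_q n m a) 0 = 1"
  by (simp add: pde_q_def poly_sum poly_monom)

locale herzog =
  fixes \<rho> :: real
  assumes \<rho>: "\<rho> > 0"
begin

sublocale shift: cbounded_op "shift \<rho>" \<rho>
  by (rule cbounded_op_shift) (use \<rho> in simp)

end

locale pde = herzog \<rho> for \<rho> :: real +
  fixes n m :: nat and a :: "nat \<Rightarrow> nat \<Rightarrow> complex"
  assumes n: "n \<ge> 1"
    and q_nz: "\<And>z. z \<in> cball 0 \<rho> \<Longrightarrow> poly (pde_q n m a) z \<noteq> 0"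
begin

definition symb :: "nat \<Rightarrow> complex \<Rightarrow> complex" where
  "symb j z = poly (pde_p m a j) z / poly (pde_q n m a) z"

lemma denominator_nonzero_beyond:
  "\<exists>R>\<rho>. \<forall>z\<in>ball 0 R. poly (pde_q n m a) z \<noteq> 0"
proof -
  define S where "S = {z. poly (pde_q n m a) z = 0}"
  have "finite S"
    unfolding S_def by (rule poly_roots_finite) (use pde_q_0[of n m a] in auto)
  \<comment> \<open>the value rho + 1 covers the case that q has no zeros\<close>
  define R where "R = Min (insert (\<rho> + 1) (cmod ` S))"
  have "\<rho> < cmod z" if "z \<in> S" for z
    using q_nz[of z] that by (auto simp: S_def not_le[symmetric])
  then have "R > \<rho>"
    unfolding R_def using \<open>finite S\<close> by (subst Min_gr_iff) auto
  moreover have "poly (pde_q n m a) z \<noteq> 0" if "z \<in> ball 0 R" for z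
  proof
    assume "poly (pde_q n m a) z = 0"
    then have "R \<le> cmod z" unfolding R_def by (intro Min_le) (use \<open>finite S\<close> in \<open>auto simp: S_def\<close>)
    then show False using that by simp
  qed
  ultimately show ?thesis by blast
qed

lemma symb_holomorphic:
  "\<exists>R>\<rho>. (\<forall>j. symb j holomorphic_on ball 0 R) \<and> (\<forall>z\<in>ball 0 R. poly (pde_q n m a) z \<noteq> 0)"
proof -
  obtain R where R: "R > \<rho>" "\<And>z. z \<in> ball 0 R \<Longrightarrow> poly (pde_q n m a) z \<noteq> 0"
    using denominator_nonzero_beyond by blast
  have "symb j holomorphic_on ball 0 R" for j
    unfolding symb_def using R(2) by (intro holomorphic_on_divide poly_holomorphic_on holomorphic_on_ident)
  with R show ?thesis by blast
qed

abbreviation fs :: "nat \<Rightarrow> bseq \<Rightarrow> bseq" where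
  "fs j \<equiv> fcalc (shift \<rho>) (symb j)"

lemma fs_cbounded_op: "\<exists>K. cbounded_op (fs j) K"
proof -
  obtain R where R: "R > \<rho>" "\<And>j. symb j holomorphic_on ball 0 R"
      "\<And>z. z \<in> ball 0 R \<Longrightarrow> poly (pde_q n m a) z \<noteq> 0"
    using symb_holomorphic by blast
  show ?thesis using shift.fcalc_bounded_op[OF R(2,1)] ..
qed

abbreviation Ad :: "bseqs \<Rightarrow> bseqs" where
  "Ad \<equiv> companion \<rho> n m a"

lemma fs_bound: "\<exists>K\<ge>0. \<forall>j\<in>{1..n}. \<forall>u. norm (fs j u) \<le> K * norm u"
proof -
  have "\<forall>j. \<exists>K. cbounded_op (fs j) K" using fs_cbounded_op ..
  from choice[OF this] obtain K where "\<forall>j. cbounded_op (fs j) (K j)" ..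
  then have K: "cbounded_op (fs j) (K j)" for j ..
  have K0: "K j \<ge> 0" and Kb: "norm (fs j u) \<le> K j * norm u" for j u
    by (rule cbounded_op.nonneg[OF K], rule cbounded_op.bound[OF K])
  have "norm (fs j u) \<le> (\<Sum>j=1..n. K j) * norm u" if "j \<in> {1..n}" for j u
  proof (rule order.trans[OF Kb mult_right_mono])
    show "K j \<le> (\<Sum>j=1..n. K j)" by (rule member_le_sum) (use that K0 in auto)
  qed simp
  then show ?thesis using K0 by (intro exI[of _ "\<Sum>j=1..n. K j"]) (simp add: sum_nonneg)
qed

lemma companion_apply:
  "apply_bcontfun (Ad w) i =
    (if i \<in> {1..<n} then apply_bcontfun w (Suc i)
     else if i = n then (\<Sum>j=1..n. fs j (apply_bcontfun w j)) else 0)"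
proof -
  obtain K where K: "K \<ge> 0" "\<And>j u. j \<in> {1..n} \<Longrightarrow> norm (fs j u) \<le> K * norm u" 
    using fs_bound by blast
  let ?f = "\<lambda>i. if i \<in> {1..<n} then apply_bcontfun w (Suc i)
     else if i = n then (\<Sum>j=1..n. fs j (apply_bcontfun w j)) else 0"
  have "norm (?f i) \<le> max (norm w) (norm (\<Sum>j=1..n. fs j (apply_bcontfun w j)))" for i
    using norm_bounded[of w "Suc i"] by (auto simp: le_max_iff_disj)
  then have "apply_bcontfun (Bcontfun ?f) = ?f" by (rule bcontfun_bounded_fun)
  moreover have "Ad w = Bcontfun ?f" by (simp only: companion_def symb_def[abs_def])
  ultimately show ?thesis by (simp only:)
qed

lemma companion_cbounded_op: "\<exists>K. cbounded_op Ad K"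
proof -
  obtain K where K: "K \<ge> 0" "\<And>j u. j \<in> {1..n} \<Longrightarrow> norm (fs j u) \<le> K * norm u" 
    using fs_bound by blast
  have fs_add: "fs j (x + y) = fs j x + fs j y" and fs_scale: "fs j (c *\<^sub>C x) = c *\<^sub>C fs j x" for j x y c
    using fs_cbounded_op[of j] cbounded_op.add cbounded_op.scale by blast+
  have "cbounded_op Ad (1 + n * K)"
  proof
    show "Ad (x + y) = Ad x + Ad y" for x y
      by (rule bcontfun_eqI) (simp add: companion_apply fs_add sum.distrib)
    show "Ad (c *\<^sub>C x) = c *\<^sub>C Ad x" for c x
      by (rule bcontfun_eqI) (simp add: companion_apply fs_scale scaleC.sum_right)
    show "norm (Ad x) \<le> (1 + n * K) * norm x" for x
    proof (rule norm_bound)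
      fix i
      have 1: "norm x \<le> (1 + n * K) * norm x"
        using K(1) mult_right_mono[of 1 "1 + n * K" "norm x"] by simp
      have "norm (\<Sum>j=1..n. fs j (apply_bcontfun x j)) \<le> (\<Sum>j=1..n. K * norm x)"
      proof (rule sum_norm_le)
        fix j assume j: "j \<in> {1..n}"
        have "norm (fs j (apply_bcontfun x j)) \<le> K * norm (apply_bcontfun x j)" by (rule K(2)[OF j])
        also have "\<dots> \<le> K * norm x" by (intro mult_left_mono norm_bounded K)
        finally show "norm (fs j (apply_bcontfun x j)) \<le> K * norm x" .
      qed
      also have "\<dots> \<le> (1 + n * K) * norm x" by (simp add: algebra_simps)
      finally have 2: "norm (\<Sum>j=1..n. fs j (apply_bcontfun x j)) \<le> (1 + n * K) * norm x" .
      have 3: "0 \<le> (1 + n * K) * norm x" using K(1) by simp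
      show "norm (apply_bcontfun (Ad x) i) \<le> (1 + n * K) * norm x"
        using order.trans[OF norm_bounded[of x "Suc i"] 1] 2 3 by (simp add: companion_apply)
    qed
    show "0 \<le> 1 + n * K" using K(1) by simp
  qed
  then show ?thesis ..
qed

lemma fs_null_seqs: "u \<in> null_seqs \<Longrightarrow> fs j u \<in> null_seqs"
proof -
  assume u: "u \<in> null_seqs"
  obtain R where R: "R > \<rho>" "\<And>j. symb j holomorphic_on ball 0 R"
      "\<And>z. z \<in> ball 0 R \<Longrightarrow> poly (pde_q n m a) z \<noteq> 0"
    using symb_holomorphic by blast
  show ?thesis
    by (rule shift.fcalc_closed_subspace[OF R(2,1) closed_null_seqs csubspace_null_seqs shift_null_seqs u])
qed

lemma companion_null_rows:
  assumes "w \<in> null_rows n"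
  shows "Ad w \<in> null_rows n"
proof -
  have "(\<Sum>j=1..n. fs j (apply_bcontfun w j)) \<in> null_seqs"
    by (intro csubspaceD[OF csubspace_null_seqs] fs_null_seqs) (use assms in \<open>auto simp: null_rows_def\<close>)
  then show ?thesis using assms n by (auto simp: null_rows_def companion_apply)
qed

definition eigvec :: "complex \<Rightarrow> complex \<Rightarrow> bseqs" where
  "eigvec \<mu> z = Bcontfun (\<lambda>i. if i \<in> {1..n} then \<mu> ^ (i - 1) *\<^sub>C expo \<rho> z else 0)"

lemma eigvec_apply:
  "apply_bcontfun (eigvec \<mu> z) i = (if i \<in> {1..n} then \<mu> ^ (i - 1) *\<^sub>C expo \<rho> z else 0)"
proof -
  have "norm (if i \<in> {1..n} then \<mu> ^ (i - 1) *\<^sub>C expo \<rho> z else 0)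
      \<le> (\<Sum>i=1..n. norm (\<mu> ^ (i - 1) *\<^sub>C expo \<rho> z))" for i
  proof (cases "i \<in> {1..n}")
    case True
    then show ?thesis
      using member_le_sum[of i "{1..n}" "\<lambda>i. norm (\<mu> ^ (i - 1) *\<^sub>C expo \<rho> z)"] by simp
  qed (auto intro: sum_nonneg)
  from bcontfun_bounded_fun[of "\<lambda>i. if i \<in> {1..n} then \<mu> ^ (i - 1) *\<^sub>C expo \<rho> z else 0", OF this]
  show ?thesis by (simp add: eigvec_def)
qed

lemma eigvec_null_rows: "cmod z < \<rho> \<Longrightarrow> eigvec \<mu> z \<in> null_rows n"
  by (auto simp: null_rows_def eigvec_apply intro!: csubspaceD[OF csubspace_null_seqs] expo_null_seqs \<rho>)

lemma companion_eigvec: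
  assumes z: "cmod z < \<rho>" and root: "poly (pde_P n m a \<mu>) z = 0"
  shows "Ad (eigvec \<mu> z) = \<mu> *\<^sub>C eigvec \<mu> z"
proof (rule bcontfun_eqI)
  fix i
  obtain R where R: "R > \<rho>" "\<And>j. symb j holomorphic_on ball 0 R"
      "\<And>z. z \<in> ball 0 R \<Longrightarrow> poly (pde_q n m a) z \<noteq> 0"
    using symb_holomorphic by blast
  have "fs j (expo \<rho> z) = symb j z *\<^sub>C expo \<rho> z" for j
    by (rule shift.fcalc_eigenvector[OF R(2) _ shift_expo[OF \<rho> z]]) (use z R(1) in simp)
  then have "fs j (\<mu> ^ (j - 1) *\<^sub>C expo \<rho> z) = (\<mu> ^ (j - 1) * symb j z) *\<^sub>C expo \<rho> z" for j
    using shift.fcalc_scale_right[OF R(2,1)] by (simp add: scaleC_scaleC)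
  then have "(\<Sum>j=1..n. fs j (apply_bcontfun (eigvec \<mu> z) j)) =
      (\<Sum>j=1..n. \<mu> ^ (j - 1) * symb j z) *\<^sub>C expo \<rho> z"
    by (simp add: eigvec_apply scaleC.sum_left)
  also have "(\<Sum>j=1..n. \<mu> ^ (j - 1) * symb j z) = \<mu> ^ n"
  proof -
    have "poly (pde_q n m a) z \<noteq> 0" by (rule q_nz) (use z in simp)
    moreover have "(\<Sum>j=1..n. \<mu> ^ (j - 1) * poly (pde_p m a j) z) = \<mu> ^ n * poly (pde_q n m a) z"
      using root by (simp add: poly_pde_P)
    ultimately show ?thesis by (simp add: symb_def sum_divide_distrib[symmetric] field_simps)
  qed
  finally have row: "(\<Sum>j=1..n. fs j (apply_bcontfun (eigvec \<mu> z) j)) = \<mu> ^ n *\<^sub>C expo \<rho> z" .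
  have pw: "\<mu> ^ i = \<mu> * \<mu> ^ (i - 1)" if "i \<ge> 1"
    using that by (cases i) auto
  show "apply_bcontfun (Ad (eigvec \<mu> z)) i = apply_bcontfun (\<mu> *\<^sub>C eigvec \<mu> z) i"
    unfolding companion_apply row using n pw by (auto simp: eigvec_apply scaleC_scaleC)
qed

text \<open>The first row \<open>u\<close> of an eigenvector determines the others, and the last row states that
  \<open>(P(\<mu>, \<cdot>)/q)(\<partial>\<^sub>x) u = 0\<close>. Applying \<open>q(\<partial>\<^sub>x)\<close> gives \<open>P(\<mu>, \<partial>\<^sub>x) u = 0\<close>, and without a root in
  the open disc this operator is injective on the null sequences.\<close>

lemma eigenvector_root:
  assumes w: "w \<in> null_rows n" "w \<noteq> 0" "Ad w = \<mu> *\<^sub>C w" and P: "pde_P n m a \<mu> \<noteq> 0"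
  shows "\<exists>z. cmod z < \<rho> \<and> poly (pde_P n m a \<mu>) z = 0"
proof (rule ccontr)
  assume no_root: "\<not> ?thesis"
  define u where "u = apply_bcontfun w 1"
  have eq: "apply_bcontfun (Ad w) i = \<mu> *\<^sub>C apply_bcontfun w i" for i
    using w(3) by simp
  have rows: "apply_bcontfun w (Suc i) = \<mu> ^ i *\<^sub>C u" if "i < n" for i
    using that
  proof (induction i)
    case (Suc i)
    then have "apply_bcontfun w (Suc (Suc i)) = \<mu> *\<^sub>C apply_bcontfun w (Suc i)"
      using eq[of "Suc i"] by (simp add: companion_apply)
    then show ?case using Suc by (simp add: scaleC_scaleC)
  qed (simp add: u_def)
  obtain R where R: "R > \<rho>" "\<And>j. symb j holomorphic_on ball 0 R"
      "\<And>z. z \<in> ball 0 R \<Longrightarrow> poly (pde_q n m a) z \<noteq> 0"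
    using symb_holomorphic by blast
  have u: "u \<in> null_seqs" using w(1) n by (auto simp: u_def null_rows_def)
  have "u \<noteq> 0"
  proof
    assume "u = 0"
    have "apply_bcontfun w i = 0" for i
    proof (cases "i \<in> {1..n}")
      case True
      then show ?thesis using rows[of "i - 1"] \<open>u = 0\<close> by (cases i) auto
    qed (use w(1) in \<open>auto simp: null_rows_def\<close>)
    then show False using w(2) by (auto intro: bcontfun_eqI)
  qed
  define H where "H k z = (\<Sum>j=1..k. \<mu> ^ (j - 1) * symb j z) - \<mu> ^ n" for k z
  have H_hol: "H k holomorphic_on ball 0 R" for k
    unfolding H_def by (intro holomorphic_intros R(2))
  have H_calc: "fcalc (shift \<rho>) (H k) u = (\<Sum>j=1..k. \<mu> ^ (j - 1) *\<^sub>C fs j u) - \<mu> ^ n *\<^sub>C u" for k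
  proof (induction k)
    case 0
    have "H 0 = (\<lambda>z. - (\<mu> ^ n))" by (simp add: H_def fun_eq_iff)
    then show ?case by (simp add: shift.fcalc_const scaleC.minus_left)
  next
    case (Suc k)
    have "H (Suc k) = (\<lambda>z. H k z + \<mu> ^ k * symb (Suc k) z)" by (simp add: H_def fun_eq_iff)
    moreover have "fcalc (shift \<rho>) (\<lambda>z. H k z + \<mu> ^ k * symb (Suc k) z) u =
        fcalc (shift \<rho>) (H k) u + fcalc (shift \<rho>) (\<lambda>z. \<mu> ^ k * symb (Suc k) z) u"
      by (rule shift.fcalc_add_left[OF H_hol _ R(1)]) (intro holomorphic_intros R(2))
    moreover have "fcalc (shift \<rho>) (\<lambda>z. \<mu> ^ k * symb (Suc k) z) u = \<mu> ^ k *\<^sub>C fs (Suc k) u"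
      using shift.fcalc_mult[OF _ R(2,1), of "\<lambda>z. \<mu> ^ k" "Suc k" u] by (simp add: shift.fcalc_const)
    ultimately show ?case using Suc by simp
  qed
  have "(\<Sum>j=1..n. \<mu> ^ (j - 1) *\<^sub>C fs j u) = (\<Sum>j=1..n. fs j (apply_bcontfun w j))"
  proof (rule sum.cong)
    fix j assume "j \<in> {1..n}"
    then have "apply_bcontfun w j = \<mu> ^ (j - 1) *\<^sub>C u" using rows[of "j - 1"] by (cases j) auto
    then show "\<mu> ^ (j - 1) *\<^sub>C fs j u = fs j (apply_bcontfun w j)"
      using shift.fcalc_scale_right[OF R(2,1)] by simp
  qed simp
  also have "\<dots> = \<mu> *\<^sub>C apply_bcontfun w n" using eq[of n] n by (simp add: companion_apply)
  also have "\<dots> = \<mu> ^ n *\<^sub>C u"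
    using rows[of "n - 1"] n by (cases n) (auto simp: scaleC_scaleC)
  finally have H0: "fcalc (shift \<rho>) (H n) u = 0" by (simp add: H_calc)
  have "poly (pde_P n m a \<mu>) z = poly (pde_q n m a) z * H n z" if "z \<in> ball 0 R" for z
    using R(3)[OF that]
    by (simp add: poly_pde_P H_def symb_def right_diff_distrib sum_distrib_left mult_ac)
  then have "fcalc (shift \<rho>) (poly (pde_P n m a \<mu>)) u =
      fcalc (shift \<rho>) (\<lambda>z. poly (pde_q n m a) z * H n z) u"
    by (subst fcalc_cong[of R]) (use R(1) \<rho> in auto)
  also have "\<dots> = fcalc (shift \<rho>) (poly (pde_q n m a)) (fcalc (shift \<rho>) (H n) u)"
    by (rule shift.fcalc_mult[OF _ H_hol R(1)]) (intro poly_holomorphic_on holomorphic_on_ident)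
  also have "\<dots> = 0"
    using shift.fcalc_scale_right[of "poly (pde_q n m a)" R 0 0] R(1)
    by (simp add: H0 poly_holomorphic_on)
  finally have "u = 0"
    using no_root by (intro poly_shift_injective[OF \<rho> P _ u]) (auto simp: not_less)
  then show False using \<open>u \<noteq> 0\<close> by simp
qed

text \<open>As a polynomial in \<open>\<mu>\<close> this has the leading coefficient \<open>- q(z) \<noteq> 0\<close>.\<close>

lemma finite_roots_in_time: "finite {\<mu>. poly (pde_P n m a \<mu>) z = 0}" if "cmod z < \<rho>"
proof -
  define r where "r = (\<Sum>i=1..n. monom (poly (pde_p m a i) z) (i - 1)) - monom (poly (pde_q n m a) z) n"
  have r: "poly r \<mu> = poly (pde_P n m a \<mu>) z" for \<mu>
    by (simp add: r_def poly_pde_P poly_sum poly_monom mult.commute)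
  have "coeff r n = - poly (pde_q n m a) z"
    by (auto simp: r_def coeff_sum intro!: sum.neutral)
  moreover have "poly (pde_q n m a) z \<noteq> 0" by (rule q_nz) (use that in simp)
  ultimately have "r \<noteq> 0" by auto
  then have "finite {\<mu>. poly r \<mu> = 0}" by (rule poly_roots_finite)
  then show ?thesis by (simp add: r)
qed

text \<open>Devaney chaos of the projection family, witnessed by \<open>Y\<close> and stated for coefficients.\<close>

definition chaotic_subspace :: "bseqs set \<Rightarrow> bool" where
  "chaotic_subspace Y \<longleftrightarrow> closed Y \<and> csubspace Y \<and> Y \<subseteq> null_rows n \<and> Y \<noteq> {0} \<and>
     (\<forall>t\<ge>0. \<forall>w\<in>Y. expop Ad t w \<in> Y) \<and>
     (\<exists>w\<in>Y. Y \<subseteq> closure {expop Ad t w |t. t \<ge> 0}) \<and>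
     Y \<subseteq> closure {w \<in> Y. \<exists>t>0. expop Ad t w = w} \<and>
     null_seqs \<subseteq> closure ((\<lambda>w. apply_bcontfun w 1) ` Y)"

text \<open>The eigenvectors along the analytic branch \<open>\<zeta>\<close> of roots form a holomorphic family. By
  \<open>finite_roots_in_time\<close>, the value \<open>z0\<close> is attained by \<open>\<zeta>\<close> only finitely often, so the values of \<open>\<zeta>\<close> accumulate at
  \<open>z0\<close> and the corresponding exponentials are total.\<close>

lemma chaotic_subspace_of_simple_root:
  assumes \<mu>0: "Re \<mu>0 = 0" and z0: "cmod z0 < \<rho>" and root: "poly (pde_P n m a \<mu>0) z0 = 0"
    and disc: "disc_z n m a \<mu>0 \<noteq> 0"
  shows "\<exists>Y. chaotic_subspace Y"
proof -
  obtain K where "cbounded_op Ad K" using companion_cbounded_op ..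
  then interpret A: cbounded_op "Ad" K .
  obtain d \<zeta> where d: "d > 0" and hol: "\<zeta> holomorphic_on ball \<mu>0 d" and \<zeta>0: "\<zeta> \<mu>0 = z0"
    and \<zeta>: "\<And>\<mu>. \<mu> \<in> ball \<mu>0 d \<Longrightarrow> \<zeta> \<mu> \<in> ball z0 (\<rho> - cmod z0) \<and> poly (pde_P n m a \<mu>) (\<zeta> \<mu>) = 0"
    using analytic_root_branch[OF disc root, of "\<rho> - cmod z0"] z0 by auto
  have in_disc: "cmod (\<zeta> \<mu>) < \<rho>" if "\<mu> \<in> ball \<mu>0 d" for \<mu>
    using \<zeta>[OF that] norm_triangle_ineq[of "\<zeta> \<mu> - z0" z0] by (auto simp: dist_norm norm_minus_commute)
  define v where "v \<mu> = eigvec \<mu> (\<zeta> \<mu>)" for \<mu>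
  \<comment> \<open>a common bound for the powers of all parameters in the ball with exponents below n\<close>
  define M where "M = (1 + (cmod \<mu>0 + d)) ^ n"
  have M: "M \<ge> 1" unfolding M_def using d by (intro one_le_power) simp
  have ps: "pseries v \<mu>0 d M"
  proof (intro pseries_bcontfun)
    fix i k
    let ?f = "\<lambda>\<mu>. if i \<in> {1..n} then \<mu> ^ (i - 1) * (\<zeta> \<mu> / of_real \<rho>) ^ k else 0"
    have "pseries ?f \<mu>0 d M"
    proof (rule pseries_complex[OF _ _ d])
      show "?f holomorphic_on ball \<mu>0 d"
        using \<rho> hol by (cases "i \<in> {1..n}") (auto intro!: holomorphic_intros)
      fix \<mu> assume \<mu>: "\<mu> \<in> ball \<mu>0 d"
      show "cmod (?f \<mu>) \<le> M"
      proof (cases "i \<in> {1..n}")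
        case True
        have "cmod \<mu> \<le> 1 + (cmod \<mu>0 + d)"
          using \<mu> norm_triangle_ineq[of "\<mu> - \<mu>0" \<mu>0] by (simp add: dist_norm norm_minus_commute)
        then have "cmod \<mu> ^ (i - 1) \<le> (1 + (cmod \<mu>0 + d)) ^ (i - 1)" by (intro power_mono) auto
        also have "\<dots> \<le> M" unfolding M_def using True d by (intro power_increasing) auto
        finally have "cmod \<mu> ^ (i - 1) \<le> M" .
        moreover have "(cmod (\<zeta> \<mu>) / \<rho>) ^ k \<le> 1"
          using in_disc[OF \<mu>] \<rho> by (intro power_le_one) auto
        ultimately have "cmod \<mu> ^ (i - 1) * (cmod (\<zeta> \<mu>) / \<rho>) ^ k \<le> M * 1"
          using M \<rho> by (intro mult_mono) auto
        then show ?thesis using True \<rho> by (simp add: norm_mult norm_power norm_divide)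
      next
        case False
        then have "?f \<mu> = 0" by (simp only: if_False)
        then show ?thesis using M by (simp only: norm_zero)
      qed
    qed
    then show "pseries (\<lambda>\<mu>. apply_bcontfun (apply_bcontfun (v \<mu>) i) k) \<mu>0 d M"
      by (rule pseries_cong)
        (auto simp: v_def eigvec_apply scaleC_complex_def expo_apply[OF \<rho> in_disc])
  qed
  have eig: "Ad (v \<mu>) = \<mu> *\<^sub>C v \<mu>" if "\<mu> \<in> ball \<mu>0 d" for \<mu>
    unfolding v_def by (rule companion_eigvec) (use in_disc \<zeta> that in auto)
  define Y where "Y = closure (cspan (v ` ball \<mu>0 d))"
  note chaos = A.chaos_of_eigenvector_family[OF ps d \<mu>0 eig, folded Y_def]
  have csY: "csubspace Y" unfolding Y_def by (intro csubspace_closure csubspace_cspan)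
  have vY: "v \<mu> \<in> Y" if "\<mu> \<in> ball \<mu>0 d" for \<mu>
    unfolding Y_def by (rule subsetD[OF closure_subset], rule subsetD[OF cspan_superset]) (use that in simp)
  have "v \<mu>0 \<noteq> 0"
  proof
    assume "v \<mu>0 = 0"
    then have "apply_bcontfun (apply_bcontfun (v \<mu>0) 1) 0 = 0" by simp
    then show False
      using n d by (simp add: v_def eigvec_apply scaleC_complex_def expo_apply[OF \<rho> in_disc])
  qed
  then have "Y \<noteq> {0}" using vY[of \<mu>0] d by auto
  moreover have "Y \<subseteq> null_rows n"
    unfolding Y_def
    by (intro closure_minimal closed_null_rows cspan_minimal csubspace_null_rows)
      (auto simp: v_def intro!: eigvec_null_rows in_disc)
  moreover have "null_seqs \<subseteq> closure ((\<lambda>w. apply_bcontfun w 1) ` Y)"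
  proof (rule expo_total[OF \<rho> z0, where \<Lambda> = "\<zeta> ` ball \<mu>0 d"])
    have "csubspace ((\<lambda>w. apply_bcontfun w 1) ` Y)"
      unfolding csubspace_def
    proof (intro conjI allI ballI)
      show "subspace ((\<lambda>w. apply_bcontfun w 1) ` Y)"
        using csY by (intro linear_subspace_image bounded_linear.linear[OF bounded_linear_apply_bcontfun])
          (simp add: csubspace_def)
      fix c x assume "x \<in> (\<lambda>w. apply_bcontfun w 1) ` Y"
      then obtain w where "w \<in> Y" "x = apply_bcontfun w 1" by blast
      then show "c *\<^sub>C x \<in> (\<lambda>w. apply_bcontfun w 1) ` Y"
        by (intro image_eqI[of _ _ "c *\<^sub>C w"] csubspaceD(4)[OF csY]) simp_all
    qed
    then show "csubspace (closure ((\<lambda>w. apply_bcontfun w 1) ` Y))" by (rule csubspace_closure)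
    show "expo \<rho> z \<in> closure ((\<lambda>w. apply_bcontfun w 1) ` Y)" if z: "z \<in> \<zeta> ` ball \<mu>0 d" for z
    proof -
      obtain \<mu> where \<mu>: "\<mu> \<in> ball \<mu>0 d" "z = \<zeta> \<mu>" using z by blast
      have "expo \<rho> z = apply_bcontfun (v \<mu>) 1" using n \<mu>(2) by (simp add: v_def eigvec_apply)
      then show ?thesis
        by (intro subsetD[OF closure_subset] image_eqI[OF _ vY[OF \<mu>(1)]])
    qed
    show "z0 islimpt \<zeta> ` ball \<mu>0 d"
      unfolding islimpt_approachable
    proof (intro allI impI)
      fix e :: real assume e: "e > 0"
      have "continuous_on (ball \<mu>0 d) \<zeta>" by (rule holomorphic_on_imp_continuous_on[OF hol])
      then obtain d' where d': "d' > 0" "\<And>\<mu>. \<mu> \<in> ball \<mu>0 d \<Longrightarrow> dist \<mu> \<mu>0 < d' \<Longrightarrow> dist (\<zeta> \<mu>) z0 < e"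
        using d e \<zeta>0 unfolding continuous_on_iff by force
      have "infinite (ball \<mu>0 (min d d'))"
        using uncountable_ball[of "min d d'" \<mu>0] d d'(1) by (auto dest: countable_finite)
      then have "\<not> ball \<mu>0 (min d d') \<subseteq> {\<mu>. poly (pde_P n m a \<mu>) z0 = 0}"
        using finite_roots_in_time[OF z0] finite_subset by blast
      then obtain \<mu> where \<mu>: "\<mu> \<in> ball \<mu>0 (min d d')" "poly (pde_P n m a \<mu>) z0 \<noteq> 0" by blast
      then have "\<zeta> \<mu> \<noteq> z0" "dist (\<zeta> \<mu>) z0 < e" "\<zeta> \<mu> \<in> \<zeta> ` ball \<mu>0 d"
        using \<zeta>[of \<mu>] d'(2)[of \<mu>] by (auto simp: dist_commute)
      then show "\<exists>z\<in>\<zeta> ` ball \<mu>0 d. z \<noteq> z0 \<and> dist z z0 < e" by blast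
    qed
  qed simp
  ultimately have "chaotic_subspace Y"
    using chaos csY by (simp add: chaotic_subspace_def Y_def)
  then show ?thesis ..
qed

theorem chaotic_subspace_iff:
  assumes fin: "finite {\<mu>. disc_z n m a \<mu> = 0}"
  shows "(\<exists>Y. chaotic_subspace Y) \<longleftrightarrow>
    (\<exists>\<mu>\<^sub>0 z\<^sub>0. Re \<mu>\<^sub>0 = 0 \<and> z\<^sub>0 \<in> ball 0 \<rho> \<and>
       poly (pde_P n m a \<mu>\<^sub>0) z\<^sub>0 = 0 \<and> disc_z n m a \<mu>\<^sub>0 \<noteq> 0)" (is "_ \<longleftrightarrow> ?rhs")
proof
  assume "\<exists>Y. chaotic_subspace Y"
  then obtain Y where Y: "chaotic_subspace Y" ..
  obtain K where "cbounded_op Ad K" using companion_cbounded_op ..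
  then interpret A: cbounded_op "Ad" K .
  from Y have Y': "csubspace Y" "Y \<subseteq> null_rows n" "Y \<noteq> {0}"
      "Y \<subseteq> closure {w \<in> Y. \<exists>t>0. expop Ad t w = w}"
    and orbit: "\<exists>x\<in>Y. Y \<subseteq> closure {expop Ad t x |t. t \<ge> 0}"
    unfolding chaotic_subspace_def by simp_all
  obtain x where x: "x \<in> Y" "Y \<subseteq> closure {expop Ad t x |t. t \<ge> 0}"
    using orbit by (rule bexE)
  show ?rhs
  proof (rule A.chaos_implies_imaginary_eigenvalue[OF csubspace_null_rows companion_null_rows
        Y'(1-3) fin x Y'(4)])
    fix \<mu> w
    assume w: "w \<in> null_rows n" "w \<noteq> 0" "Ad w = \<mu> *\<^sub>C w"
      and \<mu>: "Re \<mu> = 0" "\<mu> \<notin> {\<mu>. disc_z n m a \<mu> = 0}"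
    have "pde_P n m a \<mu> \<noteq> 0" using \<mu>(2) by (auto simp: disc_z_def disc_def)
    from eigenvector_root[OF w this] obtain z
      where "cmod z < \<rho>" "poly (pde_P n m a \<mu>) z = 0" by blast
    then show ?rhs using \<mu> by (rule_tac exI[of _ \<mu>], rule_tac exI[of _ z]) simp
  qed
next
  assume ?rhs
  then obtain \<mu>0 z0 where "Re \<mu>0 = 0" "z0 \<in> ball 0 \<rho>" "poly (pde_P n m a \<mu>0) z0 = 0"
    "disc_z n m a \<mu>0 \<noteq> 0" by blast
  then show "\<exists>Y. chaotic_subspace Y" by (intro chaotic_subspace_of_simple_root[of \<mu>0 z0]) simp_all
qed

end

section \<open>Herzog spaces as sequence spaces\<close>

definition hser :: "real \<Rightarrow> bseq \<Rightarrow> real \<Rightarrow> complex" where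
  "hser \<rho> c = herzog_series \<rho> (apply_bcontfun c)"

lemma null_seqs_iff: "c \<in> null_seqs \<longleftrightarrow> apply_bcontfun c \<in> c0_seqs"
  by (simp add: null_seqs_def c0_seqs_def)

lemma Bcontfun_c0_seqs:
  assumes "c \<in> c0_seqs"
  shows "apply_bcontfun (Bcontfun c) = c"
proof -
  have "Bseq c" using assms by (auto simp: c0_seqs_def intro: convergent_imp_Bseq convergentI)
  then obtain K where "\<And>k. norm (c k) \<le> K" unfolding Bseq_def by blast
  then show ?thesis by (rule bcontfun_bounded_fun)
qed

lemma herzog_space_eq: "herzog_space \<rho> = hser \<rho> ` null_seqs"
proof -
  have eq: "c0_seqs = apply_bcontfun ` null_seqs"
  proof (intro equalityI subsetI)
    fix c assume "c \<in> c0_seqs"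
    then show "c \<in> apply_bcontfun ` null_seqs"
      by (intro image_eqI[of _ _ "Bcontfun c"]) (simp_all add: Bcontfun_c0_seqs null_seqs_iff)
  qed (auto simp: null_seqs_iff)
  show ?thesis unfolding herzog_space_def eq image_image hser_def ..
qed

lemma hser_in_herzog_space: "c \<in> null_seqs \<Longrightarrow> hser \<rho> c \<in> herzog_space \<rho>"
  by (simp add: herzog_space_eq)

lemma hser_inj_on: "\<rho> > 0 \<Longrightarrow> inj_on (hser \<rho>) null_seqs"
proof (rule inj_onI)
  fix c d assume \<rho>: "\<rho> > 0" and "c \<in> null_seqs" "d \<in> null_seqs" "hser \<rho> c = hser \<rho> d"
  then have "apply_bcontfun c = apply_bcontfun d"
    by (intro inj_onD[OF herzog_series_inj[OF \<rho>]]) (simp_all add: hser_def null_seqs_iff)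
  then show "c = d" by (simp add: apply_bcontfun_inject)
qed

lemma hser_add:
  assumes "c \<in> null_seqs" "d \<in> null_seqs"
  shows "hser \<rho> (c + d) = (\<lambda>x. hser \<rho> c x + hser \<rho> d x)"
proof
  fix x
  have "hser \<rho> c x + hser \<rho> d x = (\<Sum>k. apply_bcontfun c k * of_real (\<rho> ^ k) / fact k * of_real (x ^ k)
      + apply_bcontfun d k * of_real (\<rho> ^ k) / fact k * of_real (x ^ k))"
    unfolding hser_def herzog_series_def
    using assms by (intro suminf_add herzog_series_summable) (simp_all add: null_seqs_iff)
  also have "\<dots> = hser \<rho> (c + d) x"
    unfolding hser_def herzog_series_def by (simp add: distrib_right add_divide_distrib)
  finally show "hser \<rho> (c + d) x = hser \<rho> c x + hser \<rho> d x" by simp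
qed

lemma hser_scaleC:
  assumes "c \<in> null_seqs"
  shows "hser \<rho> (s *\<^sub>C c) = (\<lambda>x. s * hser \<rho> c x)"
proof
  fix x
  have "s * hser \<rho> c x = (\<Sum>k. s * (apply_bcontfun c k * of_real (\<rho> ^ k) / fact k * of_real (x ^ k)))"
    unfolding hser_def herzog_series_def
    by (rule suminf_mult[symmetric], rule herzog_series_summable) (use assms in \<open>simp add: null_seqs_iff\<close>)
  then show "hser \<rho> (s *\<^sub>C c) x = s * hser \<rho> c x"
    by (simp add: hser_def herzog_series_def scaleC_complex_def mult.assoc)
qed

lemma hser_zero: "hser \<rho> 0 = (\<lambda>x. 0)"
  by (simp add: fun_eq_iff hser_def herzog_series_def)

lemma hser_diff:
  assumes "c \<in> null_seqs" "d \<in> null_seqs"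
  shows "hser \<rho> (c - d) = (\<lambda>x. hser \<rho> c x - hser \<rho> d x)"
  using hser_add[OF assms(1) csubspaceD(4)[OF csubspace_null_seqs assms(2)], of \<rho> "-1"]
    hser_scaleC[OF assms(2), of \<rho> "-1"]
  by (simp add: scaleC_minus_one)

lemma hser_sum:
  assumes "finite I" "\<And>i. i \<in> I \<Longrightarrow> c i \<in> null_seqs"
  shows "hser \<rho> (\<Sum>i\<in>I. c i) = (\<lambda>x. \<Sum>i\<in>I. hser \<rho> (c i) x)"
  using assms
proof (induction I rule: finite_induct)
  case (insert i I)
  have "hser \<rho> (c i + (\<Sum>i\<in>I. c i)) = (\<lambda>x. hser \<rho> (c i) x + hser \<rho> (\<Sum>i\<in>I. c i) x)"
    by (intro hser_add csubspaceD[OF csubspace_null_seqs]) (use insert in auto)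
  then show ?case using insert by simp
qed (simp add: hser_zero)

lemma herzog_norm_hser:
  assumes "\<rho> > 0" "c \<in> null_seqs"
  shows "herzog_norm \<rho> (hser \<rho> c) = norm c"
  using herzog_coeff_series[OF assms(1), of "apply_bcontfun c"] assms(2)
  by (simp add: herzog_norm_def hser_def null_seqs_iff norm_bcontfun_def dist_bcontfun.rep_eq)

lemma herzog_dist_hser:
  assumes "\<rho> > 0" "c \<in> null_seqs" "d \<in> null_seqs"
  shows "herzog_dist \<rho> (hser \<rho> c) (hser \<rho> d) = dist c d"
  using assms herzog_norm_hser[OF assms(1) csubspaceD(3)[OF csubspace_null_seqs assms(2,3)]]
  by (simp add: herzog_dist_def hser_in_herzog_space hser_diff dist_norm)

lemma dx_hser:
  assumes c: "c \<in> null_seqs"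
  shows "dx (hser \<rho> c) = hser \<rho> (shift \<rho> c)"
proof
  fix x :: real
  define b where "b k = apply_bcontfun c k * of_real (\<rho> ^ k) / fact k" for k
  have sm: "summable (\<lambda>k. b k * y ^ k)" for y
  proof (rule summable_comparison_test'[where N = 0])
    show "summable (\<lambda>k. norm c * (inverse (fact k) * (\<bar>\<rho>\<bar> * cmod y) ^ k))"
      by (intro summable_mult summable_exp)
    show "norm (b k * y ^ k) \<le> norm c * (inverse (fact k) * (\<bar>\<rho>\<bar> * cmod y) ^ k)" for k
    proof -
      have "norm (b k * y ^ k) = norm (apply_bcontfun c k) * (inverse (fact k) * (\<bar>\<rho>\<bar> * cmod y) ^ k)"
        by (simp add: b_def norm_mult norm_divide norm_power power_mult_distrib field_simps)
      then show ?thesis by (simp add: mult_right_mono norm_bounded)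
    qed
  qed
  have "((\<lambda>z. \<Sum>k. b k * z ^ k) has_field_derivative (\<Sum>k. diffs b k * of_real x ^ k)) (at (of_real x))"
    by (rule termdiffs_strong_converges_everywhere[OF sm])
  from has_vector_derivative_real_field[OF this, of UNIV]
  have "(hser \<rho> c has_vector_derivative (\<Sum>k. diffs b k * of_real x ^ k)) (at x)"
    by (simp add: hser_def herzog_series_def[abs_def] b_def)
  moreover have "diffs b k = apply_bcontfun (shift \<rho> c) k * of_real (\<rho> ^ k) / fact k" for k
    by (simp add: diffs_def b_def shift_apply del: of_nat_Suc)
  ultimately have "(hser \<rho> c has_vector_derivative hser \<rho> (shift \<rho> c) x) (at x)"
    by (simp add: hser_def herzog_series_def)
  then show "dx (hser \<rho> c) x = hser \<rho> (shift \<rho> c) x"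
    unfolding dx_def by (rule vector_derivative_at)
qed

section \<open>The Riesz--Dunford calculus of the derivative\<close>

text \<open>Comparing coefficients in \<open>(\<zeta> - z) f(z) = 1\<close> gives \<open>\<zeta> f\<^sub>k\<^sub>+\<^sub>1 = f\<^sub>k\<close> and
  \<open>\<zeta> f\<^sub>0 = 1\<close>.\<close>

lemma taylor_resolvent:
  assumes "\<zeta> \<noteq> 0"
  shows "taylor (\<lambda>z. inverse (\<zeta> - z)) k = inverse \<zeta> ^ Suc k"
proof -
  define f where "f = (\<lambda>z. inverse (\<zeta> - z))"
  define g where "g = (\<lambda>z. \<zeta> - z)"
  define R where "R = cmod \<zeta>"
  have R: "R > 0" using assms by (simp add: R_def)
  have "deriv g = (\<lambda>z. -1)"
    unfolding g_def by (intro ext DERIV_imp_deriv) (auto intro!: derivative_eq_intros)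
  then have "(deriv ^^ Suc k) g = (deriv ^^ k) (\<lambda>z. -1)" for k by (simp add: funpow_swap1)
  then have tg: "taylor g 0 = \<zeta>" "taylor g (Suc k) = (if k = 0 then -1 else 0)" for k
    by (auto simp: taylor_def g_def simp del: funpow.simps(2))
  have f: "f holomorphic_on ball 0 R" unfolding f_def R_def by (intro holomorphic_intros) auto
  have g: "g holomorphic_on ball 0 R" unfolding g_def by (intro holomorphic_intros)
  have "(if k = 0 then 1 else 0) = taylor (\<lambda>z. g z * f z) k" for k
    unfolding taylor_const[symmetric]
  proof (rule taylor_cong[OF _ R])
    fix z :: complex assume "z \<in> ball 0 R"
    then have "\<zeta> - z \<noteq> 0" by (auto simp: R_def)
    then show "1 = g z * f z" by (simp add: f_def g_def)
  qed
  then have conv: "(if k = 0 then 1 else 0) = (\<Sum>i\<le>k. taylor g i * taylor f (k - i))" for k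
    using taylor_mult[OF g f R] by simp
  have "taylor f k = inverse \<zeta> ^ Suc k"
  proof (induction k)
    case 0
    then show ?case using conv[of 0] assms by (simp add: tg field_simps)
  next
    case (Suc k)
    have "0 = (\<Sum>i\<le>Suc k. taylor g i * taylor f (Suc k - i))" using conv[of "Suc k"] by simp
    also have "\<dots> = (\<Sum>i\<in>{0, 1}. taylor g i * taylor f (Suc k - i))"
    proof (rule sum.mono_neutral_right)
      show "\<forall>i\<in>{..Suc k} - {0, 1}. taylor g i * taylor f (Suc k - i) = 0"
      proof
        fix i assume "i \<in> {..Suc k} - {0, 1}"
        then obtain j where "i = Suc j" "j \<noteq> 0" by (cases i) auto
        then show "taylor g i * taylor f (Suc k - i) = 0" by (simp add: tg)
      qed
    qed auto
    also have "\<dots> = \<zeta> * taylor f (Suc k) - taylor f k"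
      using tg(2)[of 0] by (simp add: tg(1))
    finally show ?case using assms by (simp add: Suc field_simps)
  qed
  then show ?thesis by (simp add: f_def)
qed

context herzog
begin

abbreviation resolvent :: "complex \<Rightarrow> bseq \<Rightarrow> bseq" where
  "resolvent \<zeta> \<equiv> fcalc (shift \<rho>) (\<lambda>z. inverse (\<zeta> - z))"

lemma resolvent_holomorphic: "(\<lambda>z. inverse (\<zeta> - z)) holomorphic_on ball 0 (cmod \<zeta>)"
  by (intro holomorphic_intros) auto

lemma resolvent_null_seqs:
  "cmod \<zeta> > \<rho> \<Longrightarrow> c \<in> null_seqs \<Longrightarrow> resolvent \<zeta> c \<in> null_seqs"
  by (rule shift.fcalc_closed_subspace[OF resolvent_holomorphic _ closed_null_seqs csubspace_null_seqs
        shift_null_seqs])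

lemma fcalc_const_minus: "fcalc (shift \<rho>) (\<lambda>z. \<zeta> - z) c = \<zeta> *\<^sub>C c - shift \<rho> c"
proof -
  have "fcalc (shift \<rho>) (\<lambda>z. (z - \<zeta>) * (-1)) c = fcalc (shift \<rho>) (\<lambda>z. z - \<zeta>) (fcalc (shift \<rho>) (\<lambda>z. -1) c)"
    by (rule shift.fcalc_mult[of _ "\<rho> + 1"]) (auto intro: holomorphic_intros)
  then show ?thesis
    by (simp add: shift.fcalc_diff_const shift.fcalc_const scaleC_minus_one
        linear_neg[OF bounded_linear.linear[OF shift.bounded_linear]] scaleC.minus_right)
qed

lemma resolvent_inverse:
  assumes "cmod \<zeta> > \<rho>"
  shows "\<zeta> *\<^sub>C resolvent \<zeta> c - shift \<rho> (resolvent \<zeta> c) = c"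
    and "resolvent \<zeta> (\<zeta> *\<^sub>C c - shift \<rho> c) = c"
proof -
  have hol: "(\<lambda>z. \<zeta> - z) holomorphic_on ball 0 (cmod \<zeta>)" by (intro holomorphic_intros)
  have R: "cmod \<zeta> > 0" using assms \<rho> by linarith
  have nz: "(\<zeta> - z) * inverse (\<zeta> - z) = 1" if "z \<in> ball 0 (cmod \<zeta>)" for z
    by (rule right_inverse) (use that in auto)
  have "fcalc (shift \<rho>) (\<lambda>z. (\<zeta> - z) * inverse (\<zeta> - z)) c = c"
    by (subst fcalc_cong[OF nz R]) (simp_all add: shift.fcalc_const)
  then show "\<zeta> *\<^sub>C resolvent \<zeta> c - shift \<rho> (resolvent \<zeta> c) = c"
    using shift.fcalc_mult[OF hol resolvent_holomorphic assms] by (simp add: fcalc_const_minus)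
  have "fcalc (shift \<rho>) (\<lambda>z. inverse (\<zeta> - z) * (\<zeta> - z)) c = c"
    by (subst fcalc_cong[OF nz[unfolded mult.commute[of "\<zeta> - _"]] R]) (simp_all add: shift.fcalc_const)
  then show "resolvent \<zeta> (\<zeta> *\<^sub>C c - shift \<rho> c) = c"
    using shift.fcalc_mult[OF resolvent_holomorphic hol assms] by (simp add: fcalc_const_minus)
qed

lemma resolvent_equation_hser:
  assumes "c \<in> null_seqs"
  shows "(\<lambda>x. \<zeta> * hser \<rho> c x - dx (hser \<rho> c) x) = hser \<rho> (\<zeta> *\<^sub>C c - shift \<rho> c)"
  using assms by (simp add: dx_hser hser_diff hser_scaleC csubspaceD(4)[OF csubspace_null_seqs] shift_null_seqs)

lemma herzog_spectrum_subset: "herzog_spectrum \<rho> dx \<subseteq> cball 0 \<rho>"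
proof
  fix \<zeta> assume \<zeta>: "\<zeta> \<in> herzog_spectrum \<rho> dx"
  show "\<zeta> \<in> cball 0 \<rho>"
  proof (rule ccontr)
    assume "\<zeta> \<notin> cball 0 \<rho>"
    then have z: "cmod \<zeta> > \<rho>" by simp
    let ?L = "\<lambda>h x. \<zeta> * h x - dx h x"
    have ran: "\<zeta> *\<^sub>C c - shift \<rho> c \<in> null_seqs" if "c \<in> null_seqs" for c
      using that by (intro csubspaceD[OF csubspace_null_seqs] shift_null_seqs)
    have bij: "bij_betw ?L (herzog_space \<rho>) (herzog_space \<rho>)"
      unfolding bij_betw_def
    proof
      show "inj_on ?L (herzog_space \<rho>)"
      proof (rule inj_onI)
        fix h h' assume "h \<in> herzog_space \<rho>" "h' \<in> herzog_space \<rho>" and eq: "?L h = ?L h'"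
        then obtain c c' where c: "c \<in> null_seqs" "h = hser \<rho> c" "c' \<in> null_seqs" "h' = hser \<rho> c'"
          by (auto simp: herzog_space_eq)
        have "\<zeta> *\<^sub>C c - shift \<rho> c = \<zeta> *\<^sub>C c' - shift \<rho> c'"
          using eq c by (intro inj_onD[OF hser_inj_on[OF \<rho>]] ran) (simp_all add: resolvent_equation_hser)
        then have "c = c'" using resolvent_inverse(2)[OF z] by metis
        then show "h = h'" using c by simp
      qed
      show "?L ` herzog_space \<rho> = herzog_space \<rho>"
      proof (intro equalityI subsetI)
        fix h assume "h \<in> ?L ` herzog_space \<rho>"
        then obtain c where "c \<in> null_seqs" "h = ?L (hser \<rho> c)" by (auto simp: herzog_space_eq)
        then show "h \<in> herzog_space \<rho>"
          by (simp add: resolvent_equation_hser ran hser_in_herzog_space)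
      next
        fix h assume "h \<in> herzog_space \<rho>"
        then obtain c where c: "c \<in> null_seqs" "h = hser \<rho> c" by (auto simp: herzog_space_eq)
        then have "h = ?L (hser \<rho> (resolvent \<zeta> c))"
          by (simp add: resolvent_equation_hser resolvent_null_seqs z resolvent_inverse(1))
        then show "h \<in> ?L ` herzog_space \<rho>"
          by (rule image_eqI[where x = "hser \<rho> (resolvent \<zeta> c)"]) (intro hser_in_herzog_space resolvent_null_seqs z c(1))
      qed
    qed
    define C where "C = (\<Sum>k. cmod (taylor (\<lambda>z. inverse (\<zeta> - z)) k) * \<rho> ^ k)"
    have "herzog_norm \<rho> h \<le> C * herzog_norm \<rho> (?L h)" if h: "h \<in> herzog_space \<rho>" for h
    proof -
      obtain c where c: "c \<in> null_seqs" "h = hser \<rho> c" using h by (auto simp: herzog_space_eq)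
      have "norm c = norm (resolvent \<zeta> (\<zeta> *\<^sub>C c - shift \<rho> c))" by (simp add: resolvent_inverse(2)[OF z])
      also have "\<dots> \<le> C * norm (\<zeta> *\<^sub>C c - shift \<rho> c)"
        unfolding C_def by (rule shift.fcalc_bound[OF resolvent_holomorphic z])
      finally show ?thesis
        using c ran[OF c(1)] by (simp add: resolvent_equation_hser herzog_norm_hser[OF \<rho>])
    qed
    then show False using \<zeta> bij unfolding herzog_spectrum_def by blast
  qed
qed

text \<open>For \<open>0 \<le> s < \<rho>\<close> the exponential \<open>x \<mapsto> exp (s x)\<close> has norm \<open>1\<close> and is multiplied by \<open>\<rho> - s\<close>
  under \<open>\<rho> - \<partial>\<^sub>x\<close>, which is therefore not bounded below. Hence every circle about \<open>0\<close> that encloses the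
  spectrum has radius larger than \<open>\<rho>\<close>.\<close>

lemma radius_in_herzog_spectrum: "of_real \<rho> \<in> herzog_spectrum \<rho> dx"
proof (rule ccontr)
  assume "of_real \<rho> \<notin> herzog_spectrum \<rho> dx"
  then obtain C where C: "\<And>h. h \<in> herzog_space \<rho> \<Longrightarrow>
      herzog_norm \<rho> h \<le> C * herzog_norm \<rho> (\<lambda>x. of_real \<rho> * h x - dx h x)"
    unfolding herzog_spectrum_def by blast
  have main: "1 \<le> C * (\<rho> - s)" if s: "0 \<le> s" "s < \<rho>" for s
  proof -
    let ?e = "expo \<rho> (of_real s)"
    have e: "cmod (of_real s) < \<rho>" using s by simp
    have "norm ?e \<ge> 1"
      using norm_bounded[of ?e 0] by (simp add: expo_apply[OF \<rho> e])
    moreover have "norm ?e \<le> 1"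
      by (rule norm_bound) (use s \<rho> in \<open>simp add: expo_apply[OF \<rho> e] norm_power norm_divide power_le_one\<close>)
    ultimately have 1: "norm ?e = 1" by simp
    have "of_real \<rho> *\<^sub>C ?e - shift \<rho> ?e = of_real (\<rho> - s) *\<^sub>C ?e"
      by (simp add: shift_expo[OF \<rho> e] scaleC.diff_left)
    then have 2: "norm (of_real \<rho> *\<^sub>C ?e - shift \<rho> ?e) = \<rho> - s"
      using s 1 by (simp only: norm_scaleC norm_of_real) simp
    have en: "?e \<in> null_seqs" by (rule expo_null_seqs[OF \<rho> e])
    have "of_real \<rho> *\<^sub>C ?e - shift \<rho> ?e \<in> null_seqs"
      using en by (intro csubspaceD[OF csubspace_null_seqs] shift_null_seqs)
    then show ?thesis
      using C[OF hser_in_herzog_space[OF en]] en 1 2 by (simp add: resolvent_equation_hser herzog_norm_hser[OF \<rho>])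
  qed
  have "((\<lambda>s. C * (\<rho> - s)) \<longlongrightarrow> C * (\<rho> - \<rho>)) (at_left \<rho>)" by (intro tendsto_intros)
  moreover have "\<forall>\<^sub>F s in at_left \<rho>. 1 \<le> C * (\<rho> - s)"
    unfolding eventually_at_left_field using main \<rho> by (intro exI[of _ 0]) auto
  ultimately have "1 \<le> C * (\<rho> - \<rho>)" by (rule tendsto_lowerbound) simp
  then show False by simp
qed

lemma herzog_resolvent_hser:
  assumes "cmod \<zeta> > \<rho>" "c \<in> null_seqs"
  shows "herzog_resolvent \<rho> dx \<zeta> (hser \<rho> c) = hser \<rho> (resolvent \<zeta> c)"
  unfolding herzog_resolvent_def
proof (rule inv_into_f_eq)
  have "\<zeta> \<notin> herzog_spectrum \<rho> dx" using herzog_spectrum_subset assms(1) by auto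
  then show "inj_on (\<lambda>h x. \<zeta> * h x - dx h x) (herzog_space \<rho>)"
    unfolding herzog_spectrum_def by (simp add: bij_betw_def)
  show "hser \<rho> (resolvent \<zeta> c) \<in> herzog_space \<rho>"
    by (intro hser_in_herzog_space resolvent_null_seqs assms)
  show "(\<lambda>x. \<zeta> * hser \<rho> (resolvent \<zeta> c) x - dx (hser \<rho> (resolvent \<zeta> c)) x) = hser \<rho> c"
    by (simp add: resolvent_equation_hser resolvent_null_seqs assms resolvent_inverse(1))
qed

text \<open>The gauge integral only involves finite sums and the norm, both of which the isometry \<open>hser\<close>
  respects.\<close>

lemma has_herzog_integral_hser:
  assumes G: "\<And>t. t \<in> {0..1} \<Longrightarrow> G t \<in> null_seqs" "\<And>t. t \<in> {0..1} \<Longrightarrow> F t = hser \<rho> (G t)"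
  shows "has_herzog_integral \<rho> F y \<longleftrightarrow> (\<exists>w\<in>null_seqs. y = hser \<rho> w \<and> (G has_integral w) {0..1})"
proof -
  have eq: "herzog_norm \<rho> (\<lambda>x. (\<Sum>(t, K)\<in>\<D>. of_real (measure lborel K) * F t x) - hser \<rho> w x) =
      norm ((\<Sum>(t, K)\<in>\<D>. measure lborel K *\<^sub>R G t) - w)"
    if D: "\<D> tagged_division_of {0..1}" and w: "w \<in> null_seqs" for \<D> w
  proof -
    have fin: "finite \<D>" using D by (rule tagged_division_of_finite)
    have tag: "t \<in> {0..1}" if "(t, K) \<in> \<D>" for t K
      using D that by (meson tag_in_interval)
    have mem: "of_real (measure lborel K) *\<^sub>C G t \<in> null_seqs" if "(t, K) \<in> \<D>" for t K
      by (intro csubspaceD[OF csubspace_null_seqs] G tag[OF that])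
    define S where "S = (\<Sum>p\<in>\<D>. of_real (measure lborel (snd p)) *\<^sub>C G (fst p))"
    have S: "S \<in> null_seqs" unfolding S_def
      by (intro csubspaceD(5)[OF csubspace_null_seqs]) (use mem in auto)
    have "hser \<rho> S = (\<lambda>x. \<Sum>p\<in>\<D>. hser \<rho> (of_real (measure lborel (snd p)) *\<^sub>C G (fst p)) x)"
      unfolding S_def by (rule hser_sum[OF fin]) (use mem in auto)
    also have "\<dots> = (\<lambda>x. \<Sum>(t, K)\<in>\<D>. of_real (measure lborel K) * F t x)"
      by (intro ext sum.cong) (auto simp: hser_scaleC[OF G(1)[OF tag]] G(2)[OF tag])
    finally have "(\<lambda>x. (\<Sum>(t, K)\<in>\<D>. of_real (measure lborel K) * F t x) - hser \<rho> w x) = hser \<rho> (S - w)"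
      using hser_diff[OF S w] by (metis (no_types))
    moreover have "herzog_norm \<rho> (hser \<rho> (S - w)) = norm (S - w)"
      by (intro herzog_norm_hser \<rho> csubspaceD[OF csubspace_null_seqs] S w)
    moreover have "S = (\<Sum>(t, K)\<in>\<D>. measure lborel K *\<^sub>R G t)"
      by (simp add: S_def scaleC_of_real case_prod_beta)
    ultimately show ?thesis by simp
  qed
  have *: "has_herzog_integral \<rho> F (hser \<rho> w) \<longleftrightarrow> (G has_integral w) {0..1}" if w: "w \<in> null_seqs" for w
  proof -
    have "(G has_integral w) {0..1} \<longleftrightarrow> (\<forall>e>0. \<exists>\<gamma>. gauge \<gamma> \<and>
        (\<forall>\<D>. \<D> tagged_division_of {0..1} \<and> \<gamma> fine \<D> \<longrightarrow>
          norm ((\<Sum>(t, K)\<in>\<D>. measure lborel K *\<^sub>R G t) - w) < e))"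
      using has_integral[of G w 0 1] by simp
    also have "\<dots> \<longleftrightarrow> (\<forall>e>0. \<exists>\<gamma>. gauge \<gamma> \<and>
        (\<forall>\<D>. \<D> tagged_division_of {0..1} \<and> \<gamma> fine \<D> \<longrightarrow>
          herzog_norm \<rho> (\<lambda>x. (\<Sum>(t, K)\<in>\<D>. of_real (measure lborel K) * F t x) - hser \<rho> w x) < e))"
      by (simp add: eq[OF _ w] cong: conj_cong)
    finally show ?thesis
      by (simp add: has_herzog_integral_def hser_in_herzog_space w)
  qed
  show ?thesis
  proof
    assume i: "has_herzog_integral \<rho> F y"
    then obtain w where "w \<in> null_seqs" "y = hser \<rho> w"
      by (auto simp: has_herzog_integral_def herzog_space_eq)
    then show "\<exists>w\<in>null_seqs. y = hser \<rho> w \<and> (G has_integral w) {0..1}" using i * by blast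
  next
    assume "\<exists>w\<in>null_seqs. y = hser \<rho> w \<and> (G has_integral w) {0..1}"
    then show "has_herzog_integral \<rho> F y" using * by blast
  qed
qed

lemma cauchy_coefficient_integral:
  assumes r: "r > 0" and g: "g holomorphic_on ball 0 r" "continuous_on (cball 0 r) g"
  shows "((\<lambda>t. 1 / (2 * of_real pi * \<i>) * vector_derivative (circlepath 0 r) (at t within {0..1}) *
      g (circlepath 0 r t) * inverse (circlepath 0 r t) ^ Suc k) has_integral taylor g k) {0..1}"
proof -
  let ?f = "\<lambda>u. g u / (u - 0) ^ Suc k"
  let ?C = "1 / (2 * of_real pi * \<i>) :: complex"
  have i: "?f contour_integrable_on circlepath 0 r"
    and d: "(deriv ^^ k) g 0 = fact k / (2 * pi * \<i>) * contour_integral (circlepath 0 r) ?f"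
    using Cauchy_higher_derivative_integral_circlepath[OF g(2,1), of 0 k] r by auto
  have "taylor g k = ?C * contour_integral (circlepath 0 r) ?f"
    by (simp add: taylor_def d)
  moreover have "((\<lambda>t. ?C * (?f (circlepath 0 r t) * vector_derivative (circlepath 0 r) (at t within {0..1})))
      has_integral ?C * contour_integral (circlepath 0 r) ?f) {0..1}"
    using has_contour_integral_integral[OF i] unfolding has_contour_integral_def
    by (rule has_integral_mult_right)
  moreover have "(\<lambda>t. ?C * (?f (circlepath 0 r t) * vector_derivative (circlepath 0 r) (at t within {0..1}))) =
      (\<lambda>t. ?C * vector_derivative (circlepath 0 r) (at t within {0..1}) *
        g (circlepath 0 r t) * inverse (circlepath 0 r t) ^ Suc k)"
    unfolding diff_0_right divide_inverse power_inverse by (simp only: mult_ac)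
  ultimately show ?thesis by (simp only:)
qed

text \<open>The expansion of the resolvent in negative powers of \<open>\<zeta>\<close> converges uniformly on the circle, as
  \<open>\<rho> < r\<close>. It can be integrated term by term, and Cauchy's formula turns the coefficients into the Taylor
  coefficients of \<open>g\<close>.\<close>

lemma cauchy_integral_resolvent:
  assumes r: "r > \<rho>" and g: "g analytic_on cball 0 r"
  shows "((\<lambda>t. (1 / (2 * of_real pi * \<i>) * vector_derivative (circlepath 0 r) (at t within {0..1}) *
      g (circlepath 0 r t)) *\<^sub>C resolvent (circlepath 0 r t) c) has_integral fcalc (shift \<rho>) g c) {0..1}"
proof -
  have r0: "r > 0" using r \<rho> by simp
  have hol: "g holomorphic_on cball 0 r" using g by (rule analytic_imp_holomorphic)
  then have hol': "g holomorphic_on ball 0 r" by (rule holomorphic_on_subset) auto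
  have contg: "continuous_on (cball 0 r) g" using hol by (rule holomorphic_on_imp_continuous_on)
  define \<gamma> where "\<gamma> t = of_real r * exp (2 * of_real pi * \<i> * of_real t)" for t
  have \<gamma>: "circlepath 0 r t = \<gamma> t" for t by (simp only: circlepath \<gamma>_def add_0)
  have \<gamma>n: "cmod (\<gamma> t) = r" for t
    unfolding \<gamma>_def norm_mult norm_exp_eq_Re using r0 by simp
  have \<gamma>nz: "\<gamma> t \<noteq> 0" for t using \<gamma>n[of t] r0 by auto
  have \<gamma>c: "continuous_on S \<gamma>" for S unfolding \<gamma>_def by (intro continuous_intros)
  define h where "h t = \<gamma> t * g (\<gamma> t)" for t
  have h: "1 / (2 * of_real pi * \<i>) * vector_derivative (circlepath 0 r) (at t within {0..1}) *
      g (circlepath 0 r t) = h t" if "t \<in> {0..1}" for t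
  proof -
    have "vector_derivative (circlepath 0 r) (at t within {0..1}) = 2 * of_real pi * \<i> * \<gamma> t"
      using that by (subst vector_derivative_circlepath01) (auto simp: \<gamma>_def)
    then show ?thesis by (simp add: \<gamma> h_def)
  qed
  have hc: "continuous_on {0..1} h"
    unfolding h_def using \<gamma>n r0
    by (intro continuous_on_mult \<gamma>c continuous_on_compose2[OF contg \<gamma>c]) auto
  then have "compact (h ` {0..1})" by (intro compact_continuous_image) auto
  then have "bounded (h ` {0..1})" by (rule compact_imp_bounded)
  then obtain B where "\<forall>x\<in>h ` {0..1}. cmod x \<le> B" unfolding bounded_iff by blast
  then have B: "cmod (h t) \<le> B" if "t \<in> {0..1}" for t using that by simp
  define f where "f k t = (h t * inverse (\<gamma> t) ^ Suc k) *\<^sub>C (shift \<rho> ^^ k) c" for k t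
  define F where "F N t = (\<Sum>k<N. f k t)" for N t
  define G where "G t = h t *\<^sub>C resolvent (\<gamma> t) c" for t
  have f_sums: "(\<lambda>k. f k t) sums G t" for t
  proof -
    have "(\<lambda>k. taylor (\<lambda>z. inverse (\<gamma> t - z)) k *\<^sub>C (shift \<rho> ^^ k) c) sums resolvent (\<gamma> t) c"
      by (rule shift.fcalc_sums[OF resolvent_holomorphic]) (simp add: \<gamma>n r)
    then have "(\<lambda>k. inverse (\<gamma> t) ^ Suc k *\<^sub>C (shift \<rho> ^^ k) c) sums resolvent (\<gamma> t) c"
      by (simp only: taylor_resolvent[OF \<gamma>nz])
    from sums_scaleC_right[OF this, of "h t"] show ?thesis
      by (simp only: G_def f_def scaleC_scaleC)
  qed
  have f_bound: "norm (f k t) \<le> B / r * norm c * (\<rho> / r) ^ k" if "t \<in> {0..1}" for k t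
  proof -
    have "norm (f k t) = cmod (h t) * inverse r ^ Suc k * norm ((shift \<rho> ^^ k) c)"
      by (simp only: f_def norm_scaleC norm_mult norm_power norm_inverse \<gamma>n)
    also have "\<dots> \<le> B * inverse r ^ Suc k * (\<rho> ^ k * norm c)"
      using r0 \<rho> B[OF that] order.trans[OF norm_ge_zero B[OF that]]
      by (intro mult_mono shift.pow_bound mult_right_mono) auto
    also have "\<dots> = B / r * norm c * (\<rho> / r) ^ k"
      using r0 by (simp add: divide_inverse power_inverse power_mult_distrib mult_ac)
    finally show ?thesis .
  qed
  have unif: "uniform_limit {0..1} F (\<lambda>t. \<Sum>k. f k t) sequentially"
    unfolding F_def
    by (rule Weierstrass_m_test[OF f_bound]) (use r \<rho> in \<open>auto intro!: summable_mult summable_geometric\<close>)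
  moreover have "(\<lambda>t. \<Sum>k. f k t) = G" using f_sums by (simp add: fun_eq_iff sums_iff)
  ultimately have unif: "uniform_limit {0..1} F G sequentially" by simp
  have f_cont: "continuous_on {0..1} (f k)" for k
    unfolding f_def using \<gamma>n r0
    by (intro continuous_on_scaleC continuous_on_mult hc continuous_on_power continuous_on_inverse \<gamma>c
        continuous_on_const) (simp add: \<gamma>nz)
  then have F_cont: "continuous_on {0..1} (F N)" for N unfolding F_def by (intro continuous_on_sum)
  obtain I J where I: "\<And>N. (F N has_integral I N) {0..1}" and J: "(G has_integral J) {0..1}"
    and IJ: "I \<longlonglongrightarrow> J"
    by (rule uniform_limit_integral[OF unif F_cont sequentially_bot]) (rule that)
  have f_int: "(f k has_integral taylor g k *\<^sub>C (shift \<rho> ^^ k) c) {0..1}" for k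
  proof -
    have "((\<lambda>t. h t * inverse (\<gamma> t) ^ Suc k) has_integral taylor g k) {0..1}"
      using cauchy_coefficient_integral[OF r0 hol' contg, of k]
      by (rule has_integral_cong[THEN iffD1, rotated]) (subst h[symmetric], assumption, simp only: \<gamma>)
    from has_integral_linear[OF this scaleC.bounded_linear_left] show ?thesis
      by (simp add: f_def[abs_def] o_def)
  qed
  have "(F N has_integral (\<Sum>k<N. taylor g k *\<^sub>C (shift \<rho> ^^ k) c)) {0..1}" for N
    unfolding F_def by (intro has_integral_sum f_int) simp
  then have "I = (\<lambda>N. \<Sum>k<N. taylor g k *\<^sub>C (shift \<rho> ^^ k) c)"
    by (intro ext has_integral_unique[OF I])
  then have "I \<longlonglongrightarrow> fcalc (shift \<rho>) g c"
    using shift.fcalc_sums[OF hol' r, of c] by (simp add: sums_def)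
  from LIMSEQ_unique[OF IJ this] J have "(G has_integral fcalc (shift \<rho>) g c) {0..1}" by (simp only:)
  then show ?thesis
    by (rule has_integral_cong[THEN iffD1, rotated]) (unfold G_def, subst h[symmetric], assumption, simp only: \<gamma>)
qed

text \<open>Every radius admitted in the definition exceeds \<open>\<rho>\<close>, and for each such radius the integral has
  the same value.\<close>

theorem riesz_dunford_hser:
  assumes R: "R > \<rho>" and g: "g holomorphic_on ball 0 R" and c: "c \<in> null_seqs"
  shows "riesz_dunford \<rho> dx g (hser \<rho> c) = hser \<rho> (fcalc (shift \<rho>) g c)"
proof -
  let ?k = "\<lambda>r t. 1 / (2 * of_real pi * \<i>) * vector_derivative (circlepath 0 r) (at t within {0..1}) *
      g (circlepath 0 r t)"
  let ?F = "\<lambda>r t x. 1 / (2 * of_real pi * \<i>) * vector_derivative (circlepath 0 r) (at t within {0..1}) *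
      g (circlepath 0 r t) * herzog_resolvent \<rho> dx (circlepath 0 r t) (hser \<rho> c) x"
  have int: "has_herzog_integral \<rho> (?F r) y \<longleftrightarrow> y = hser \<rho> (fcalc (shift \<rho>) g c)"
    if r: "r > \<rho>" and gr: "g analytic_on cball 0 r" for r y
  proof -
    have n: "cmod (circlepath 0 r t) > \<rho>" for t
      using r \<rho> by (simp add: circlepath norm_mult norm_exp_eq_Re)
    have fin: "fcalc (shift \<rho>) g c \<in> null_seqs"
      by (rule shift.fcalc_closed_subspace[OF g R closed_null_seqs csubspace_null_seqs shift_null_seqs c])
    have G: "?k r t *\<^sub>C resolvent (circlepath 0 r t) c \<in> null_seqs" for t
      by (intro csubspaceD[OF csubspace_null_seqs] resolvent_null_seqs n c)
    have "?F r t = hser \<rho> (?k r t *\<^sub>C resolvent (circlepath 0 r t) c)" for t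
      by (simp only: hser_scaleC[OF resolvent_null_seqs[OF n c]] herzog_resolvent_hser[OF n c])
    then have "has_herzog_integral \<rho> (?F r) y \<longleftrightarrow> (\<exists>w\<in>null_seqs. y = hser \<rho> w \<and>
        ((\<lambda>t. ?k r t *\<^sub>C resolvent (circlepath 0 r t) c) has_integral w) {0..1})"
      by (intro has_herzog_integral_hser G)
    also have "\<dots> \<longleftrightarrow> y = hser \<rho> (fcalc (shift \<rho>) g c)"
    proof
      assume "y = hser \<rho> (fcalc (shift \<rho>) g c)"
      then show "\<exists>w\<in>null_seqs. y = hser \<rho> w \<and>
          ((\<lambda>t. ?k r t *\<^sub>C resolvent (circlepath 0 r t) c) has_integral w) {0..1}"
        by (intro bexI[OF _ fin] conjI cauchy_integral_resolvent[OF r gr])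
    next
      assume "\<exists>w\<in>null_seqs. y = hser \<rho> w \<and>
          ((\<lambda>t. ?k r t *\<^sub>C resolvent (circlepath 0 r t) c) has_integral w) {0..1}"
      then obtain w where "y = hser \<rho> w"
        and w: "((\<lambda>t. ?k r t *\<^sub>C resolvent (circlepath 0 r t) c) has_integral w) {0..1}" by (elim bexE conjE)
      with has_integral_unique[OF w cauchy_integral_resolvent[OF r gr]]
      show "y = hser \<rho> (fcalc (shift \<rho>) g c)" by (simp only:)
    qed
    finally show ?thesis .
  qed
  obtain r where r: "\<rho> < r" "r < R" using dense[OF R] by blast
  have "g analytic_on ball 0 R" using g by (simp add: analytic_on_open)
  then have gr: "g analytic_on cball 0 r" by (rule analytic_on_subset) (use r in auto)
  show ?thesis
    unfolding riesz_dunford_def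
  proof (rule the_equality)
    show "\<exists>r>0. herzog_spectrum \<rho> dx \<subseteq> ball 0 r \<and> g analytic_on cball 0 r \<and>
        has_herzog_integral \<rho> (?F r) (hser \<rho> (fcalc (shift \<rho>) g c))"
    proof (intro exI[of _ r] conjI gr)
      have "cball 0 \<rho> \<subseteq> ball (0 :: complex) r" using r by auto
      then show "herzog_spectrum \<rho> dx \<subseteq> ball 0 r" by (rule order.trans[OF herzog_spectrum_subset])
      show "has_herzog_integral \<rho> (?F r) (hser \<rho> (fcalc (shift \<rho>) g c))" by (simp only: int[OF r(1) gr])
    qed (use r \<rho> in simp)
    fix y assume "\<exists>r>0. herzog_spectrum \<rho> dx \<subseteq> ball 0 r \<and> g analytic_on cball 0 r \<and>
        has_herzog_integral \<rho> (?F r) y"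
    then obtain s where s: "herzog_spectrum \<rho> dx \<subseteq> ball 0 s" "g analytic_on cball 0 s"
      "has_herzog_integral \<rho> (?F s) y" by (elim exE conjE)
    have "s > \<rho>" using subsetD[OF s(1) radius_in_herzog_spectrum] \<rho> by simp
    from int[OF this s(2)] s(3) show "y = hser \<rho> (fcalc (shift \<rho>) g c)" by (simp only:)
  qed
qed

lemma homeomorphic_map_hser: "homeomorphic_map (top_of_set null_seqs) (herzog_topology \<rho>) (hser \<rho>)"
proof -
  interpret X: Metric_space "herzog_space \<rho>" "herzog_dist \<rho>" by (rule Metric_space_herzog[OF \<rho>])
  interpret N: Submetric UNIV "dist :: bseq \<Rightarrow> bseq \<Rightarrow> real" null_seqs by unfold_locales auto
  interpret NX: Metric_space12 null_seqs dist "herzog_space \<rho>" "herzog_dist \<rho>" ..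
  have "homeomorphic_map N.sub.mtopology X.mtopology (hser \<rho>)"
    by (rule NX.isometry_imp_homeomorphic_map) (simp_all add: herzog_space_eq herzog_dist_hser[OF \<rho>])
  then show ?thesis
    by (simp add: herzog_topology_def N.mtopology_submetric)
qed

end

section \<open>Transport to the Herzog spaces\<close>

context pde
begin

definition hrows :: "bseqs \<Rightarrow> nat \<Rightarrow> real \<Rightarrow> complex" where
  "hrows w = (\<lambda>i\<in>{1..n}. hser \<rho> (apply_bcontfun w i))"

definition row :: "nat \<Rightarrow> bseq \<Rightarrow> bseqs" where
  "row i c = Bcontfun (\<lambda>k. if k = i then c else 0)"

lemma row_apply: "apply_bcontfun (row i c) k = (if k = i then c else 0)"
  using bcontfun_bounded_fun[of "\<lambda>k. if k = i then c else 0" "norm c"] by (simp add: row_def)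

lemma bounded_linear_row: "bounded_linear (row i)"
proof (rule bounded_linear_intro[where K = 1])
  show "row i (x + y) = row i x + row i y" for x y
    by (rule bcontfun_eqI) (simp add: row_apply)
  show "row i (r *\<^sub>R x) = r *\<^sub>R row i x" for r x
    by (rule bcontfun_eqI) (simp add: row_apply)
  show "norm (row i x) \<le> norm x * 1" for x
    by (rule norm_bound) (simp add: row_apply)
qed

lemma apply_bcontfun_sum:
  fixes f :: "'i \<Rightarrow> nat \<Rightarrow>\<^sub>C 'b::real_normed_vector"
  shows "apply_bcontfun (\<Sum>j\<in>I. f j) k = (\<Sum>j\<in>I. apply_bcontfun (f j) k)"
  by (rule linear_sum[OF bounded_linear.linear[OF bounded_linear_apply_bcontfun]])

lemma null_rows_apply: "w \<in> null_rows n \<Longrightarrow> i \<in> {1..n} \<Longrightarrow> apply_bcontfun w i \<in> null_seqs"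
  by (simp add: null_rows_def)

text \<open>The inverse is the finite sum \<open>J\<close> of the continuous maps that put the coefficients of the
  \<open>i\<close>-th component into row \<open>i\<close>.\<close>

lemma homeomorphic_map_hrows:
  "homeomorphic_map (top_of_set (null_rows n)) (herzog_power_topology \<rho> n) hrows"
proof -
  obtain g where g: "homeomorphic_maps (top_of_set null_seqs) (herzog_topology \<rho>) (hser \<rho>) g"
    using homeomorphic_map_hser unfolding homeomorphic_map_maps by blast
  have hc: "continuous_map (top_of_set null_seqs) (herzog_topology \<rho>) (hser \<rho>)"
    and gc: "continuous_map (herzog_topology \<rho>) (top_of_set null_seqs) g"
    and gh: "\<And>c. c \<in> null_seqs \<Longrightarrow> g (hser \<rho> c) = c"
    and hg: "\<And>f. f \<in> topspace (herzog_topology \<rho>) \<Longrightarrow> hser \<rho> (g f) = f"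
    using g unfolding homeomorphic_maps_def by auto
  define J where "J u = (\<Sum>i\<in>{1..n}. row i (g (u i)))" for u :: "nat \<Rightarrow> real \<Rightarrow> complex"
  have J_apply: "apply_bcontfun (J u) k = (if k \<in> {1..n} then g (u k) else 0)" for u k
    by (simp add: J_def apply_bcontfun_sum row_apply sum.delta)
  have g_null: "g f \<in> null_seqs" if "f \<in> topspace (herzog_topology \<rho>)" for f
    using continuous_map_funspace[OF gc] that by auto
  have Kc: "continuous_map (top_of_set (null_rows n)) (herzog_power_topology \<rho> n) hrows"
    unfolding herzog_power_topology_def continuous_map_componentwise
  proof (intro conjI ballI)
    show "hrows ` topspace (top_of_set (null_rows n)) \<subseteq> extensional {1..n}"
      by (auto simp: hrows_def)
    fix k assume k: "k \<in> {1..n}"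
    have "continuous_map (top_of_set (null_rows n)) (top_of_set null_seqs) (\<lambda>w. apply_bcontfun w k)"
    proof (rule continuous_map_into_subtopology)
      show "continuous_map (top_of_set (null_rows n)) euclidean (\<lambda>w. apply_bcontfun w k)"
        unfolding continuous_map_iff_continuous
        by (rule linear_continuous_on[OF bounded_linear_apply_bcontfun])
    qed (use k null_rows_apply in auto)
    from continuous_map_compose[OF this hc]
    show "continuous_map (top_of_set (null_rows n)) (herzog_topology \<rho>) (\<lambda>w. hrows w k)"
      using k by (simp add: o_def hrows_def)
  qed
  have Jc: "continuous_map (herzog_power_topology \<rho> n) (top_of_set (null_rows n)) J"
  proof (rule continuous_map_into_subtopology)
    have "continuous_map (herzog_power_topology \<rho> n) euclidean (\<lambda>u. row i (g (u i)))" if i: "i \<in> {1..n}" for i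
    proof -
      have "continuous_map (herzog_power_topology \<rho> n) (herzog_topology \<rho>) (\<lambda>u. u i)"
        unfolding herzog_power_topology_def by (rule continuous_map_product_projection[OF i])
      moreover have "continuous_map (herzog_topology \<rho>) euclidean g"
        using gc by (rule continuous_map_into_fulltopology)
      moreover have "continuous_map euclidean euclidean (row i)"
        unfolding continuous_map_iff_continuous2 by (rule linear_continuous_on[OF bounded_linear_row])
      ultimately have "continuous_map (herzog_power_topology \<rho> n) euclidean (row i \<circ> (g \<circ> (\<lambda>u. u i)))"
        by (intro continuous_map_compose)
      then show ?thesis by (simp add: o_def)
    qed
    then show "continuous_map (herzog_power_topology \<rho> n) euclidean J"
      unfolding J_def by (intro continuous_map_sum) auto
    show "J \<in> topspace (herzog_power_topology \<rho> n) \<rightarrow> null_rows n"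
      unfolding null_rows_def
      by (auto simp: J_apply herzog_power_topology_def PiE_iff intro!: g_null)
  qed
  have "homeomorphic_maps (top_of_set (null_rows n)) (herzog_power_topology \<rho> n) hrows J"
    unfolding homeomorphic_maps_def
  proof (intro conjI Kc Jc ballI)
    fix w assume "w \<in> topspace (top_of_set (null_rows n))"
    then have w: "w \<in> null_rows n" by simp
    show "J (hrows w) = w"
    proof (rule bcontfun_eqI)
      fix k
      show "apply_bcontfun (J (hrows w)) k = apply_bcontfun w k"
        using w by (cases "k \<in> {1..n}") (auto simp: J_apply hrows_def null_rows_def intro!: gh)
    qed
  next
    fix u assume u: "u \<in> topspace (herzog_power_topology \<rho> n)"
    show "hrows (J u) = u"
    proof
      fix i
      show "hrows (J u) i = u i"
        using u by (cases "i \<in> {1..n}")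
          (auto simp: hrows_def J_apply herzog_power_topology_def PiE_iff extensional_def intro!: hg)
    qed
  qed
  then show ?thesis unfolding homeomorphic_map_maps by blast
qed

lemma hrows_inj_on: "inj_on hrows (null_rows n)"
  using homeomorphic_imp_injective_map[OF homeomorphic_map_hrows] by simp

lemma hrows_image: "hrows ` null_rows n = topspace (herzog_power_topology \<rho> n)"
  using homeomorphic_imp_surjective_map[OF homeomorphic_map_hrows] by simp

lemma hrows_zero: "hrows 0 = (\<lambda>i\<in>{1..n}. \<lambda>x. 0)"
  by (auto simp: hrows_def hser_zero restrict_def)

lemma hrows_add:
  assumes "w \<in> null_rows n" "w' \<in> null_rows n"
  shows "hrows (w + w') = (\<lambda>i\<in>{1..n}. \<lambda>x. hrows w i x + hrows w' i x)"
proof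
  fix i
  show "hrows (w + w') i = (\<lambda>i\<in>{1..n}. \<lambda>x. hrows w i x + hrows w' i x) i"
    using assms by (cases "i \<in> {1..n}") (auto simp: hrows_def hser_add null_rows_def)
qed

lemma hrows_scale:
  assumes "w \<in> null_rows n"
  shows "hrows (c *\<^sub>C w) = (\<lambda>i\<in>{1..n}. \<lambda>x. c * hrows w i x)"
proof
  fix i
  show "hrows (c *\<^sub>C w) i = (\<lambda>i\<in>{1..n}. \<lambda>x. c * hrows w i x) i"
    using assms by (cases "i \<in> {1..n}") (auto simp: hrows_def hser_scaleC null_rows_def)
qed

lemma pde_operator_hrows:
  assumes w: "w \<in> null_rows n"
  shows "pde_operator \<rho> n m a (hrows w) = hrows (Ad w)"
proof
  fix i
  obtain R where R: "R > \<rho>" "\<And>j. symb j holomorphic_on ball 0 R"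
    using symb_holomorphic by blast
  have rd: "riesz_dunford \<rho> dx (\<lambda>z. poly (pde_p m a j) z / poly (pde_q n m a) z) (hrows w j) =
      hser \<rho> (fs j (apply_bcontfun w j))" if j: "j \<in> {1..n}" for j
    using riesz_dunford_hser[OF R(1) R(2)[of j] null_rows_apply[OF w j]] j
    by (simp add: hrows_def symb_def[abs_def])
  show "pde_operator \<rho> n m a (hrows w) i = hrows (Ad w) i"
  proof (cases "i \<in> {1..n}")
    case True
    show ?thesis
    proof (cases "i < n")
      case True
      then show ?thesis using \<open>i \<in> {1..n}\<close> by (simp add: pde_operator_def hrows_def companion_apply)
    next
      case False
      then have i: "i = n" using True by simp
      have "(\<lambda>x. \<Sum>j=1..n. riesz_dunford \<rho> dx (\<lambda>z. poly (pde_p m a j) z / poly (pde_q n m a) z) (hrows w j) x)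
          = (\<lambda>x. \<Sum>j=1..n. hser \<rho> (fs j (apply_bcontfun w j)) x)"
        by (intro ext sum.cong) (simp_all add: rd)
      also have "\<dots> = hser \<rho> (\<Sum>j=1..n. fs j (apply_bcontfun w j))"
        by (rule hser_sum[symmetric]) (auto intro!: fs_null_seqs null_rows_apply w)
      finally show ?thesis using True i by (simp add: pde_operator_def hrows_def companion_apply)
    qed
  next
    case False
    then show ?thesis by (auto simp: pde_operator_def hrows_def)
  qed
qed

lemma companion_pow_null_rows: "w \<in> null_rows n \<Longrightarrow> (Ad ^^ k) w \<in> null_rows n"
  by (induction k) (auto intro: companion_null_rows)

lemma pde_operator_pow_hrows:
  assumes w: "w \<in> null_rows n"
  shows "(pde_operator \<rho> n m a ^^ k) (hrows w) = hrows ((Ad ^^ k) w)"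
  by (induction k) (simp_all add: pde_operator_hrows companion_pow_null_rows w)

lemma Hausdorff_herzog_power: "Hausdorff_space (herzog_power_topology \<rho> n)"
  unfolding herzog_power_topology_def Hausdorff_space_product_topology herzog_topology_def
  using Metric_space.Hausdorff_space_mtopology[OF Metric_space_herzog[OF \<rho>]] by simp

theorem solution_semigroup_hrows:
  assumes w: "w \<in> null_rows n"
  shows "solution_semigroup \<rho> n m a t (hrows w) = hrows (expop Ad t w)"
proof -
  obtain K where "cbounded_op Ad K" using companion_cbounded_op ..
  then interpret A: cbounded_op "Ad" K .
  define S where "S N = (\<Sum>k<N. of_real (t ^ k / fact k) *\<^sub>C (Ad ^^ k) w)" for N
  have S_null: "S N \<in> null_rows n" for N
    unfolding S_def by (intro csubspaceD[OF csubspace_null_rows] companion_pow_null_rows w)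
  have lim_null: "expop Ad t w \<in> null_rows n"
    by (rule A.expop_invariant[OF closed_null_rows csubspace_null_rows companion_null_rows w])
  have S_lim: "S \<longlonglongrightarrow> expop Ad t w"
    using A.expop_sums[of t w] by (simp add: sums_def S_def[abs_def])
  have partial: "(\<lambda>i\<in>{1..n}. \<lambda>x. \<Sum>k<N. of_real (t ^ k / fact k) *
      (pde_operator \<rho> n m a ^^ k) (hrows w) i x) = hrows (S N)" for N
  proof
    fix i
    show "(\<lambda>i\<in>{1..n}. \<lambda>x. \<Sum>k<N. of_real (t ^ k / fact k) *
      (pde_operator \<rho> n m a ^^ k) (hrows w) i x) i = hrows (S N) i"
    proof (cases "i \<in> {1..n}")
      case True
      have mem: "apply_bcontfun ((Ad ^^ k) w) i \<in> null_seqs" for k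
        by (intro null_rows_apply companion_pow_null_rows w True)
      have "hrows (S N) i = hser \<rho> (\<Sum>k<N. of_real (t ^ k / fact k) *\<^sub>C
          apply_bcontfun ((Ad ^^ k) w) i)"
        using True by (simp add: hrows_def S_def apply_bcontfun_sum)
      also have "\<dots> = (\<lambda>x. \<Sum>k<N. hser \<rho> (of_real (t ^ k / fact k) *\<^sub>C
          apply_bcontfun ((Ad ^^ k) w) i) x)"
        by (rule hser_sum) (auto intro!: csubspaceD(4)[OF csubspace_null_seqs] mem)
      also have "\<dots> = (\<lambda>x. \<Sum>k<N. of_real (t ^ k / fact k) *
          (pde_operator \<rho> n m a ^^ k) (hrows w) i x)"
        using True
        by (intro ext sum.cong refl, simp only: hser_scaleC[OF mem] pde_operator_pow_hrows[OF w])
          (simp add: hrows_def)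
      finally show ?thesis using True by simp
    next
      case False
      then show ?thesis unfolding hrows_def restrict_def by (simp only: if_False)
    qed
  qed
  have "limitin (top_of_set (null_rows n)) S (expop Ad t w) sequentially"
    using S_lim S_null lim_null by (simp add: limitin_subtopology)
  from continuous_map_limit[OF homeomorphic_imp_continuous_map[OF homeomorphic_map_hrows] this]
  have lim: "limitin (herzog_power_topology \<rho> n) (\<lambda>N. hrows (S N))
      (hrows (expop Ad t w)) sequentially"
    by (simp add: o_def)
  show ?thesis
    unfolding solution_semigroup_def herzog_exp_def partial
  proof (rule the_equality[where P = "\<lambda>v. limitin (herzog_power_topology \<rho> n) (\<lambda>N. hrows (S N)) v sequentially"])
    show "v = hrows (expop Ad t w)"
      if "limitin (herzog_power_topology \<rho> n) (\<lambda>N. hrows (S N)) v sequentially" for v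
      by (rule limitin_Hausdorff_unique[OF that lim sequentially_bot Hausdorff_herzog_power])
  qed (rule lim)
qed

lemma herzog_closed_subspace_hrows:
  assumes Y: "Y \<subseteq> null_rows n"
  shows "herzog_closed_subspace \<rho> n (hrows ` Y) \<longleftrightarrow> closed Y \<and> csubspace Y"
proof -
  have mem: "hrows w \<in> hrows ` Y \<longleftrightarrow> w \<in> Y" if "w \<in> null_rows n" for w
    using inj_on_image_mem_iff[OF hrows_inj_on that Y] .
  note cs = csubspaceD[OF csubspace_null_rows]
  have "closedin (herzog_power_topology \<rho> n) (hrows ` Y) \<longleftrightarrow> closedin (top_of_set (null_rows n)) Y"
    using homeomorphic_map_closedness_eq[OF homeomorphic_map_hrows, of Y] Y by simp
  also have "\<dots> \<longleftrightarrow> closed Y"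
    using closedin_closed_eq[OF closed_null_rows[of n]] Y by blast
  finally have 1: "closedin (herzog_power_topology \<rho> n) (hrows ` Y) \<longleftrightarrow> closed Y" .
  have 2: "(\<lambda>i\<in>{1..n}. \<lambda>x. 0) \<in> hrows ` Y \<longleftrightarrow> 0 \<in> Y"
    unfolding hrows_zero[symmetric] by (rule mem[OF cs(1)])
  have 3: "(\<forall>u\<in>hrows ` Y. \<forall>v\<in>hrows ` Y. (\<lambda>i\<in>{1..n}. \<lambda>x. u i x + v i x) \<in> hrows ` Y) \<longleftrightarrow>
      (\<forall>w\<in>Y. \<forall>w'\<in>Y. w + w' \<in> Y)"
  proof -
    have "(\<lambda>i\<in>{1..n}. \<lambda>x. hrows w i x + hrows w' i x) \<in> hrows ` Y \<longleftrightarrow> w + w' \<in> Y"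
      if "w \<in> Y" "w' \<in> Y" for w w'
      using that Y mem[OF cs(2), of w w'] hrows_add[of w w'] by auto
    then show ?thesis by simp
  qed
  have 4: "(\<forall>c. \<forall>u\<in>hrows ` Y. (\<lambda>i\<in>{1..n}. \<lambda>x. c * u i x) \<in> hrows ` Y) \<longleftrightarrow>
      (\<forall>c. \<forall>w\<in>Y. c *\<^sub>C w \<in> Y)"
  proof -
    have "(\<lambda>i\<in>{1..n}. \<lambda>x. c * hrows w i x) \<in> hrows ` Y \<longleftrightarrow> c *\<^sub>C w \<in> Y" if "w \<in> Y" for c w
      using that Y mem[OF cs(4), of w c] hrows_scale[of w c] by auto
    then show ?thesis by simp
  qed
  have 5: "csubspace Y \<longleftrightarrow> 0 \<in> Y \<and> (\<forall>w\<in>Y. \<forall>w'\<in>Y. w + w' \<in> Y) \<and> (\<forall>c. \<forall>w\<in>Y. c *\<^sub>C w \<in> Y)"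
    by (auto simp: csubspace_def subspace_def scaleC_of_real[symmetric])
  show ?thesis unfolding herzog_closed_subspace_def 1 2 3 4 5 by blast
qed

lemma closure_hrows_eq_iff:
  assumes "S \<subseteq> Y" "Y \<subseteq> null_rows n"
  shows "subtopology (herzog_power_topology \<rho> n) (hrows ` Y) closure_of (hrows ` S) = hrows ` Y
    \<longleftrightarrow> Y \<subseteq> closure S"
proof -
  have "subtopology (herzog_power_topology \<rho> n) (hrows ` Y) closure_of (hrows ` S) =
      hrows ` Y \<inter> herzog_power_topology \<rho> n closure_of (hrows ` S)"
    using assms by (simp add: closure_of_subtopology Int_absorb1 image_mono)
  also have "herzog_power_topology \<rho> n closure_of (hrows ` S) =
      hrows ` (top_of_set (null_rows n) closure_of S)"
    by (rule homeomorphic_map_closure_of[OF homeomorphic_map_hrows]) (use assms in simp)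
  also have "top_of_set (null_rows n) closure_of S = null_rows n \<inter> closure S"
    using assms by (simp add: closure_of_subtopology Int_absorb1)
  also have "hrows ` Y \<inter> hrows ` (null_rows n \<inter> closure S) = hrows ` (Y \<inter> (null_rows n \<inter> closure S))"
    by (rule inj_on_image_Int[OF hrows_inj_on, symmetric]) (use assms in auto)
  also have "Y \<inter> (null_rows n \<inter> closure S) = Y \<inter> closure S" using assms by auto
  also have "hrows ` (Y \<inter> closure S) = hrows ` Y \<longleftrightarrow> Y \<inter> closure S = Y"
    by (rule inj_on_image_eq_iff[OF hrows_inj_on]) (use assms in auto)
  finally show ?thesis by auto
qed

lemma first_coordinate_dense_iff:
  assumes Y: "Y \<subseteq> null_rows n"
  shows "herzog_topology \<rho> closure_of ((\<lambda>u. u 1) ` hrows ` Y) = herzog_space \<rho> \<longleftrightarrow>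
    null_seqs \<subseteq> closure ((\<lambda>w. apply_bcontfun w 1) ` Y)"
proof -
  let ?S = "(\<lambda>w. apply_bcontfun w 1) ` Y"
  have S: "?S \<subseteq> null_seqs" using Y null_rows_apply n by auto
  have "(\<lambda>u. u 1) ` hrows ` Y = hser \<rho> ` ?S"
    using n by (simp add: image_image hrows_def)
  then have "herzog_topology \<rho> closure_of ((\<lambda>u. u 1) ` hrows ` Y) =
      hser \<rho> ` (top_of_set null_seqs closure_of ?S)"
    using homeomorphic_map_closure_of[OF homeomorphic_map_hser, of ?S] S by simp
  also have "top_of_set null_seqs closure_of ?S = null_seqs \<inter> closure ?S"
    using S by (simp add: closure_of_subtopology Int_absorb1)
  also have "hser \<rho> ` (null_seqs \<inter> closure ?S) = herzog_space \<rho> \<longleftrightarrow> null_seqs \<inter> closure ?S = null_seqs"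
    unfolding herzog_space_eq by (rule inj_on_image_eq_iff[OF hser_inj_on[OF \<rho>]]) auto
  finally show ?thesis by auto
qed

lemma chaotic_hrows_iff:
  assumes Y: "Y \<subseteq> null_rows n"
  defines "T \<equiv> solution_semigroup \<rho> n m a"
  shows "herzog_closed_subspace \<rho> n (hrows ` Y) \<and> hrows ` Y \<noteq> {(\<lambda>i\<in>{1..n}. \<lambda>x. 0)} \<and>
      (\<forall>t\<ge>0. T t ` (hrows ` Y) \<subseteq> hrows ` Y) \<and>
      devaney_chaotic (subtopology (herzog_power_topology \<rho> n) (hrows ` Y)) T \<and>
      herzog_topology \<rho> closure_of ((\<lambda>u. u 1) ` (hrows ` Y)) = herzog_space \<rho>
    \<longleftrightarrow> chaotic_subspace Y" (is "?lhs \<longleftrightarrow> _")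
proof -
  let ?E = "expop Ad"
  obtain K where "cbounded_op Ad K" using companion_cbounded_op ..
  then interpret A: cbounded_op "Ad" K .
  have E_null: "?E t w \<in> null_rows n" if "w \<in> null_rows n" for t w
    by (rule A.expop_invariant[OF closed_null_rows csubspace_null_rows companion_null_rows that])
  have T: "T t (hrows w) = hrows (?E t w)" if "w \<in> Y" for t w
    unfolding T_def by (rule solution_semigroup_hrows) (use Y that in auto)
  have mem: "hrows w \<in> hrows ` Y \<longleftrightarrow> w \<in> Y" if "w \<in> null_rows n" for w
    using inj_on_image_mem_iff[OF hrows_inj_on that Y] .
  have "hrows ` Y = {hrows 0} \<longleftrightarrow> Y = {0}"
    using inj_on_image_eq_iff[OF hrows_inj_on Y, of "{0}"] csubspaceD(1)[OF csubspace_null_rows] by simp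
  then have nz: "hrows ` Y \<noteq> {(\<lambda>i\<in>{1..n}. \<lambda>x. 0)} \<longleftrightarrow> Y \<noteq> {0}" by (simp only: hrows_zero)
  have inv: "(\<forall>t\<ge>0. T t ` (hrows ` Y) \<subseteq> hrows ` Y) \<longleftrightarrow> (\<forall>t\<ge>0. \<forall>w\<in>Y. ?E t w \<in> Y)"
  proof -
    have "T t (hrows w) \<in> hrows ` Y \<longleftrightarrow> ?E t w \<in> Y" if "w \<in> Y" for t w
      using T[OF that] mem[OF E_null] Y that by auto
    then show ?thesis by (simp add: image_subset_iff)
  qed
  have top: "topspace (subtopology (herzog_power_topology \<rho> n) (hrows ` Y)) = hrows ` Y"
    using image_mono[OF Y, of hrows] hrows_image by (simp add: Int_absorb1)
  have orbit: "subtopology (herzog_power_topology \<rho> n) (hrows ` Y) closure_of {T t (hrows w) |t. t \<ge> 0}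
      = hrows ` Y \<longleftrightarrow> Y \<subseteq> closure {?E t w |t. t \<ge> 0}"
    if "\<forall>t\<ge>0. \<forall>w\<in>Y. ?E t w \<in> Y" "w \<in> Y" for w
  proof -
    have "{T t (hrows w) |t. t \<ge> 0} = hrows ` {?E t w |t. t \<ge> 0}"
      using T[OF \<open>w \<in> Y\<close>] by (auto simp: image_iff)
    moreover have "{?E t w |t. t \<ge> 0} \<subseteq> Y" using that by auto
    ultimately show ?thesis using closure_hrows_eq_iff[OF _ Y] by simp
  qed
  have "{x \<in> hrows ` Y. \<exists>t>0. T t x = x} = hrows ` {w \<in> Y. \<exists>t>0. ?E t w = w}"
  proof -
    have "T t (hrows w) = hrows w \<longleftrightarrow> ?E t w = w" if "w \<in> Y" for t w
      using T[OF that] inj_on_eq_iff[OF hrows_inj_on E_null[of w t], of w] that Y by auto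
    then show ?thesis by auto
  qed
  then have per: "subtopology (herzog_power_topology \<rho> n) (hrows ` Y) closure_of
      {x \<in> hrows ` Y. \<exists>t>0. T t x = x} = hrows ` Y \<longleftrightarrow> Y \<subseteq> closure {w \<in> Y. \<exists>t>0. ?E t w = w}"
    using closure_hrows_eq_iff[of "{w \<in> Y. \<exists>t>0. ?E t w = w}" Y] Y by auto
  have chaos: "devaney_chaotic (subtopology (herzog_power_topology \<rho> n) (hrows ` Y)) T \<longleftrightarrow>
      (\<exists>w\<in>Y. Y \<subseteq> closure {?E t w |t. t \<ge> 0}) \<and> Y \<subseteq> closure {w \<in> Y. \<exists>t>0. ?E t w = w}"
    if i: "\<forall>t\<ge>0. \<forall>w\<in>Y. ?E t w \<in> Y"
  proof -
    have "(\<exists>x\<in>hrows ` Y. subtopology (herzog_power_topology \<rho> n) (hrows ` Y) closure_of {T t x |t. t \<ge> 0}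
        = hrows ` Y) \<longleftrightarrow> (\<exists>w\<in>Y. Y \<subseteq> closure {?E t w |t. t \<ge> 0})"
      using orbit[OF i] by simp
    then show ?thesis unfolding devaney_chaotic_def top per by (simp only:)
  qed
  show ?thesis
    unfolding chaotic_subspace_def herzog_closed_subspace_hrows[OF Y] nz inv first_coordinate_dense_iff[OF Y]
    using chaos Y by blast
qed

theorem projection_family_chaotic_iff:
  "projection_family_chaotic \<rho> n (solution_semigroup \<rho> n m a) \<longleftrightarrow> (\<exists>Y. chaotic_subspace Y)"
proof
  assume "\<exists>Y. chaotic_subspace Y"
  then obtain Y where Y: "chaotic_subspace Y" ..
  then have "Y \<subseteq> null_rows n" by (simp add: chaotic_subspace_def)
  from chaotic_hrows_iff[OF this] Y
  show "projection_family_chaotic \<rho> n (solution_semigroup \<rho> n m a)"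
    unfolding projection_family_chaotic_def by (intro exI[of _ "hrows ` Y"]) simp
next
  assume "projection_family_chaotic \<rho> n (solution_semigroup \<rho> n m a)"
  then obtain V where V: "herzog_closed_subspace \<rho> n V \<and> V \<noteq> {(\<lambda>i\<in>{1..n}. \<lambda>x. 0)} \<and>
      (\<forall>t\<ge>0. solution_semigroup \<rho> n m a t ` V \<subseteq> V) \<and>
      devaney_chaotic (subtopology (herzog_power_topology \<rho> n) V) (solution_semigroup \<rho> n m a) \<and>
      herzog_topology \<rho> closure_of ((\<lambda>u. u 1) ` V) = herzog_space \<rho>"
    unfolding projection_family_chaotic_def ..
  define Y where "Y = {w \<in> null_rows n. hrows w \<in> V}"
  have "V \<subseteq> hrows ` null_rows n"
    using V unfolding hrows_image herzog_closed_subspace_def by (blast dest: closedin_subset)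
  then have "V = hrows ` Y" by (auto simp: Y_def)
  moreover have "Y \<subseteq> null_rows n" by (auto simp: Y_def)
  ultimately have "chaotic_subspace Y" using chaotic_hrows_iff[of Y] V by simp
  then show "\<exists>Y. chaotic_subspace Y" ..
qed

end

theorem corollary4p11:
  fixes n m :: nat and a :: "nat \<Rightarrow> nat \<Rightarrow> complex" and \<rho> :: real
  assumes "n \<ge> 1" and "m \<ge> 1" and "\<rho> > 0"
    and "{z. poly (pde_q n m a) z = 0} \<subseteq> - cball 0 \<rho>"
    and "finite {\<mu>. disc_z n m a \<mu> = 0}"
  shows "projection_family_chaotic \<rho> n (solution_semigroup \<rho> n m a) \<longleftrightarrow>
    (\<exists>\<mu>\<^sub>0 z\<^sub>0. Re \<mu>\<^sub>0 = 0 \<and> z\<^sub>0 \<in> ball 0 \<rho> \<and>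
       poly (pde_P n m a \<mu>\<^sub>0) z\<^sub>0 = 0 \<and> disc_z n m a \<mu>\<^sub>0 \<noteq> 0)"
proof -
  interpret pde \<rho> n m a by unfold_locales (use assms in auto)
  show ?thesis
    unfolding projection_family_chaotic_iff by (rule chaotic_subspace_iff[OF assms(5)])
qed

end
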